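(* Let $b\in\mathbb{C}$ and let $P:\mathbb{C}^2\to\mathbb{C}^2$ be a holomorphic map whose 2-jet at the origin is $$(J_0^2P)(z,w)=(z-z^2,\;w+w^2+bz^2).$$ Then: (1) if $b\in(\tfrac14,+\infty)$, the map $P$ has an invariant spiral domain; (2) if $b\in\mathbb{C}\setminus(\tfrac14,+\infty)$, the map $P$ has an invariant parabolic domain $\Omega$ that is tangent to one of the non-degenerate characteristic directions of $P$.
   Context: A parabolic domain of $P$ is a maximal invariant connected domain $\Omega\subset\mathbb{C}^2$ such that the origin belongs to $\partial\Omega$ and the iterates $P^n|_\Omega$ converge locally uniformly on $\Omega$ to the origin. A parabolic domain is tangent to a direction $v$ if every point of the domain is attracted to the origin along a trajectory tangent to $v$, i.e. $[P^n(x)]\to[v]$ in $\mathbb{P}^1$ for every $x$ in the domain. An invariant parabolic domain that is not tangent to any direction is called a spiral domain. Writing $P=\mathrm{Id}+P_2+O(\|(z,w)\|^3)$ with $P_2(z,w)=(-z^2,w^2+bz^2)$, a characteristic direction of $P$ is a vector $v\in\mathbb{C}^2\setminus\{0\}$ with $P_2(v)=\lambda v$ for some $\lambda\in\mathbb{C}$; it is non-degenerate if $\lambda\neq0$. *)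

theory Defs
  imports "HOL-Analysis.Analysis" "HOL-Library.Landau_Symbols"
begin

section \<open>Holomorphic self-maps of \<open>\<complex>\<^sup>2\<close>\<close>

type_synonym C2 = "complex \<times> complex"

text \<open>Complex scaling; the library's \<open>*\<^sub>R\<close> on pairs is only the real one.\<close>

definition cscale :: "complex \<Rightarrow> C2 \<Rightarrow> C2" where
  "cscale c v = (c * fst v, c * snd v)"

text \<open>Entire: Frechet differentiable everywhere, with complex linear derivative (real
  linearity is part of \<open>has_derivative\<close>).\<close>

definition holomorphic_C2 :: "(C2 \<Rightarrow> C2) \<Rightarrow> bool" where
  "holomorphic_C2 P \<longleftrightarrow>
     (\<forall>x. \<exists>D. (P has_derivative D) (at x) \<and> (\<forall>c v. D (cscale c v) = cscale c (D v)))"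

text \<open>A smooth map has 2-jet \<open>J\<close> (a polynomial map of degree at most 2) at the origin iff
  \<open>P = J + O(\<parallel>x\<parallel>\<^sup>3)\<close>. The filter \<open>nhds 0\<close> includes the origin itself.\<close>

definition has_two_jet_at_0 :: "(C2 \<Rightarrow> C2) \<Rightarrow> (C2 \<Rightarrow> C2) \<Rightarrow> bool" where
  "has_two_jet_at_0 P J \<longleftrightarrow>
     (\<lambda>x. norm (P x - J x)) \<in> O[nhds 0](\<lambda>x. norm x ^ 3)"

text \<open>The homogeneous part \<open>P\<^sub>2\<close> of degree 2, so that \<open>P = Id + P\<^sub>2 + O(\<parallel>x\<parallel>\<^sup>3)\<close>.\<close>

definition P2 :: "complex \<Rightarrow> C2 \<Rightarrow> C2" where
  "P2 b = (\<lambda>(z, w). (- (z^2), w^2 + b * z^2))"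

definition nondegenerate_characteristic_direction :: "(C2 \<Rightarrow> C2) \<Rightarrow> C2 \<Rightarrow> bool" where
  "nondegenerate_characteristic_direction Q v \<longleftrightarrow>
     v \<noteq> 0 \<and> (\<exists>l. Q v = cscale l v \<and> l \<noteq> 0)"


section \<open>The complex projective line\<close>

text \<open>The point \<open>[v]\<close> is the complex line spanned by \<open>v \<noteq> 0\<close>. The topology is the quotient
  topology from \<open>\<complex>\<^sup>2 - {0}\<close>.\<close>

definition complex_line :: "C2 \<Rightarrow> C2 set" where
  "complex_line v = range (\<lambda>c. cscale c v)"

definition P1_topology :: "C2 set topology" where
  "P1_topology = topology (\<lambda>U. U \<subseteq> complex_line ` (- {0}) \<and>
     openin (top_of_set (- {0})) {v \<in> - {0}. complex_line v \<in> U})"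

lemma openin_P1_topology:
  "openin P1_topology U \<longleftrightarrow> U \<subseteq> complex_line ` (- {0}) \<and>
     openin (top_of_set (- {0})) {v \<in> - {0}. complex_line v \<in> U}"
proof -
  have "istopology (\<lambda>U. U \<subseteq> complex_line ` (- {0}) \<and>
     openin (top_of_set (- {0})) {v \<in> - {0}. complex_line v \<in> U})" (is "istopology ?L")
    unfolding istopology_def
  proof (intro conjI allI impI)
    fix S T assume S: "?L S" and T: "?L T"
    then show "S \<inter> T \<subseteq> complex_line ` (- {0})" by blast
    have "{v \<in> - {0}. complex_line v \<in> S \<inter> T}
        = {v \<in> - {0}. complex_line v \<in> S} \<inter> {v \<in> - {0}. complex_line v \<in> T}" by blast
    with S T show "openin (top_of_set (- {0})) {v \<in> - {0}. complex_line v \<in> S \<inter> T}"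
      by (simp only: openin_Int)
  next
    fix \<K> assume K: "\<forall>K\<in>\<K>. ?L K"
    then show "\<Union>\<K> \<subseteq> complex_line ` (- {0})" by blast
    have "{v \<in> - {0}. complex_line v \<in> \<Union>\<K>} = \<Union>((\<lambda>K. {v \<in> - {0}. complex_line v \<in> K}) ` \<K>)"
      by blast
    moreover have "openin (top_of_set (- {0})) (\<Union>((\<lambda>K. {v \<in> - {0}. complex_line v \<in> K}) ` \<K>))"
      by (rule openin_Union) (use K in blast)
    ultimately show "openin (top_of_set (- {0})) {v \<in> - {0}. complex_line v \<in> \<Union>\<K>}"
      by (simp only:)
  qed
  then show ?thesis
    by (simp only: P1_topology_def topology_inverse')
qed

lemma topspace_P1_topology: "topspace P1_topology = complex_line ` (- {0})"
proof -
  have "{v \<in> - {0}. complex_line v \<in> complex_line ` (- {0})} = - {0}" by blast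
  then have "openin P1_topology (complex_line ` (- {0}))"
    by (simp only: openin_P1_topology openin_subtopology_self) simp
  then show ?thesis
    by (metis openin_P1_topology openin_subset openin_topspace subset_antisym)
qed

lemma quotient_map_complex_line:
  "quotient_map (top_of_set (- {0})) P1_topology complex_line"
  by (auto simp: quotient_map_def topspace_P1_topology openin_P1_topology)


section \<open>Parabolic and spiral domains\<close>

text \<open>Invariance is forward invariance \<open>P(\<Omega>) \<subseteq> \<Omega>\<close>.\<close>

definition invariant_attracted_domain :: "(C2 \<Rightarrow> C2) \<Rightarrow> C2 set \<Rightarrow> bool" where
  "invariant_attracted_domain P \<Omega> \<longleftrightarrow>
     open \<Omega> \<and> connected \<Omega> \<and> P ` \<Omega> \<subseteq> \<Omega> \<and> 0 \<in> frontier \<Omega> \<and>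
     (\<forall>x\<in>\<Omega>. \<exists>U. open U \<and> x \<in> U \<and> U \<subseteq> \<Omega> \<and>
        uniform_limit U (\<lambda>n. P ^^ n) (\<lambda>_. 0) sequentially)"

definition parabolic_domain :: "(C2 \<Rightarrow> C2) \<Rightarrow> C2 set \<Rightarrow> bool" where
  "parabolic_domain P \<Omega> \<longleftrightarrow> invariant_attracted_domain P \<Omega> \<and>
     (\<forall>\<Omega>'. invariant_attracted_domain P \<Omega>' \<and> \<Omega> \<subseteq> \<Omega>' \<longrightarrow> \<Omega>' = \<Omega>)"

text \<open>The classes \<open>[P\<^sup>n(x)]\<close> are well defined: the open set \<open>\<Omega>\<close> is invariant and does not
  contain its frontier point \<open>0\<close>.\<close>

definition parabolic_domain_tangent_to :: "(C2 \<Rightarrow> C2) \<Rightarrow> C2 set \<Rightarrow> C2 \<Rightarrow> bool" where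
  "parabolic_domain_tangent_to P \<Omega> v \<longleftrightarrow> parabolic_domain P \<Omega> \<and> v \<noteq> 0 \<and>
     (\<forall>x\<in>\<Omega>. limitin P1_topology (\<lambda>n. complex_line ((P ^^ n) x)) (complex_line v) sequentially)"

definition spiral_domain :: "(C2 \<Rightarrow> C2) \<Rightarrow> C2 set \<Rightarrow> bool" where
  "spiral_domain P \<Omega> \<longleftrightarrow>
     parabolic_domain P \<Omega> \<and> \<not> (\<exists>v. parabolic_domain_tangent_to P \<Omega> v)"

end

theory Submission
  imports Defs "HOL-Complex_Analysis.Great_Picard"
begin

text \<open>
  In the coordinates \<open>a = 1 / z\<close>, \<open>u = w / z\<close> the map is \<open>a \<mapsto> a + 1 + O(1/a)\<close>,
  \<open>u \<mapsto> u + (u\<^sup>2 + u + b) / a + O(1/a\<^sup>2)\<close>. Since \<open>a\<close> grows like \<open>n\<close>, the slope \<open>u\<close> follows, in the time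
  \<open>log n\<close> and up to summable errors, the flow of the vector field \<open>u\<^sup>2 + u + b\<close>. Its zeros
  \<open>(- 1 \<plusminus> \<kappa>) / 2\<close>, \<open>\<kappa>\<^sup>2 = 1 - 4 b\<close>, are the slopes of the non-degenerate characteristic directions other
  than the vertical one. For \<open>b\<close> outside \<open>[1/4, \<infinity>)\<close> one zero is attracting; for \<open>b = 1/4\<close> there is a double
  zero, which attracts a half plane of the time coordinate \<open>- 1 / (u + 1/2)\<close>; for \<open>b > 1/4\<close> both zeros are
  centres, and because the harmonic series diverges the slopes rotate around them for ever. In each
  case an explicit forward invariant region (the locales \<open>mobius_germ\<close>, \<open>double_root_germ\<close>) gives an
  attracted domain, and Zorn's lemma puts it into a maximal one.

  For \<open>b > 1/4\<close> one orbit with rotating slope shows that this maximal domain is not tangent to any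
  direction. In the other cases the orbits in the explicit region are tangent to \<open>(1, t)\<close>, and the point
  is to extend this to the maximal domain \<open>\<Omega>\<close>, about which nothing is known but that \<open>P\<^sup>n\<close> tends to 0
  locally uniformly on it (theorem \<open>tangency_propagates\<close>). This follows from Montel's theorem and the
  identity theorem once the logarithmic derivatives \<open>\<parallel>(P\<^sup>n)'\<parallel> / \<parallel>P\<^sup>n\<parallel>\<close> are locally bounded on \<open>\<Omega>\<close> uniformly in
  \<open>n\<close> (theorem \<open>log_derivative_bound\<close>).

  To prove that bound, suppose that it fails. A Brody rescaling at the first time at which the
  logarithmic derivatives become large (lemma \<open>brody_rescaling\<close>) yields a nonconstant entire curve as
  the limit of \<open>P\<^sup>n / r\<close>, where \<open>r\<close> is the norm at the centre. As the bounds hold at all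
  earlier times too, the curves \<open>P\<^sup>m / r\<close> with \<open>n - \<sigma> / r \<le> m \<le> n\<close> are locally bounded as well. At this scale
  \<open>P\<close> acts like the flow of \<open>z' = - z\<^sup>2\<close>, \<open>w' = w\<^sup>2 + b z\<^sup>2\<close>, whose backward solutions reach infinity from
  positions that depend on the elapsed time \<open>\<sigma>\<close>. Hence the limit curve omits these positions for all
  small \<open>\<sigma>\<close>, first in the coordinate \<open>z\<close>, which satisfies an autonomous equation, and then in \<open>w\<close>; by
  little Picard it is constant (lemma \<open>rescaled_limit_constant\<close>), a contradiction.
\<close>

section \<open>Holomorphic curves\<close>

definition holomorphic_curve :: "(complex \<Rightarrow> C2) \<Rightarrow> bool" where
  "holomorphic_curve f \<longleftrightarrow>
     (\<lambda>\<xi>. fst (f \<xi>)) holomorphic_on UNIV \<and> (\<lambda>\<xi>. snd (f \<xi>)) holomorphic_on UNIV"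

definition curve_deriv :: "(complex \<Rightarrow> C2) \<Rightarrow> complex \<Rightarrow> C2" where
  "curve_deriv f \<xi> = (deriv (\<lambda>\<xi>. fst (f \<xi>)) \<xi>, deriv (\<lambda>\<xi>. snd (f \<xi>)) \<xi>)"

lemma norm_cscale: "norm (cscale c v) = cmod c * norm v"
  by (cases v) (simp add: cscale_def norm_Pair norm_mult power_mult_distrib real_sqrt_mult
      flip: distrib_left)

lemma has_derivative_curve:
  assumes "holomorphic_curve f"
  shows "(f has_derivative (\<lambda>h. cscale h (curve_deriv f \<xi>))) (at \<xi>)"
proof -
  have "((\<lambda>\<xi>. fst (f \<xi>)) has_field_derivative fst (curve_deriv f \<xi>)) (at \<xi>)"
    "((\<lambda>\<xi>. snd (f \<xi>)) has_field_derivative snd (curve_deriv f \<xi>)) (at \<xi>)"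
    using assms by (auto simp: holomorphic_curve_def curve_deriv_def intro: holomorphic_derivI)
  from has_derivative_Pair[OF this[unfolded has_field_derivative_def]]
  show ?thesis by (simp add: cscale_def mult.commute)
qed

lemma holomorphic_curve_continuous:
  "holomorphic_curve f \<Longrightarrow> continuous_on S f"
  by (meson has_derivative_curve has_derivative_at_withinI has_derivative_continuous_on)

lemma curve_deriv_continuous:
  assumes "holomorphic_curve f"
  shows "continuous_on S (curve_deriv f)"
proof -
  have "continuous_on UNIV (curve_deriv f)"
    unfolding curve_deriv_def using assms
    by (auto simp: holomorphic_curve_def intro!: continuous_on_Pair holomorphic_on_imp_continuous_on
        holomorphic_deriv)
  then show ?thesis by (rule continuous_on_subset) simp
qed

lemma curve_derivI:
  assumes "\<And>\<xi>. (f has_derivative (\<lambda>h. cscale h (f' \<xi>))) (at \<xi>)"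
  shows "holomorphic_curve f" "curve_deriv f = f'"
proof -
  have *: "((\<lambda>\<xi>. fst (f \<xi>)) has_field_derivative fst (f' \<xi>)) (at \<xi>)"
    "((\<lambda>\<xi>. snd (f \<xi>)) has_field_derivative snd (f' \<xi>)) (at \<xi>)" for \<xi>
    using has_derivative_fst[OF assms[of \<xi>]] has_derivative_snd[OF assms[of \<xi>]]
    by (simp_all add: cscale_def has_field_derivative_def mult_commute_abs)
  then show "holomorphic_curve f"
    unfolding holomorphic_curve_def
    by (metis UNIV_I field_differentiable_at_within field_differentiable_def holomorphic_on_def)
  show "curve_deriv f = f'"
    by (rule ext) (simp add: curve_deriv_def DERIV_imp_deriv[OF *(1)] DERIV_imp_deriv[OF *(2)])
qed

lemma holomorphic_curve_compose:
  assumes "holomorphic_C2 P" "holomorphic_curve f"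
  shows "holomorphic_curve (\<lambda>\<xi>. P (f \<xi>))"
proof -
  obtain D where D: "\<And>x. (P has_derivative D x) (at x)"
      "\<And>x c v. D x (cscale c v) = cscale c (D x v)"
    using assms(1) unfolding holomorphic_C2_def by metis
  have "((\<lambda>\<xi>. P (f \<xi>)) has_derivative (\<lambda>h. cscale h (D (f \<xi>) (curve_deriv f \<xi>)))) (at \<xi>)" for \<xi>
    using has_derivative_compose[OF has_derivative_curve[OF assms(2)] D(1)] by (simp add: D(2))
  then show ?thesis by (rule curve_derivI)
qed

lemma curve_affine:
  assumes "holomorphic_curve f"
  shows "holomorphic_curve (\<lambda>\<eta>. f (a + \<rho> * \<eta>))"
    "curve_deriv (\<lambda>\<eta>. f (a + \<rho> * \<eta>)) = (\<lambda>\<eta>. cscale \<rho> (curve_deriv f (a + \<rho> * \<eta>)))"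
proof -
  have "((\<lambda>\<eta>. f (a + \<rho> * \<eta>)) has_derivative
      (\<lambda>h. cscale h (cscale \<rho> (curve_deriv f (a + \<rho> * \<eta>))))) (at \<eta>)" for \<eta>
  proof -
    have "((\<lambda>\<eta>. a + \<rho> * \<eta>) has_derivative (\<lambda>h. \<rho> * h)) (at \<eta>)"
      by (auto intro!: derivative_eq_intros)
    from has_derivative_compose[OF this has_derivative_curve[OF assms]]
    show ?thesis by (simp add: cscale_def ac_simps)
  qed
  then show "holomorphic_curve (\<lambda>\<eta>. f (a + \<rho> * \<eta>))"
    "curve_deriv (\<lambda>\<eta>. f (a + \<rho> * \<eta>)) = (\<lambda>\<eta>. cscale \<rho> (curve_deriv f (a + \<rho> * \<eta>)))"
    by (rule curve_derivI)+
qed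

text \<open>Cauchy-Schwarz makes \<open>\<parallel>\<gamma>\<parallel>\<^sup>2 exp (- 2 M s)\<close> nonincreasing.\<close>

lemma gronwall_norm:
  fixes \<gamma> :: "real \<Rightarrow> 'a::real_inner"
  assumes d: "\<And>s. 0 \<le> s \<Longrightarrow> s \<le> 1 \<Longrightarrow> (\<gamma> has_vector_derivative \<gamma>' s) (at s)"
    and le: "\<And>s. 0 \<le> s \<Longrightarrow> s \<le> 1 \<Longrightarrow> norm (\<gamma>' s) \<le> M * norm (\<gamma> s)"
  shows "norm (\<gamma> 1) \<le> exp M * norm (\<gamma> 0)"
proof -
  define h where "h s = (\<gamma> s \<bullet> \<gamma> s) * exp (- (2 * M * s))" for s
  have "h 1 \<le> h 0"
  proof (rule DERIV_nonpos_imp_nonincreasing[of 0 1 h])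
    fix s :: real assume s: "0 \<le> s" "s \<le> 1"
    have "((\<lambda>s. \<gamma> s \<bullet> \<gamma> s) has_derivative (\<lambda>t. \<gamma> s \<bullet> (t *\<^sub>R \<gamma>' s) + (t *\<^sub>R \<gamma>' s) \<bullet> \<gamma> s)) (at s)"
      using d[OF s] unfolding has_vector_derivative_def
      by (intro has_derivative_inner)
    then have *: "((\<lambda>s. \<gamma> s \<bullet> \<gamma> s) has_real_derivative 2 * (\<gamma> s \<bullet> \<gamma>' s)) (at s)"
      by (simp add: has_field_derivative_def inner_commute algebra_simps mult_commute_abs)
    have "(h has_real_derivative
        (2 * (\<gamma> s \<bullet> \<gamma>' s) - 2 * M * (\<gamma> s \<bullet> \<gamma> s)) * exp (- (2 * M * s))) (at s)"
      unfolding h_def by (rule derivative_eq_intros * refl | simp add: algebra_simps)+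
    moreover have "\<gamma> s \<bullet> \<gamma>' s \<le> M * (\<gamma> s \<bullet> \<gamma> s)"
    proof -
      have "\<gamma> s \<bullet> \<gamma>' s \<le> norm (\<gamma> s) * norm (\<gamma>' s)" by (rule norm_cauchy_schwarz)
      also have "\<dots> \<le> norm (\<gamma> s) * (M * norm (\<gamma> s))" by (intro mult_left_mono le s) simp
      finally show ?thesis by (simp add: dot_square_norm power2_eq_square mult_ac)
    qed
    ultimately have "(h has_real_derivative
        (2 * (\<gamma> s \<bullet> \<gamma>' s) - 2 * M * (\<gamma> s \<bullet> \<gamma> s)) * exp (- (2 * M * s))) (at s)"
      "(2 * (\<gamma> s \<bullet> \<gamma>' s) - 2 * M * (\<gamma> s \<bullet> \<gamma> s)) * exp (- (2 * M * s)) \<le> 0"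
      by (simp_all add: mult_nonpos_nonneg)
    then show "\<exists>y. (h has_real_derivative y) (at s) \<and> y \<le> 0" by blast
  qed simp
  then have "(norm (\<gamma> 1))\<^sup>2 \<le> (norm (\<gamma> 0))\<^sup>2 * exp (2 * M)"
    by (simp add: h_def dot_square_norm exp_minus field_simps)
  also have "\<dots> = (exp M * norm (\<gamma> 0))\<^sup>2"
    by (simp add: power_mult_distrib exp_double)
  finally show ?thesis by (rule power2_le_imp_le) simp
qed

text \<open>A bound on the logarithmic derivative compares the sizes of a curve at any two points; exchanging
  the end points gives the lower estimate.\<close>

lemma curve_norm_growth:
  assumes "holomorphic_curve f"
    and le: "\<And>\<zeta>. \<zeta> \<in> closed_segment x y \<Longrightarrow> norm (curve_deriv f \<zeta>) \<le> L * norm (f \<zeta>)"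
  shows "norm (f y) \<le> exp (L * cmod (y - x)) * norm (f x)"
proof -
  define \<sigma> where "\<sigma> s = x + complex_of_real s * (y - x)" for s
  define \<gamma> where "\<gamma> s = f (\<sigma> s)" for s
  define \<gamma>' where "\<gamma>' s = cscale (y - x) (curve_deriv f (\<sigma> s))" for s
  have d: "(\<gamma> has_vector_derivative \<gamma>' s) (at s)" for s
  proof -
    have "(\<sigma> has_derivative (\<lambda>t. complex_of_real t * (y - x))) (at s)"
      unfolding \<sigma>_def by (auto intro!: derivative_eq_intros)
    from has_derivative_compose[OF this has_derivative_curve[OF assms(1)]]
    have "(\<gamma> has_derivative (\<lambda>t. cscale (complex_of_real t * (y - x))
        (curve_deriv f (\<sigma> s)))) (at s)"
      unfolding \<gamma>_def .
    moreover have "cscale (complex_of_real t * c) v = t *\<^sub>R cscale c v" for t c v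
      by (simp add: cscale_def prod_eq_iff scaleR_conv_of_real mult.assoc)
    ultimately show ?thesis
      by (simp add: has_vector_derivative_def \<gamma>'_def)
  qed
  have le': "norm (\<gamma>' s) \<le> (L * cmod (y - x)) * norm (\<gamma> s)" if "0 \<le> s" "s \<le> 1" for s
  proof -
    have "\<sigma> s = (1 - s) *\<^sub>R x + s *\<^sub>R y"
      unfolding \<sigma>_def by (simp add: scaleR_conv_of_real algebra_simps)
    then have "\<sigma> s \<in> closed_segment x y"
      using that by (auto simp: closed_segment_def)
    from mult_left_mono[OF le[OF this], of "cmod (y - x)"]
    show ?thesis unfolding norm_cscale \<gamma>_def \<gamma>'_def by (simp only: mult_ac norm_ge_zero)
  qed
  have "norm (\<gamma> 1) \<le> exp (L * cmod (y - x)) * norm (\<gamma> 0)"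
    by (rule gronwall_norm[of \<gamma> \<gamma>']) (use d le' in auto)
  then show ?thesis by (simp add: \<gamma>_def \<sigma>_def)
qed

section \<open>Rescaling a sequence of curves\<close>

text \<open>Brody's reparametrization for the metric \<open>\<parallel>dx\<parallel> / \<parallel>x\<parallel>\<close> on \<open>\<complex>\<^sup>2 - {0}\<close>: a point where
  \<open>(1 - \<bar>\<xi>\<bar>) \<parallel>f\<^sub>n'\<parallel> / \<parallel>f\<^sub>n\<parallel>\<close> is maximal becomes the centre of a large disc on which the logarithmic
  derivative is at most twice its value at the centre. The time \<open>n\<close> is the first one at which the
  maximum exceeds a threshold; therefore the same bound holds for all earlier curves, so that the
  limit of the rescaled curves can be followed backwards in time.\<close>

lemma brody_rescaling:
  fixes f :: "nat \<Rightarrow> complex \<Rightarrow> C2"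
  assumes curves: "\<And>n. holomorphic_curve (f n)"
    and nz: "\<And>n \<xi>. cmod \<xi> \<le> 1 \<Longrightarrow> f n \<xi> \<noteq> 0"
    and unbounded: "\<And>L. \<exists>n \<xi>. cmod \<xi> \<le> 1/2 \<and> norm (curve_deriv (f n) \<xi>) > L * norm (f n \<xi>)"
  shows "\<exists>n a \<rho>. N \<le> n \<and> 0 < \<rho> \<and> cmod a \<le> 1 \<and>
    \<rho> * norm (curve_deriv (f n) a) = norm (f n a) \<and>
    (\<forall>m\<le>n. \<forall>\<eta>. cmod \<eta> \<le> real N \<longrightarrow> cmod (a + \<rho> * \<eta>) \<le> 1 \<and>
       \<rho> * norm (curve_deriv (f m) (a + \<rho> * \<eta>)) \<le> 2 * norm (f m (a + \<rho> * \<eta>)))"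
proof -
  define \<Lambda> where "\<Lambda> n \<xi> = (1 - cmod \<xi>) * (norm (curve_deriv (f n) \<xi>) / norm (f n \<xi>))" for n \<xi>
  have cont: "continuous_on (cball 0 1) (\<Lambda> n)" for n
    unfolding \<Lambda>_def using nz
    by (intro continuous_intros curve_deriv_continuous[OF curves]
        holomorphic_curve_continuous[OF curves]) auto
  have "\<exists>x\<in>cball 0 1. \<forall>y\<in>cball 0 1. \<Lambda> n y \<le> \<Lambda> n x" for n
    by (rule continuous_attains_sup) (use cont in auto)
  then obtain top where top: "\<And>n. cmod (top n) \<le> 1" "\<And>n \<xi>. cmod \<xi> \<le> 1 \<Longrightarrow> \<Lambda> n \<xi> \<le> \<Lambda> n (top n)"
    by (metis dist_0_norm mem_cball)
  have \<Lambda>_ge0: "0 \<le> \<Lambda> n (top n)" for n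
    using top(1)[of n] by (simp add: \<Lambda>_def)
  define K where "K = 2 * real N + 1 + (\<Sum>m<N. \<Lambda> m (top m))"
  have K_gt: "\<Lambda> m (top m) < K" if "m < N" for m
  proof -
    have "\<Lambda> m (top m) \<le> (\<Sum>m<N. \<Lambda> m (top m))"
      by (rule member_le_sum) (use that \<Lambda>_ge0 in auto)
    then show ?thesis by (simp add: K_def)
  qed
  have "\<exists>n. \<Lambda> n (top n) \<ge> K"
  proof -
    obtain n \<xi> where \<xi>: "cmod \<xi> \<le> 1/2" "norm (curve_deriv (f n) \<xi>) > (2 * K) * norm (f n \<xi>)"
      using unbounded by blast
    have "0 < norm (f n \<xi>)" using nz[of \<xi> n] \<xi>(1) by simp
    then have "2 * K \<le> norm (curve_deriv (f n) \<xi>) / norm (f n \<xi>)"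
      using \<xi>(2) by (simp add: field_simps)
    then have "(1/2) * (2 * K) \<le> \<Lambda> n \<xi>"
      unfolding \<Lambda>_def by (intro mult_mono) (use \<xi>(1) in \<open>auto simp: K_def \<Lambda>_ge0 sum_nonneg\<close>)
    also have "\<dots> \<le> \<Lambda> n (top n)" by (rule top) (use \<xi> in simp)
    finally show ?thesis by (auto intro!: exI[of _ n])
  qed
  then obtain n where n: "K \<le> \<Lambda> n (top n)" "\<And>m. m < n \<Longrightarrow> \<Lambda> m (top m) < K"
    using exists_least_iff[of "\<lambda>n. K \<le> \<Lambda> n (top n)"] by (auto simp: not_le)
  have K_pos: "0 < K" "2 * real N + 1 \<le> K" by (simp_all add: K_def \<Lambda>_ge0 sum_nonneg add_pos_nonneg)
  define a where "a = top n"
  define l where "l = \<Lambda> n a"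
  define \<rho> where "\<rho> = (1 - cmod a) / l"
  have l: "K \<le> l" using n by (simp add: a_def l_def)
  then have l_pos: "0 < l" using K_pos by simp
  have a_lt: "cmod a < 1"
    using top(1)[of n] l_pos unfolding a_def[symmetric] l_def \<Lambda>_def by (cases "cmod a = 1") auto
  have \<rho>_pos: "0 < \<rho>" using a_lt l_pos by (simp add: \<rho>_def)
  show ?thesis
  proof (intro exI[of _ n] exI[of _ a] exI[of _ \<rho>] conjI allI impI)
    show "N \<le> n" using n(1) K_gt[of n] by (meson not_le)
    show "0 < \<rho>" by fact
    show "cmod a \<le> 1" using a_lt by simp
    have "0 < norm (f n a)" using nz[of a n] a_lt by simp
    moreover have "norm (curve_deriv (f n) a) \<noteq> 0"
      using l_pos by (auto simp: l_def \<Lambda>_def)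
    ultimately show "\<rho> * norm (curve_deriv (f n) a) = norm (f n a)"
      using a_lt by (simp add: \<rho>_def l_def \<Lambda>_def)
    fix m \<eta> assume m: "m \<le> n" and \<eta>: "cmod \<eta> \<le> real N"
    define \<zeta> where "\<zeta> = a + \<rho> * \<eta>"
    have "\<rho> * cmod \<eta> \<le> \<rho> * (l / 2)"
      by (rule mult_left_mono) (use \<eta> l K_pos \<rho>_pos in auto)
    also have "\<dots> = (1 - cmod a) / 2" using l_pos by (simp add: \<rho>_def)
    finally have "\<rho> * cmod \<eta> \<le> (1 - cmod a) / 2" .
    moreover have "cmod \<zeta> \<le> cmod a + \<rho> * cmod \<eta>"
      using norm_triangle_ineq[of a "\<rho> * \<eta>"] \<rho>_pos by (simp add: \<zeta>_def norm_mult)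
    ultimately have "cmod \<zeta> \<le> cmod a + (1 - cmod a) / 2" by linarith
    then have half: "(1 - cmod a) / 2 \<le> 1 - cmod \<zeta>" by argo
    then have \<zeta>_le: "cmod \<zeta> \<le> 1" using a_lt by simp
    then show "cmod (a + \<rho> * \<eta>) \<le> 1" by (simp add: \<zeta>_def)
    have "\<Lambda> m \<zeta> \<le> l"
    proof (cases "m = n")
      case True then show ?thesis using top(2)[OF \<zeta>_le] by (simp add: l_def a_def)
    next
      case False
      then have "\<Lambda> m (top m) < K" using n(2) m by simp
      then show ?thesis using top(2)[OF \<zeta>_le, of m] l by simp
    qed
    moreover have "(1 - cmod a) / 2 * (norm (curve_deriv (f m) \<zeta>) / norm (f m \<zeta>)) \<le> \<Lambda> m \<zeta>"
      unfolding \<Lambda>_def by (rule mult_right_mono[OF half]) simp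
    ultimately have "(1 - cmod a) / 2 * (norm (curve_deriv (f m) \<zeta>) / norm (f m \<zeta>)) \<le> l" by simp
    moreover have "0 < norm (f m \<zeta>)" using nz[OF \<zeta>_le] by simp
    ultimately have "\<rho> * norm (curve_deriv (f m) \<zeta>) \<le> 2 * norm (f m \<zeta>)"
      using l_pos by (simp add: \<rho>_def field_simps)
    then show "\<rho> * norm (curve_deriv (f m) (a + \<rho> * \<eta>)) \<le> 2 * norm (f m (a + \<rho> * \<eta>))"
      by (simp add: \<zeta>_def)
  qed
qed

section \<open>Discrete Riccati equations\<close>

text \<open>With \<open>\<omega> = p / q\<close> the recursion \<open>\<omega> \<mapsto> \<omega> + \<omega>\<^sup>2 + \<beta>\<close> becomes linear up to higher order terms.
  The initial value \<open>(1, 0)\<close> stands for \<open>\<omega> = \<infinity>\<close>, so \<open>p / q\<close> is the orbit that comes from infinity.\<close>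

fun riccati_lin :: "(nat \<Rightarrow> complex) \<Rightarrow> nat \<Rightarrow> complex \<times> complex" where
  "riccati_lin \<beta> 0 = (1, 0)"
| "riccati_lin \<beta> (Suc j) = (case riccati_lin \<beta> j of (p, q) \<Rightarrow> (p + \<beta> j * q, q - p))"

text \<open>Over a short rescaled time \<open>\<sigma>\<close> the forcing term \<open>\<beta>\<close> matters little, and \<open>(p, q)\<close> stays close to
  \<open>(1, - j)\<close>, its value for \<open>\<beta> = 0\<close>.\<close>

lemma riccati_lin_bounds:
  assumes \<beta>: "\<And>j. j < k \<Longrightarrow> cmod (\<beta> j) \<le> B * r\<^sup>2" and "0 \<le> r" "0 \<le> B"
    and rk: "r * real k \<le> \<sigma>" and small: "B * \<sigma>\<^sup>2 \<le> 1"
    and j: "j \<le> k"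
  shows "cmod (fst (riccati_lin \<beta> j) - 1) \<le> B * \<sigma>\<^sup>2"
    "cmod (snd (riccati_lin \<beta> j)) \<le> 2 * real j"
    "cmod (snd (riccati_lin \<beta> j) + of_nat j) \<le> B * \<sigma>\<^sup>2 * real j"
proof -
  have sq: "B * (r * real i)\<^sup>2 \<le> B * \<sigma>\<^sup>2" if "i \<le> k" for i
  proof (intro mult_left_mono power_mono)
    have "r * real i \<le> r * real k" using that assms by (intro mult_left_mono) auto
    then show "r * real i \<le> \<sigma>" using rk by simp
  qed (use assms in auto)
  have "cmod (fst (riccati_lin \<beta> j) - 1) \<le> B * (r * real j)\<^sup>2 \<and>
     cmod (snd (riccati_lin \<beta> j)) \<le> 2 * real j \<and>
     cmod (snd (riccati_lin \<beta> j) + of_nat j) \<le> B * \<sigma>\<^sup>2 * real j"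
    using j
  proof (induction j)
    case (Suc j)
    obtain p q where pq: "riccati_lin \<beta> j = (p, q)" by fastforce
    have IH: "cmod (p - 1) \<le> B * (r * real j)\<^sup>2" "cmod q \<le> 2 * real j"
        "cmod (q + of_nat j) \<le> B * \<sigma>\<^sup>2 * real j"
      using Suc pq by auto
    have p1: "cmod (p - 1) \<le> B * \<sigma>\<^sup>2" using IH(1) sq[of j] Suc.prems by simp
    then have p2: "cmod p \<le> 2" using small norm_triangle_ineq[of "p - 1" 1] by simp
    have "cmod (\<beta> j * q) \<le> (B * r\<^sup>2) * (2 * real j)"
      unfolding norm_mult by (intro mult_mono \<beta> IH) (use Suc.prems assms in auto)
    then have "cmod (p + \<beta> j * q - 1) \<le> B * (r * real j)\<^sup>2 + (B * r\<^sup>2) * (2 * real j)"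
      using IH(1) norm_triangle_ineq[of "p - 1" "\<beta> j * q"] by (simp add: algebra_simps)
    also have "\<dots> \<le> B * (r * real (Suc j))\<^sup>2"
    proof -
      have "B * (r * real (Suc j))\<^sup>2 = B * (r * real j)\<^sup>2 + (B * r\<^sup>2) * (2 * real j) + B * r\<^sup>2"
        by (simp add: power2_eq_square algebra_simps)
      then show ?thesis using assms by simp
    qed
    finally have 1: "cmod (p + \<beta> j * q - 1) \<le> B * (r * real (Suc j))\<^sup>2" .
    have 2: "cmod (q - p) \<le> 2 * real (Suc j)"
      using IH(2) p2 norm_triangle_ineq4[of q p] by simp
    have "cmod ((q + of_nat j) - (p - 1)) \<le> B * \<sigma>\<^sup>2 * real j + B * \<sigma>\<^sup>2"
      by (rule order_trans[OF norm_triangle_ineq4]) (use IH(3) p1 in simp)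
    then have 3: "cmod (q - p + of_nat (Suc j)) \<le> B * \<sigma>\<^sup>2 * real (Suc j)"
      by (simp add: algebra_simps)
    from 1 2 3 show ?case by (simp add: pq)
  qed (use assms in auto)
  then show "cmod (fst (riccati_lin \<beta> j) - 1) \<le> B * \<sigma>\<^sup>2"
    "cmod (snd (riccati_lin \<beta> j)) \<le> 2 * real j"
    "cmod (snd (riccati_lin \<beta> j) + of_nat j) \<le> B * \<sigma>\<^sup>2 * real j"
    using sq[OF j] by auto
qed

text \<open>The expression \<open>p - \<omega> q\<close> is a discrete Wronskian: one step multiplies it by \<open>1 + \<omega>\<close>, up to an error
  of second order. It starts at 1 and hence stays away from 0: an orbit that was bounded during the
  whole time does not meet the orbit from infinity.\<close>

lemma riccati_lower_bound:
  assumes \<omega>: "\<And>j. j \<le> k \<Longrightarrow> cmod (\<omega> j) \<le> A * r"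
    and step: "\<And>j. j < k \<Longrightarrow> cmod (\<omega> (Suc j) - (\<omega> j + (\<omega> j)\<^sup>2 + \<beta> j)) \<le> \<epsilon> * r\<^sup>2"
    and \<beta>: "\<And>j. j < k \<Longrightarrow> cmod (\<beta> j) \<le> B * r\<^sup>2" and "0 \<le> r" "0 \<le> B" "0 \<le> A" "0 \<le> \<epsilon>"
    and rk: "r * real k \<le> \<sigma>" and small: "B * \<sigma>\<^sup>2 \<le> 1" and Ar: "A * r \<le> 1/2"
  shows "exp (- (2 * A * \<sigma>)) - 2 * (A\<^sup>2 + B) * \<sigma> * r - 2 * \<epsilon> * \<sigma>\<^sup>2
     \<le> cmod (fst (riccati_lin \<beta> k) - \<omega> k * snd (riccati_lin \<beta> k))"
proof -
  have bnd: "cmod (fst (riccati_lin \<beta> j) - 1) \<le> B * \<sigma>\<^sup>2"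
    "cmod (snd (riccati_lin \<beta> j)) \<le> 2 * real j" if "j \<le> k" for j
  proof -
    show "cmod (fst (riccati_lin \<beta> j) - 1) \<le> B * \<sigma>\<^sup>2"
      by (rule riccati_lin_bounds(1)[OF _ \<open>0 \<le> r\<close> \<open>0 \<le> B\<close> rk small that]) (rule \<beta>)
    show "cmod (snd (riccati_lin \<beta> j)) \<le> 2 * real j"
      by (rule riccati_lin_bounds(2)[OF _ \<open>0 \<le> r\<close> \<open>0 \<le> B\<close> rk small that]) (rule \<beta>)
  qed
  define W where "W j = fst (riccati_lin \<beta> j) - \<omega> j * snd (riccati_lin \<beta> j)" for j
  define d where "d = 2 * (A\<^sup>2 + B) * r\<^sup>2 + \<epsilon> * r\<^sup>2 * (2 * real k)"
  have d0: "0 \<le> d" using assms by (simp add: d_def)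
  have W_step: "exp (- (2 * (A * r))) * cmod (W j) - d \<le> cmod (W (Suc j))" if j: "j < k" for j
  proof -
    obtain p q where pq: "riccati_lin \<beta> j = (p, q)" by fastforce
    define e where "e = \<omega> (Suc j) - (\<omega> j + (\<omega> j)\<^sup>2 + \<beta> j)"
    have \<omega>': "\<omega> (Suc j) = \<omega> j + (\<omega> j)\<^sup>2 + \<beta> j + e" by (simp add: e_def)
    have "W (Suc j) = W j * (1 + \<omega> j) + (((\<omega> j)\<^sup>2 + \<beta> j) * p - e * snd (riccati_lin \<beta> (Suc j)))"
      unfolding W_def \<omega>' by (simp add: pq power2_eq_square algebra_simps)
    moreover have "cmod (((\<omega> j)\<^sup>2 + \<beta> j) * p - e * snd (riccati_lin \<beta> (Suc j))) \<le> d"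
    proof -
      have "cmod (fst (riccati_lin \<beta> j) - 1) \<le> 1" using bnd(1)[of j] j small by simp
      then have p: "cmod p \<le> 2" using norm_triangle_ineq[of "p - 1" 1] by (simp add: pq)
      have "cmod ((\<omega> j)\<^sup>2) \<le> (A * r)\<^sup>2"
        unfolding norm_power by (rule power_mono[OF \<omega>]) (use j in auto)
      then have "cmod ((\<omega> j)\<^sup>2 + \<beta> j) \<le> (A\<^sup>2 + B) * r\<^sup>2"
        using \<beta>[OF j] norm_triangle_ineq[of "(\<omega> j)\<^sup>2" "\<beta> j"] by (simp add: algebra_simps)
      then have "cmod (((\<omega> j)\<^sup>2 + \<beta> j) * p) \<le> ((A\<^sup>2 + B) * r\<^sup>2) * 2"
        unfolding norm_mult by (intro mult_mono p) (use assms in auto)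
      moreover have "cmod (e * snd (riccati_lin \<beta> (Suc j))) \<le> (\<epsilon> * r\<^sup>2) * (2 * real k)"
        unfolding norm_mult
      proof (intro mult_mono)
        show "cmod e \<le> \<epsilon> * r\<^sup>2" unfolding e_def by (rule step[OF j])
        show "cmod (snd (riccati_lin \<beta> (Suc j))) \<le> 2 * real k"
          using bnd(2)[of "Suc j"] j by simp
      qed (use assms in auto)
      moreover have "d = ((A\<^sup>2 + B) * r\<^sup>2) * 2 + (\<epsilon> * r\<^sup>2) * (2 * real k)" by (simp add: d_def)
      ultimately show ?thesis
        using norm_triangle_ineq4[of "((\<omega> j)\<^sup>2 + \<beta> j) * p" "e * snd (riccati_lin \<beta> (Suc j))"] by linarith
    qed
    moreover have "exp (- (2 * (A * r))) * cmod (W j) \<le> cmod (W j * (1 + \<omega> j))"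
    proof -
      have "exp (- (2 * (A * r))) \<le> 1 - A * r"
      proof -
        have "0 \<le> A * r" using assms by simp
        then have "0 \<le> (A * r) * (1 - 2 * (A * r))" using Ar by (intro mult_nonneg_nonneg[of "A * r"]) auto
        then have "1 \<le> (1 + 2 * (A * r)) * (1 - A * r)" by (simp add: algebra_simps)
        then have "1 / (1 - A * r) \<le> 1 + 2 * (A * r)"
          using Ar by (subst pos_divide_le_eq) auto
        also have "\<dots> \<le> exp (2 * (A * r))" by simp
        finally show ?thesis using Ar by (simp add: exp_minus field_simps)
      qed
      also have "\<dots> \<le> cmod (1 + \<omega> j)"
        using \<omega>[of j] j norm_triangle_ineq2[of 1 "- \<omega> j"] by simp
      finally have "exp (- (2 * (A * r))) \<le> cmod (1 + \<omega> j)" .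
      then have "cmod (W j) * exp (- (2 * (A * r))) \<le> cmod (W j) * cmod (1 + \<omega> j)"
        by (rule mult_left_mono) simp
      then show ?thesis by (simp add: norm_mult mult.commute)
    qed
    ultimately show ?thesis
      using norm_diff_ineq[of "W j * (1 + \<omega> j)" "((\<omega> j)\<^sup>2 + \<beta> j) * p - e * snd (riccati_lin \<beta> (Suc j))"]
      by (simp only:)
  qed
  have "exp (- (2 * (A * r) * real j)) - real j * d \<le> cmod (W j)" if "j \<le> k" for j
    using that
  proof (induction j)
    case (Suc j)
    have "exp (- (2 * (A * r) * real (Suc j))) - real (Suc j) * d
        = exp (- (2 * (A * r))) * exp (- (2 * (A * r) * real j)) - real j * d - d"
      by (simp add: exp_add[symmetric] algebra_simps)
    also have "\<dots> \<le> exp (- (2 * (A * r))) * (exp (- (2 * (A * r) * real j)) - real j * d) - d"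
    proof -
      have "exp (- (2 * (A * r))) * (real j * d) \<le> 1 * (real j * d)"
        by (rule mult_right_mono) (use assms d0 in auto)
      then show ?thesis by (simp add: algebra_simps)
    qed
    also have "\<dots> \<le> exp (- (2 * (A * r))) * cmod (W j) - d"
      using Suc by (intro diff_right_mono mult_left_mono) auto
    also have "\<dots> \<le> cmod (W (Suc j))" by (rule W_step) (use Suc.prems in simp)
    finally show ?case .
  qed (simp add: W_def)
  from this[of k] have "exp (- (2 * (A * r) * real k)) - real k * d \<le> cmod (W k)" by simp
  moreover have "exp (- (2 * A * \<sigma>)) \<le> exp (- (2 * (A * r) * real k))"
  proof -
    have "2 * A * (r * real k) \<le> 2 * A * \<sigma>" by (rule mult_left_mono[OF rk]) (use assms in simp)
    moreover have "2 * (A * r) * real k = 2 * A * (r * real k)" by simp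
    ultimately show ?thesis by (simp only: exp_le_cancel_iff neg_le_iff_le)
  qed
  moreover have "real k * d \<le> 2 * (A\<^sup>2 + B) * \<sigma> * r + 2 * \<epsilon> * \<sigma>\<^sup>2"
  proof -
    have "real k * d = 2 * (A\<^sup>2 + B) * r * (r * real k) + 2 * \<epsilon> * (r * real k)\<^sup>2"
      by (simp add: d_def power2_eq_square algebra_simps)
    also have "\<dots> \<le> 2 * (A\<^sup>2 + B) * r * \<sigma> + 2 * \<epsilon> * \<sigma>\<^sup>2"
      by (intro add_mono mult_left_mono power_mono rk) (use assms in auto)
    finally show ?thesis by (simp add: mult_ac)
  qed
  ultimately show ?thesis unfolding W_def by linarith
qed

text \<open>Passing to the limit in the preceding estimate, the end values omit the position of the orbit from
  infinity, which is roughly \<open>- 1 / \<sigma>\<close>. The two-sided bound on \<open>c\<close> records enough of this to tell the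
  omitted values for \<open>\<sigma>\<close> and \<open>\<sigma> / 2\<close> apart.\<close>

lemma riccati_limit_omits:
  fixes \<omega> :: "nat \<Rightarrow> nat \<Rightarrow> complex \<Rightarrow> complex" and r :: "nat \<Rightarrow> real"
  assumes r: "r \<longlonglongrightarrow> 0" "\<And>N. 0 < r N"
    and k: "(\<lambda>N. r N * real (k N)) \<longlonglongrightarrow> \<sigma>" "\<And>N. r N * real (k N) \<le> \<sigma>" and \<sigma>: "0 < \<sigma>"
    and B: "0 \<le> B" "B * \<sigma>\<^sup>2 \<le> 1/8"
    and \<beta>: "\<forall>\<^sub>F N in sequentially. \<forall>j<k N. cmod (\<beta> N j) \<le> B * (r N)\<^sup>2"
    and bounded: "\<And>\<eta>. \<exists>A\<ge>0. \<forall>\<^sub>F N in sequentially. \<forall>j\<le>k N. cmod (\<omega> N j \<eta>) \<le> A * r N"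
    and step: "\<And>\<eta> \<epsilon>. 0 < \<epsilon> \<Longrightarrow> \<forall>\<^sub>F N in sequentially. \<forall>j<k N.
        cmod (\<omega> N (Suc j) \<eta> - (\<omega> N j \<eta> + (\<omega> N j \<eta>)\<^sup>2 + \<beta> N j)) \<le> \<epsilon> * (r N)\<^sup>2"
    and lim: "\<And>\<eta>. (\<lambda>N. \<omega> N (k N) \<eta> / r N) \<longlonglongrightarrow> h \<eta>"
  shows "\<exists>c. 7/9 \<le> cmod c * \<sigma> \<and> cmod c * \<sigma> \<le> 9/7 \<and> (\<forall>\<eta>. h \<eta> \<noteq> c)"
proof -
  define p where "p N = fst (riccati_lin (\<beta> N) (k N))" for N
  define q where "q N = r N * snd (riccati_lin (\<beta> N) (k N))" for N
  obtain N0 where N0: "\<And>N j. N0 \<le> N \<Longrightarrow> j < k N \<Longrightarrow> cmod (\<beta> N j) \<le> B * (r N)\<^sup>2"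
    using \<beta> by (auto simp: eventually_sequentially)
  have p_near: "cmod (p N - 1) \<le> 1/8" and q_near: "cmod (q N + r N * k N) \<le> 1/8 * \<sigma>" if "N0 \<le> N" for N
  proof -
    have small: "B * \<sigma>\<^sup>2 \<le> 1" using B(2) by simp
    have r0: "0 \<le> r N" using r(2)[of N] by simp
    note bnd = riccati_lin_bounds[where \<beta> = "\<beta> N" and r = "r N" and k = "k N",
        OF _ r0 B(1) k(2) small order_refl]
    have "cmod (p N - 1) \<le> B * \<sigma>\<^sup>2"
      unfolding p_def by (rule bnd(1)) (rule N0[OF that])
    then show "cmod (p N - 1) \<le> 1/8" using B(2) by simp
    have "cmod (snd (riccati_lin (\<beta> N) (k N)) + of_nat (k N)) \<le> B * \<sigma>\<^sup>2 * real (k N)"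
      by (rule bnd(3)) (rule N0[OF that])
    also have "\<dots> \<le> 1/8 * real (k N)" by (rule mult_right_mono[OF B(2)]) simp
    finally have "r N * cmod (snd (riccati_lin (\<beta> N) (k N)) + of_nat (k N)) \<le> r N * (1/8 * real (k N))"
      using r0 by (rule mult_left_mono)
    moreover have "r N * cmod (snd (riccati_lin (\<beta> N) (k N)) + of_nat (k N)) = cmod (q N + r N * k N)"
      using r0 by (simp add: q_def norm_mult[symmetric] distrib_left[symmetric] flip: norm_of_real
          del: norm_mult norm_of_real)
        (simp add: norm_mult distrib_left[symmetric])
    ultimately show "cmod (q N + r N * k N) \<le> 1/8 * \<sigma>" using k(2)[of N] by simp
  qed
  have "bounded (range (\<lambda>N. (p (N + N0), q (N + N0))))"
  proof (rule boundedI)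
    fix x assume "x \<in> range (\<lambda>N. (p (N + N0), q (N + N0)))"
    then obtain N where x: "x = (p (N + N0), q (N + N0))" by blast
    define M where "M = N + N0"
    have "cmod (p M) \<le> 2" using p_near[of M] norm_triangle_ineq[of "p M - 1" 1] by (simp add: M_def)
    moreover have "cmod (q M) \<le> 2 * \<sigma>"
    proof -
      have "cmod (q M) \<le> cmod (q M + r M * k M) + cmod (r M * k M)"
        using norm_triangle_ineq4[of "q M + r M * k M" "r M * k M"] by simp
      moreover have "cmod (r M * k M) \<le> \<sigma>"
        using k(2)[of M] r(2)[of M] by (simp add: norm_mult)
      ultimately show ?thesis using q_near[of M] \<sigma> by (simp add: M_def)
    qed
    ultimately show "norm x \<le> 2 + 2 * \<sigma>"
      using norm_Pair_le[of "p M" "q M"] by (simp add: x M_def)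
  qed
  then obtain pq s where s: "strict_mono s" "((\<lambda>N. (p (N + N0), q (N + N0))) \<circ> s) \<longlonglongrightarrow> pq"
    using bounded_imp_convergent_subsequence by blast
  define t where "t i = s i + N0" for i
  have t: "strict_mono t" using s(1) by (simp add: t_def strict_mono_def)
  obtain p' q' where pq: "pq = (p', q')" by fastforce
  have p': "(\<lambda>i. p (t i)) \<longlonglongrightarrow> p'" and q': "(\<lambda>i. q (t i)) \<longlonglongrightarrow> q'"
    using tendsto_fst[OF s(2)] tendsto_snd[OF s(2)] by (simp_all add: pq t_def o_def)
  have sub: "(\<lambda>i. X (t i)) \<longlonglongrightarrow> L" if "X \<longlonglongrightarrow> L" for X :: "nat \<Rightarrow> 'b::topological_space" and L
    using LIMSEQ_subseq_LIMSEQ[OF that t] by (simp add: o_def)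
  have "cmod (p' - 1) \<le> 1/8"
    by (rule LIMSEQ_le_const2[OF tendsto_norm[OF tendsto_diff[OF p' tendsto_const]]])
      (use p_near in \<open>auto intro!: exI[of _ 0] simp: t_def\<close>)
  then have p'_bd: "7/8 \<le> cmod p'" "cmod p' \<le> 9/8"
    using norm_triangle_ineq[of "p' - 1" 1] norm_triangle_ineq4[of p' "p' - 1"] by auto
  have "(\<lambda>i. q (t i) + complex_of_real (r (t i) * k (t i))) \<longlonglongrightarrow> q' + complex_of_real \<sigma>"
    by (intro tendsto_intros q' sub[OF k(1)])
  then have "cmod (q' + complex_of_real \<sigma>) \<le> 1/8 * \<sigma>"
    by (intro LIMSEQ_le_const2[OF tendsto_norm])
      (use q_near in \<open>auto intro!: exI[of _ 0] simp: t_def\<close>)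
  then have q'_bd: "7/8 * \<sigma> \<le> cmod q'" "cmod q' \<le> 9/8 * \<sigma>"
    using norm_triangle_ineq4[of "q' + complex_of_real \<sigma>" "complex_of_real \<sigma>"]
      norm_triangle_ineq4[of "q' + complex_of_real \<sigma>" q'] \<sigma> by auto
  then have q'0: "0 < cmod q'" using \<sigma> by (smt (verit) mult_pos_pos zero_less_divide_iff)
  define c where "c = p' / q'"
  have "7/9 \<le> cmod c * \<sigma>"
  proof -
    have "7/9 * cmod q' \<le> 7/8 * \<sigma>" using q'_bd by simp
    also have "\<dots> \<le> cmod p' * \<sigma>" by (rule mult_right_mono) (use p'_bd \<sigma> in auto)
    finally show ?thesis using q'0 by (simp add: c_def norm_divide field_simps)
  qed
  moreover have "cmod c * \<sigma> \<le> 9/7"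
  proof -
    have "cmod p' * \<sigma> \<le> 9/8 * \<sigma>" by (rule mult_right_mono) (use p'_bd \<sigma> in auto)
    also have "\<dots> \<le> 9/7 * cmod q'" using q'_bd by simp
    finally show ?thesis using q'0 by (simp add: c_def norm_divide field_simps)
  qed
  moreover have "h \<eta> \<noteq> c" for \<eta>
  proof
    assume hc: "h \<eta> = c"
    obtain A where A: "0 \<le> A" "\<forall>\<^sub>F N in sequentially. \<forall>j\<le>k N. cmod (\<omega> N j \<eta>) \<le> A * r N"
      using bounded by blast
    define E where "E = exp (- (2 * A * \<sigma>))"
    define \<epsilon> where "\<epsilon> = E / (8 * \<sigma>\<^sup>2)"
    have E: "0 < E" "0 < \<epsilon>" using \<sigma> by (simp_all add: E_def \<epsilon>_def)
    have "(\<lambda>N. 2 * (A\<^sup>2 + B) * \<sigma> * r N) \<longlonglongrightarrow> 2 * (A\<^sup>2 + B) * \<sigma> * 0"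
      by (intro tendsto_intros r)
    then have ev1: "\<forall>\<^sub>F N in sequentially. 2 * (A\<^sup>2 + B) * \<sigma> * r N < E / 4"
      by (rule order_tendstoD) (use E in simp)
    have "(\<lambda>N. A * r N) \<longlonglongrightarrow> A * 0" by (intro tendsto_intros r)
    then have ev2: "\<forall>\<^sub>F N in sequentially. A * r N < 1/2"
      by (rule order_tendstoD) simp
    have "\<forall>\<^sub>F N in sequentially. E / 2 \<le> cmod (p N - \<omega> N (k N) \<eta> / r N * q N)"
      using \<beta> A(2) step[OF E(2), of \<eta>] ev1 ev2
    proof eventually_elim
      case (elim N)
      have "E - 2 * (A\<^sup>2 + B) * \<sigma> * r N - 2 * \<epsilon> * \<sigma>\<^sup>2
          \<le> cmod (fst (riccati_lin (\<beta> N) (k N)) - \<omega> N (k N) \<eta> * snd (riccati_lin (\<beta> N) (k N)))"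
        unfolding E_def
        by (rule riccati_lower_bound[where \<omega> = "\<lambda>j. \<omega> N j \<eta>"])
          (use elim E r(2)[of N] B A(1) k(2)[of N] in auto)
      moreover have "2 * \<epsilon> * \<sigma>\<^sup>2 = E / 4" using \<sigma> by (simp add: \<epsilon>_def)
      moreover have "\<omega> N (k N) \<eta> / r N * q N = \<omega> N (k N) \<eta> * snd (riccati_lin (\<beta> N) (k N))"
        using r(2)[of N] by (simp add: q_def)
      ultimately show ?case using elim by (simp add: p_def)
    qed
    then have "\<forall>\<^sub>F i in sequentially. E / 2 \<le> cmod (p (t i) - \<omega> (t i) (k (t i)) \<eta> / r (t i) * q (t i))"
      using eventually_subseq[OF t] by blast
    moreover have "(\<lambda>i. cmod (p (t i) - \<omega> (t i) (k (t i)) \<eta> / r (t i) * q (t i)))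
        \<longlonglongrightarrow> cmod (p' - h \<eta> * q')"
      by (intro tendsto_intros p' q' sub[OF lim])
    ultimately have "E / 2 \<le> cmod (p' - h \<eta> * q')"
      by (intro tendsto_lowerbound) auto
    then show False using E q'0 hc by (auto simp: c_def)
  qed
  ultimately show ?thesis by blast
qed

section \<open>Maps with the given 2-jet\<close>

text \<open>The last assumption makes one step of \<open>P\<close> in the ball of radius \<open>\<delta>\<close> change the norm by at most
  one half of itself.\<close>

locale parabolic_germ =
  fixes P :: "C2 \<Rightarrow> C2" and b :: complex and C \<delta> :: real
  assumes hol: "holomorphic_C2 P"
    and \<delta>_pos: "0 < \<delta>" and C_nonneg: "0 \<le> C"
    and jet: "\<And>x. norm x \<le> \<delta> \<Longrightarrow>
      norm (P x - (fst x - (fst x)\<^sup>2, snd x + (snd x)\<^sup>2 + b * (fst x)\<^sup>2)) \<le> C * norm x ^ 3"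
    and \<delta>_small: "\<delta> \<le> 1" "(2 + cmod b + C) * \<delta> \<le> 1/2"
begin

definition "C1 = 2 + cmod b + C"

lemma C1_pos: "0 < C1" "2 \<le> C1" using C_nonneg by (simp_all add: C1_def add_pos_nonneg)

lemma fst_step:
  assumes "norm x \<le> \<delta>"
  shows "cmod (fst (P x) - (fst x - (fst x)\<^sup>2)) \<le> C * norm x ^ 3"
  using jet[OF assms] norm_fst_le[of "fst (P x) - (fst x - (fst x)\<^sup>2)"
      "snd (P x) - (snd x + (snd x)\<^sup>2 + b * (fst x)\<^sup>2)"]
  by (simp add: minus_prod_def)

lemma snd_step:
  assumes "norm x \<le> \<delta>"
  shows "cmod (snd (P x) - (snd x + (snd x)\<^sup>2 + b * (fst x)\<^sup>2)) \<le> C * norm x ^ 3"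
  using jet[OF assms] norm_snd_le[of "snd (P x) - (snd x + (snd x)\<^sup>2 + b * (fst x)\<^sup>2)"
      "fst (P x) - (fst x - (fst x)\<^sup>2)"]
  by (simp add: minus_prod_def)

lemma norm_step:
  assumes x: "norm x \<le> \<delta>"
  shows "norm (P x - x) \<le> C1 * (norm x)\<^sup>2"
proof -
  obtain z w where xzw: "x = (z, w)" by fastforce
  have n: "cmod z \<le> norm x" "cmod w \<le> norm x"
    using norm_fst_le[of z w] norm_snd_le[of w z] by (simp_all add: xzw)
  let ?J = "(z - z\<^sup>2, w + w\<^sup>2 + b * z\<^sup>2)"
  have "norm (?J - x) \<le> cmod (- z\<^sup>2) + cmod (w\<^sup>2 + b * z\<^sup>2)"
    using norm_Pair_le[of "- z\<^sup>2" "w\<^sup>2 + b * z\<^sup>2"] by (simp add: xzw)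
  also have "\<dots> \<le> (cmod z)\<^sup>2 + ((cmod w)\<^sup>2 + cmod b * (cmod z)\<^sup>2)"
    using norm_triangle_ineq[of "w\<^sup>2" "b * z\<^sup>2"] by (simp add: norm_mult norm_power)
  also have "\<dots> \<le> (norm x)\<^sup>2 + ((norm x)\<^sup>2 + cmod b * (norm x)\<^sup>2)"
    by (intro add_mono mult_left_mono power_mono n) auto
  finally have J: "norm (?J - x) \<le> (2 + cmod b) * (norm x)\<^sup>2" by (simp add: algebra_simps)
  have "norm (P x - ?J) \<le> C * norm x ^ 3" using jet[OF x] by (simp add: xzw)
  also have "\<dots> \<le> C * (norm x)\<^sup>2"
    using x \<delta>_small C_nonneg by (intro mult_left_mono power_decreasing) auto
  finally have "norm (P x - ?J) \<le> C * (norm x)\<^sup>2" .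
  with J have "norm (P x - ?J) + norm (?J - x) \<le> C1 * (norm x)\<^sup>2"
    by (simp add: C1_def algebra_simps)
  then show ?thesis using norm_triangle_ineq[of "P x - ?J" "?J - x"] by simp
qed

text \<open>Since a step changes the norm by a quadratic amount only, \<open>1 / \<parallel>x\<parallel>\<close> grows at most linearly. Thus no
  orbit approaches the origin faster than a multiple of \<open>1 / n\<close>, which leaves room for going back by
  a time proportional to \<open>1 / \<parallel>x\<parallel>\<close>.\<close>

lemma P_nonzero_and_inverse_step:
  assumes x: "norm x \<le> \<delta>" "x \<noteq> 0"
  shows "P x \<noteq> 0" "1 / norm (P x) \<le> 1 / norm x + 2 * C1"
proof -
  define n where "n = norm x"
  have n: "0 < n" "C1 * n \<le> 1/2"
  proof -
    show "0 < n" using x by (simp add: n_def)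
    have "C1 * n \<le> C1 * \<delta>" using x C1_pos by (simp add: n_def)
    then show "C1 * n \<le> 1/2" using \<delta>_small by (simp add: C1_def)
  qed
  have "n - C1 * n\<^sup>2 \<le> norm (P x)"
    using norm_step[OF x(1)] norm_triangle_ineq2[of x "x - P x"]
    by (simp add: n_def norm_minus_commute)
  then have le: "n * (1 - C1 * n) \<le> norm (P x)" by (simp add: power2_eq_square algebra_simps)
  have pos: "0 < n * (1 - C1 * n)" using n by simp
  with le have "0 < norm (P x)" by linarith
  then show "P x \<noteq> 0" by simp
  have "1 / norm (P x) \<le> 1 / (n * (1 - C1 * n))" using le pos \<open>0 < norm (P x)\<close> by (intro divide_left_mono) auto
  also have "\<dots> \<le> 1 / n + 2 * C1"
  proof -
    have "0 \<le> C1 * n * (1 - 2 * (C1 * n))" using n C1_pos by (intro mult_nonneg_nonneg) auto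
    then have "1 \<le> (1 + 2 * C1 * n) * (1 - C1 * n)" by (simp add: algebra_simps)
    then have "1 / (1 - C1 * n) \<le> 1 + 2 * C1 * n" using n by (subst pos_divide_le_eq) auto
    then have "1 / (1 - C1 * n) / n \<le> (1 + 2 * C1 * n) / n" using n by (intro divide_right_mono) auto
    then show ?thesis using n by (simp add: field_simps)
  qed
  finally show "1 / norm (P x) \<le> 1 / norm x + 2 * C1" by (simp add: n_def)
qed

lemma inverse_norm_growth:
  assumes "\<And>i. i < m \<Longrightarrow> x (Suc i) = P (x i)" "\<And>i. i \<le> m \<Longrightarrow> norm (x i) \<le> \<delta>" "x 0 \<noteq> 0"
  shows "x m \<noteq> 0 \<and> 1 / norm (x m) \<le> 1 / norm (x 0) + 2 * C1 * real m"
  using assms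
proof (induction m)
  case (Suc m)
  then have "x m \<noteq> 0" "1 / norm (x m) \<le> 1 / norm (x 0) + 2 * C1 * real m" by auto
  moreover have "norm (x m) \<le> \<delta>" "x (Suc m) = P (x m)" using Suc.prems by auto
  ultimately show ?case
    using P_nonzero_and_inverse_step[of "x m"] by (auto simp: algebra_simps)
qed simp

text \<open>The first coordinate evolves autonomously up to third order, so two orbits whose first coordinates
  agree at the end also had nearly the same first coordinates before.\<close>

lemma fst_difference_backward:
  assumes step: "\<And>j. j < k \<Longrightarrow> x (Suc j) = P (x j)" "\<And>j. j < k \<Longrightarrow> y (Suc j) = P (y j)"
    and le: "\<And>j. j \<le> k \<Longrightarrow> norm (x j) \<le> A * r" "\<And>j. j \<le> k \<Longrightarrow> norm (y j) \<le> A * r"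
    and A: "0 < A" "0 < r" "A * r \<le> \<delta>" "A * r \<le> 1/4" and rk: "r * real k \<le> \<sigma>" and j: "j \<le> k"
  shows "cmod (fst (x j) - fst (y j))
     \<le> exp (4 * A * \<sigma>) * (cmod (fst (x k) - fst (y k)) + 2 * C * A ^ 3 * \<sigma> * r\<^sup>2)"
proof -
  define d where "d j = cmod (fst (x j) - fst (y j))" for j
  define e where "e = 2 * C * (A * r) ^ 3"
  have e0: "0 \<le> e" using A C_nonneg by (simp add: e_def)
  define E where "E = exp (4 * (A * r))"
  have E1: "1 \<le> E" using A by (simp add: E_def)
  have bwd: "d j \<le> E * (d (Suc j) + e)" if "j < k" for j
  proof -
    have err: "cmod (fst (P u) - (fst u - (fst u)\<^sup>2)) \<le> C * (A * r) ^ 3" if "norm u \<le> A * r" for u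
    proof -
      have "C * norm u ^ 3 \<le> C * (A * r) ^ 3"
        by (intro mult_left_mono power_mono that) (use C_nonneg in auto)
      then show ?thesis using fst_step[of u] that A by simp
    qed
    define s where "s = fst (x j) + fst (y j)"
    have s: "cmod s \<le> 2 * (A * r)"
    proof -
      have "cmod (fst (x j)) \<le> A * r" "cmod (fst (y j)) \<le> A * r"
        using le[of j] that norm_fst_le[of "fst (x j)" "snd (x j)"] norm_fst_le[of "fst (y j)" "snd (y j)"] by auto
      then show ?thesis using norm_triangle_ineq[of "fst (x j)" "fst (y j)"] by (simp add: s_def)
    qed
    have "(fst (x j) - fst (y j)) * (1 - s) = (fst (x (Suc j)) - fst (y (Suc j)))
        - (fst (P (x j)) - (fst (x j) - (fst (x j))\<^sup>2)) + (fst (P (y j)) - (fst (y j) - (fst (y j))\<^sup>2))"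
      using step[OF that] by (simp add: s_def power2_eq_square algebra_simps)
    also have "cmod \<dots> \<le> d (Suc j) + C * (A * r) ^ 3 + C * (A * r) ^ 3"
      unfolding d_def
      by (intro order_trans[OF norm_triangle_ineq] order_trans[OF norm_triangle_ineq4] add_mono order_refl err le)
        (use that in auto)
    finally have "d j * cmod (1 - s) \<le> d (Suc j) + e" by (simp add: d_def e_def norm_mult)
    moreover have "inverse E \<le> cmod (1 - s)"
    proof -
      have "(1 + 4 * (A * r)) * (1 - 2 * (A * r)) = 1 + 2 * (A * r) * (1 - 4 * (A * r))"
        by (simp add: algebra_simps)
      also have "\<dots> \<ge> 1" using A by simp
      finally have "1 / (1 - 2 * (A * r)) \<le> 1 + 4 * (A * r)" using A by (subst pos_divide_le_eq) auto
      also have "\<dots> \<le> E" by (simp add: E_def)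
      finally have "inverse E \<le> 1 - 2 * (A * r)"
        using A E1 by (simp add: field_simps)
      also have "\<dots> \<le> cmod (1 - s)" using s norm_triangle_ineq2[of 1 s] by simp
      finally show ?thesis .
    qed
    ultimately have "d j * inverse E \<le> d (Suc j) + e"
      using mult_left_mono[of "inverse E" "cmod (1 - s)" "d j"] by (simp add: d_def)
    then show ?thesis using E1 by (simp add: field_simps)
  qed
  have "d (k - i) \<le> E ^ i * (d k + real i * e)" if "i \<le> k" for i
    using that
  proof (induction i)
    case (Suc i)
    have "d (k - Suc i) \<le> E * (d (Suc (k - Suc i)) + e)" by (rule bwd) (use Suc.prems in simp)
    also have "Suc (k - Suc i) = k - i" using Suc.prems by simp
    also have "E * (d (k - i) + e) \<le> E * (E ^ i * (d k + real i * e) + E ^ i * e)"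
    proof (intro mult_left_mono add_mono)
      show "d (k - i) \<le> E ^ i * (d k + real i * e)" using Suc by simp
      have "1 * e \<le> E ^ i * e" by (rule mult_right_mono) (use E1 e0 in auto)
      then show "e \<le> E ^ i * e" by simp
    qed (use E1 in simp)
    also have "\<dots> = E ^ Suc i * (d k + real (Suc i) * e)" by (simp add: algebra_simps)
    finally show ?case .
  qed simp
  from this[of "k - j"] have "d j \<le> E ^ (k - j) * (d k + real (k - j) * e)" using j by simp
  also have "\<dots> \<le> exp (4 * A * \<sigma>) * (d k + 2 * C * A ^ 3 * \<sigma> * r\<^sup>2)"
  proof (rule mult_mono)
    have "r * real (k - j) \<le> r * real k" using A by simp
    then have rkj: "r * real (k - j) \<le> \<sigma>" using rk by simp
    have "E ^ (k - j) = exp (4 * A * (r * real (k - j)))"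
      by (simp add: E_def exp_of_nat_mult[symmetric] mult_ac)
    also have "\<dots> \<le> exp (4 * A * \<sigma>)" using rkj A by simp
    finally show "E ^ (k - j) \<le> exp (4 * A * \<sigma>)" .
    have "real (k - j) * e = 2 * C * A ^ 3 * r\<^sup>2 * (r * real (k - j))"
      by (simp add: e_def power_mult_distrib power3_eq_cube power2_eq_square mult_ac)
    also have "\<dots> \<le> 2 * C * A ^ 3 * r\<^sup>2 * \<sigma>"
      by (rule mult_left_mono[OF rkj]) (use A C_nonneg in auto)
    finally show "d k + real (k - j) * e \<le> d k + 2 * C * A ^ 3 * \<sigma> * r\<^sup>2" by (simp add: mult_ac)
  qed (use e0 in \<open>auto simp: d_def\<close>)
  finally show ?thesis by (simp add: d_def)
qed

end

section \<open>Rescaled limits are constant\<close>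

text \<open>The bounds put the values omitted for \<open>\<sigma>\<close> and \<open>\<sigma> / 2\<close> on circles of different radius; little
  Picard applies.\<close>

lemma entire_const_if_omits_family:
  assumes "h holomorphic_on UNIV" "0 < \<sigma>"
    and omits: "\<And>\<tau>. 0 < \<tau> \<Longrightarrow> \<tau> \<le> \<sigma> \<Longrightarrow>
      \<exists>c. 7/9 \<le> cmod c * \<tau> \<and> cmod c * \<tau> \<le> 9/7 \<and> (\<forall>\<eta>. h \<eta> \<noteq> c)"
  shows "\<exists>c. h = (\<lambda>_. c)"
proof -
  obtain c1 where c1: "cmod c1 * \<sigma> \<le> 9/7" "\<forall>\<eta>. h \<eta> \<noteq> c1"
    using omits[of \<sigma>] assms by auto
  obtain c2 where c2: "7/9 \<le> cmod c2 * (\<sigma>/2)" "\<forall>\<eta>. h \<eta> \<noteq> c2"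
    using omits[of "\<sigma>/2"] assms by auto
  have "c1 \<noteq> c2" using c1(1) c2(1) by auto
  moreover have "range h \<inter> {c1, c2} = {}" using c1(2) c2(2) by auto
  ultimately show ?thesis by (meson little_Picard assms(1))
qed

context parabolic_germ
begin

text \<open>At scale \<open>r\<close> and over \<open>\<sigma> / r\<close> steps, \<open>P\<close> acts like the flow of \<open>z' = - z\<^sup>2\<close>, \<open>w' = w\<^sup>2 + b z\<^sup>2\<close>.
  The limit curve has bounded preimages under this flow for all small times \<open>\<sigma>\<close>. Backward solutions
  blow up when they start from the position of the orbit from infinity, which moves with \<open>\<sigma>\<close>, so the
  limit omits infinitely many values. This applies first to \<open>- z\<close>, without forcing term. Once \<open>z\<close> is
  constant in the limit, \<open>b z\<^sup>2\<close> is a forcing term common to all points, and the argument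
  applies to \<open>w\<close>.\<close>

lemma rescaled_limit_constant:
  fixes g :: "nat \<Rightarrow> nat \<Rightarrow> complex \<Rightarrow> C2"
  assumes step: "\<And>N m \<eta>. g N (Suc m) \<eta> = P (g N m \<eta>)"
    and r: "r \<longlonglongrightarrow> 0" "\<And>N. 0 < r N" "\<And>N. r N = norm (g N (n N) 0)"
    and time: "\<And>N. 1 / r N \<le> A0 + 2 * C1 * real (n N)"
    and small: "\<And>N m. m \<le> n N \<Longrightarrow> norm (g N m 0) \<le> \<delta> \<and> g N m 0 \<noteq> 0"
    and growth: "\<And>\<eta>. \<forall>\<^sub>F N in sequentially. \<forall>m\<le>n N. norm (g N m \<eta>) \<le> exp (2 * cmod \<eta>) * norm (g N m 0)"
    and lim: "\<And>\<eta>. (\<lambda>N. fst (g N (n N) \<eta>) / r N) \<longlonglongrightarrow> h1 \<eta>"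
      "\<And>\<eta>. (\<lambda>N. snd (g N (n N) \<eta>) / r N) \<longlonglongrightarrow> h2 \<eta>"
    and h: "h1 holomorphic_on UNIV" "h2 holomorphic_on UNIV"
  shows "\<exists>c1 c2. h1 = (\<lambda>_. c1) \<and> h2 = (\<lambda>_. c2)"
proof -
  define \<sigma>0 where "\<sigma>0 = 1 / (4 * C1)"
  have \<sigma>0: "0 < \<sigma>0" using C1_pos by (simp add: \<sigma>0_def)
  define k where "k \<sigma> N = nat \<lfloor>\<sigma> / r N\<rfloor>" for \<sigma> N
  define X where "X \<sigma> N j \<eta> = g N (n N - k \<sigma> N + j) \<eta>" for \<sigma> N j \<eta>
  define A where "A \<eta> = 2 * exp (2 * cmod \<eta>)" for \<eta> :: complex
  have A_ge: "2 \<le> A \<eta>" for \<eta> by (simp add: A_def)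
  have r_ev: "\<forall>\<^sub>F N in sequentially. M * r N \<le> e" if "0 < e" for M e
  proof -
    have "(\<lambda>N. M * r N) \<longlonglongrightarrow> M * 0" by (intro tendsto_intros r)
    then have "\<forall>\<^sub>F N in sequentially. M * r N < e" by (rule order_tendstoD) (use that in simp)
    then show ?thesis by eventually_elim simp
  qed
  have half: "0 < (1/2 :: real)" and quarter: "0 < (1/4 :: real)" by simp_all
  have Xstep: "X \<sigma> N (Suc j) \<eta> = P (X \<sigma> N j \<eta>)" for \<sigma> N j \<eta>
    by (simp add: X_def step)
  have rk_le: "r N * real (k \<sigma> N) \<le> \<sigma>" if "0 < \<sigma>" for \<sigma> N
  proof -
    have "real (k \<sigma> N) \<le> \<sigma> / r N" using that r(2)[of N] by (simp add: k_def)
    then show ?thesis using r(2)[of N] by (simp add: field_simps)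
  qed
  have rk_lim: "(\<lambda>N. r N * real (k \<sigma> N)) \<longlonglongrightarrow> \<sigma>" if "0 < \<sigma>" for \<sigma>
  proof (rule tendsto_sandwich)
    have "\<sigma> - r N \<le> r N * real (k \<sigma> N)" for N
    proof -
      have "\<sigma> / r N - 1 \<le> real (k \<sigma> N)" using that r(2)[of N] unfolding k_def by linarith
      then have "r N * (\<sigma> / r N - 1) \<le> r N * real (k \<sigma> N)" using r(2)[of N] by (intro mult_left_mono) auto
      moreover have "r N * (\<sigma> / r N - 1) = \<sigma> - r N" using r(2)[of N] by (simp add: right_diff_distrib)
      ultimately show ?thesis by simp
    qed
    then show "\<forall>\<^sub>F N in sequentially. \<sigma> - r N \<le> r N * real (k \<sigma> N)" by simp
    show "(\<lambda>N. \<sigma> - r N) \<longlonglongrightarrow> \<sigma>" using tendsto_diff[OF tendsto_const r(1)] by simp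
  qed (use rk_le[OF that] in auto)
  have k_le: "\<forall>\<^sub>F N in sequentially. k \<sigma> N \<le> n N" if \<sigma>: "0 < \<sigma>" "\<sigma> \<le> \<sigma>0" for \<sigma>
    using r_ev[OF half, of A0]
  proof eventually_elim
    case (elim N)
    have "A0 \<le> 1 / (2 * r N)" using elim r(2)[of N] by (simp add: field_simps)
    moreover have "1 / r N = 2 * (1 / (2 * r N))" by simp
    ultimately have "1 / r N \<le> 4 * C1 * real (n N)" using time[of N] by linarith
    then have "\<sigma>0 * (1 / r N) \<le> \<sigma>0 * (4 * C1 * real (n N))" using \<sigma>0 by (intro mult_left_mono) auto
    then have "\<sigma>0 / r N \<le> real (n N)" using C1_pos by (simp add: \<sigma>0_def)
    moreover have "\<sigma> / r N \<le> \<sigma>0 / r N" using \<sigma> r(2)[of N] by (simp add: divide_right_mono)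
    ultimately have "\<sigma> / r N \<le> real (n N)" by simp
    then show ?case unfolding k_def by (simp add: nat_le_iff floor_le_iff)
  qed
  have centre: "norm (X \<sigma> N j 0) \<le> 2 * r N"
    if \<sigma>: "0 < \<sigma>" "\<sigma> \<le> \<sigma>0" and kn: "k \<sigma> N \<le> n N" and j: "j \<le> k \<sigma> N" for \<sigma> N j
  proof -
    define m where "m = n N - k \<sigma> N + j"
    have m: "m + (k \<sigma> N - j) = n N" using kn j by (simp add: m_def)
    have "1 / norm (g N (m + (k \<sigma> N - j)) 0) \<le> 1 / norm (g N (m + 0) 0) + 2 * C1 * real (k \<sigma> N - j)"
      using inverse_norm_growth[of "k \<sigma> N - j" "\<lambda>i. g N (m + i) 0"] small[of _ N] m step by simp
    then have "1 / r N \<le> 1 / norm (g N m 0) + 2 * C1 * real (k \<sigma> N - j)"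
      unfolding m r(3)[symmetric] by simp
    moreover have "2 * C1 * real (k \<sigma> N - j) \<le> 1 / (2 * r N)"
    proof -
      have "r N * real (k \<sigma> N - j) \<le> r N * real (k \<sigma> N)" using r(2)[of N] by simp
      then have "r N * real (k \<sigma> N - j) \<le> \<sigma>0" using rk_le[OF \<sigma>(1), of N] \<sigma> by simp
      then have "2 * C1 * (r N * real (k \<sigma> N - j)) \<le> 2 * C1 * \<sigma>0"
        using C1_pos by (intro mult_left_mono) auto
      then show ?thesis using r(2)[of N] C1_pos by (simp add: \<sigma>0_def field_simps)
    qed
    ultimately have "1 / (2 * r N) \<le> 1 / norm (g N m 0)" by (simp add: field_simps)
    moreover have "0 < norm (g N m 0)" using small[of m N] m by simp
    ultimately have "norm (g N m 0) \<le> 2 * r N" using r(2)[of N] by (simp add: field_simps)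
    then show ?thesis by (simp add: X_def m_def)
  qed
  have Xb: "\<forall>\<^sub>F N in sequentially. \<forall>j\<le>k \<sigma> N. norm (X \<sigma> N j \<eta>) \<le> A \<eta> * r N"
    if \<sigma>: "0 < \<sigma>" "\<sigma> \<le> \<sigma>0" for \<sigma> \<eta>
    using k_le[OF \<sigma>] growth[of \<eta>]
  proof eventually_elim
    case (elim N)
    show ?case
    proof (intro allI impI)
      fix j assume j: "j \<le> k \<sigma> N"
      have "norm (X \<sigma> N j \<eta>) \<le> exp (2 * cmod \<eta>) * norm (X \<sigma> N j 0)"
        unfolding X_def using elim j by auto
      also have "\<dots> \<le> exp (2 * cmod \<eta>) * (2 * r N)"
        by (intro mult_left_mono centre \<sigma> elim j) simp
      finally show "norm (X \<sigma> N j \<eta>) \<le> A \<eta> * r N" by (simp add: A_def)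
    qed
  qed
  have X_end: "\<forall>\<^sub>F N in sequentially. \<forall>\<eta>. X \<sigma> N (k \<sigma> N) \<eta> = g N (n N) \<eta>" if \<sigma>: "0 < \<sigma>" "\<sigma> \<le> \<sigma>0" for \<sigma>
    using k_le[OF \<sigma>] by eventually_elim (simp add: X_def)
  have fst_le: "cmod (fst x) \<le> norm x" and snd_le: "cmod (snd x) \<le> norm x" for x :: C2
    using norm_fst_le[of "fst x" "snd x"] norm_snd_le[of "snd x" "fst x"] by simp_all
  have cube: "C * norm x ^ 3 \<le> C * A \<eta> ^ 3 * r N ^ 3" if "norm x \<le> A \<eta> * r N" for x :: C2 and \<eta> N
  proof -
    have "norm x ^ 3 \<le> (A \<eta> * r N) ^ 3" by (rule power_mono[OF that]) simp
    from mult_left_mono[OF this C_nonneg] show ?thesis by (simp add: power_mult_distrib mult.assoc)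
  qed

  \<comment> \<open>The step \<open>z \<mapsto> z - z\<^sup>2\<close> reads \<open>\<omega> \<mapsto> \<omega> + \<omega>\<^sup>2\<close> for \<open>\<omega> = - z\<close>.\<close>
  have "\<exists>c. (\<lambda>\<eta>. - h1 \<eta>) = (\<lambda>_. c)"
  proof (rule entire_const_if_omits_family[OF _ \<sigma>0])
    show "(\<lambda>\<eta>. - h1 \<eta>) holomorphic_on UNIV" by (intro holomorphic_intros h)
    fix \<sigma> :: real assume \<sigma>: "0 < \<sigma>" "\<sigma> \<le> \<sigma>0"
    show "\<exists>c. 7/9 \<le> cmod c * \<sigma> \<and> cmod c * \<sigma> \<le> 9/7 \<and> (\<forall>\<eta>. - h1 \<eta> \<noteq> c)"
    proof (rule riccati_limit_omits[where B = 0 and r = r and k = "k \<sigma>" and \<beta> = "\<lambda>_ _. 0"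
          and \<omega> = "\<lambda>N j \<eta>. - fst (X \<sigma> N j \<eta>)", OF r(1,2) rk_lim[OF \<sigma>(1)] rk_le[OF \<sigma>(1)] \<sigma>(1)])
      fix \<eta>
      have "\<forall>\<^sub>F N in sequentially. \<forall>j\<le>k \<sigma> N. cmod (- fst (X \<sigma> N j \<eta>)) \<le> A \<eta> * r N"
        using Xb[OF \<sigma>, of \<eta>]
        by eventually_elim (auto intro: order_trans[OF fst_le])
      then show "\<exists>A\<ge>0. \<forall>\<^sub>F N in sequentially. \<forall>j\<le>k \<sigma> N. cmod (- fst (X \<sigma> N j \<eta>)) \<le> A * r N"
        using A_ge[of \<eta>] by (intro exI[of _ "A \<eta>"]) auto
      have "\<forall>\<^sub>F N in sequentially. - fst (g N (n N) \<eta>) / r N = - fst (X \<sigma> N (k \<sigma> N) \<eta>) / r N"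
        using X_end[OF \<sigma>] by eventually_elim simp
      moreover have "(\<lambda>N. - fst (g N (n N) \<eta>) / r N) \<longlonglongrightarrow> - h1 \<eta>"
        using tendsto_minus[OF lim(1)[of \<eta>]] by simp
      ultimately show "(\<lambda>N. - fst (X \<sigma> N (k \<sigma> N) \<eta>) / r N) \<longlonglongrightarrow> - h1 \<eta>"
        by (rule Lim_transform_eventually[rotated])
    next
      fix \<eta> and \<epsilon> :: real assume \<epsilon>: "0 < \<epsilon>"
      show "\<forall>\<^sub>F N in sequentially. \<forall>j<k \<sigma> N. cmod (- fst (X \<sigma> N (Suc j) \<eta>)
          - (- fst (X \<sigma> N j \<eta>) + (- fst (X \<sigma> N j \<eta>))\<^sup>2 + 0)) \<le> \<epsilon> * (r N)\<^sup>2"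
        using Xb[OF \<sigma>, of \<eta>] r_ev[OF \<delta>_pos, of "A \<eta>"] r_ev[OF \<epsilon>, of "C * A \<eta> ^ 3"]
      proof eventually_elim
        case (elim N)
        show ?case
        proof (intro allI impI)
          fix j assume "j < k \<sigma> N"
          then have x: "norm (X \<sigma> N j \<eta>) \<le> A \<eta> * r N" using elim by auto
          have "cmod (- fst (X \<sigma> N (Suc j) \<eta>) - (- fst (X \<sigma> N j \<eta>) + (- fst (X \<sigma> N j \<eta>))\<^sup>2 + 0))
              = cmod (fst (P (X \<sigma> N j \<eta>)) - (fst (X \<sigma> N j \<eta>) - (fst (X \<sigma> N j \<eta>))\<^sup>2))"
            unfolding Xstep by (subst norm_minus_cancel[symmetric]) (simp add: algebra_simps)
          also have "\<dots> \<le> C * A \<eta> ^ 3 * r N ^ 3"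
            using fst_step[of "X \<sigma> N j \<eta>"] x elim cube[OF x] by simp
          also have "\<dots> = (C * A \<eta> ^ 3 * r N) * (r N)\<^sup>2" by (simp add: power3_eq_cube power2_eq_square)
          also have "\<dots> \<le> \<epsilon> * (r N)\<^sup>2" by (rule mult_right_mono) (use elim in auto)
          finally show "cmod (- fst (X \<sigma> N (Suc j) \<eta>) - (- fst (X \<sigma> N j \<eta>) + (- fst (X \<sigma> N j \<eta>))\<^sup>2 + 0))
            \<le> \<epsilon> * (r N)\<^sup>2" .
        qed
      qed
    qed simp_all
  qed
  then obtain c where "\<And>\<eta>. - h1 \<eta> = c" by metis
  then have h1: "h1 \<eta> = - c" for \<eta> by (metis minus_minus)

  define \<sigma>1 where "\<sigma>1 = min \<sigma>0 (min 1 (1 / (32 * (1 + cmod b))))"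
  have \<sigma>1: "0 < \<sigma>1" "\<sigma>1 \<le> \<sigma>0" "\<sigma>1 \<le> 1" "\<sigma>1 \<le> 1 / (32 * (1 + cmod b))"
    using \<sigma>0 unfolding \<sigma>1_def by (auto intro: min.coboundedI2 simp: add_pos_nonneg)
  \<comment> \<open>The forcing term is evaluated along the orbit of the centre; the error made at other points is
    controlled by the constancy of \<open>h1\<close>. The choice of \<open>\<sigma>1\<close> keeps \<open>4 \<bar>b\<bar> \<sigma>\<^sup>2\<close> below \<open>1/8\<close>.\<close>
  have "\<exists>c. h2 = (\<lambda>_. c)"
  proof (rule entire_const_if_omits_family[OF h(2) \<sigma>1(1)])
    fix \<sigma> :: real assume \<sigma>: "0 < \<sigma>" "\<sigma> \<le> \<sigma>1"
    then have \<sigma>': "0 < \<sigma>" "\<sigma> \<le> \<sigma>0" using \<sigma>1 by auto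
    show "\<exists>c. 7/9 \<le> cmod c * \<sigma> \<and> cmod c * \<sigma> \<le> 9/7 \<and> (\<forall>\<eta>. h2 \<eta> \<noteq> c)"
    proof (rule riccati_limit_omits[where B = "4 * cmod b" and r = r and k = "k \<sigma>"
          and \<beta> = "\<lambda>N j. b * (fst (X \<sigma> N j 0))\<^sup>2"
          and \<omega> = "\<lambda>N j \<eta>. snd (X \<sigma> N j \<eta>)", OF r(1,2) rk_lim[OF \<sigma>(1)] rk_le[OF \<sigma>(1)] \<sigma>(1)])
      show "4 * cmod b * \<sigma>\<^sup>2 \<le> 1/8"
      proof -
        have "\<sigma>\<^sup>2 \<le> \<sigma>" using \<sigma> \<sigma>1(3) by (simp add: power2_eq_square mult_left_le_one_le)
        also have "\<dots> \<le> 1 / (32 * (1 + cmod b))" using \<sigma> \<sigma>1(4) by simp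
        finally have "(4 * cmod b) * \<sigma>\<^sup>2 \<le> (4 * (1 + cmod b)) * (1 / (32 * (1 + cmod b)))"
          by (intro mult_mono) auto
        also have "\<dots> = 1/8"
        proof -
          have "1 + cmod b \<noteq> 0" using norm_ge_zero[of b] by linarith
          then show ?thesis by (simp add: field_simps)
        qed
        finally show ?thesis .
      qed
      show "\<forall>\<^sub>F N in sequentially. \<forall>j<k \<sigma> N. cmod (b * (fst (X \<sigma> N j 0))\<^sup>2) \<le> 4 * cmod b * (r N)\<^sup>2"
        using k_le[OF \<sigma>']
      proof eventually_elim
        case (elim N)
        show ?case
        proof (intro allI impI)
          fix j assume "j < k \<sigma> N"
          then have "cmod (fst (X \<sigma> N j 0)) \<le> 2 * r N"
            using centre[OF \<sigma>' elim, of j] fst_le[of "X \<sigma> N j 0"] by simp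
          then have "(cmod (fst (X \<sigma> N j 0)))\<^sup>2 \<le> (2 * r N)\<^sup>2" by (intro power_mono) auto
          from mult_left_mono[OF this norm_ge_zero[of b]]
          show "cmod (b * (fst (X \<sigma> N j 0))\<^sup>2) \<le> 4 * cmod b * (r N)\<^sup>2"
            by (simp add: norm_mult norm_power)
        qed
      qed
      fix \<eta>
      have "\<forall>\<^sub>F N in sequentially. \<forall>j\<le>k \<sigma> N. cmod (snd (X \<sigma> N j \<eta>)) \<le> A \<eta> * r N"
        using Xb[OF \<sigma>', of \<eta>]
        by eventually_elim (auto intro: order_trans[OF snd_le])
      then show "\<exists>A\<ge>0. \<forall>\<^sub>F N in sequentially. \<forall>j\<le>k \<sigma> N. cmod (snd (X \<sigma> N j \<eta>)) \<le> A * r N"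
        using A_ge[of \<eta>] by (intro exI[of _ "A \<eta>"]) auto
      have "\<forall>\<^sub>F N in sequentially. snd (g N (n N) \<eta>) / r N = snd (X \<sigma> N (k \<sigma> N) \<eta>) / r N"
        using X_end[OF \<sigma>'] by eventually_elim simp
      then show "(\<lambda>N. snd (X \<sigma> N (k \<sigma> N) \<eta>) / r N) \<longlonglongrightarrow> h2 \<eta>"
        by (rule Lim_transform_eventually[OF lim(2)])
    next
      fix \<eta> and \<epsilon> :: real assume \<epsilon>: "0 < \<epsilon>"
      define D where "D N = cmod (fst (g N (n N) \<eta>) / r N - fst (g N (n N) 0) / r N)" for N
      define E where "E N = C * A \<eta> ^ 3 * r N
        + cmod b * (2 * A \<eta>) * exp (4 * A \<eta> * \<sigma>) * (D N + 2 * C * A \<eta> ^ 3 * \<sigma> * r N)" for N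
      have "D \<longlonglongrightarrow> cmod (h1 \<eta> - h1 0)" unfolding D_def by (intro tendsto_intros lim)
      then have "D \<longlonglongrightarrow> 0" by (simp add: h1)
      then have "E \<longlonglongrightarrow> C * A \<eta> ^ 3 * 0
        + cmod b * (2 * A \<eta>) * exp (4 * A \<eta> * \<sigma>) * (0 + 2 * C * A \<eta> ^ 3 * \<sigma> * 0)"
        unfolding E_def by (intro tendsto_intros r)
      then have E_ev: "\<forall>\<^sub>F N in sequentially. E N < \<epsilon>"
        by (rule order_tendstoD) (use \<epsilon> in simp)
      have A0_le: "A 0 \<le> A \<eta>" by (simp add: A_def)
      show "\<forall>\<^sub>F N in sequentially. \<forall>j<k \<sigma> N. cmod (snd (X \<sigma> N (Suc j) \<eta>)
          - (snd (X \<sigma> N j \<eta>) + (snd (X \<sigma> N j \<eta>))\<^sup>2 + b * (fst (X \<sigma> N j 0))\<^sup>2)) \<le> \<epsilon> * (r N)\<^sup>2"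
        using Xb[OF \<sigma>', of \<eta>] Xb[OF \<sigma>', of 0] r_ev[OF \<delta>_pos, of "A \<eta>"] r_ev[OF quarter, of "A \<eta>"] E_ev X_end[OF \<sigma>']
      proof eventually_elim
        case (elim N)
        have x0: "norm (X \<sigma> N j 0) \<le> A \<eta> * r N" if "j \<le> k \<sigma> N" for j
        proof -
          have "norm (X \<sigma> N j 0) \<le> A 0 * r N" using elim that by auto
          also have "\<dots> \<le> A \<eta> * r N" by (rule mult_right_mono[OF A0_le]) (use r(2)[of N] in simp)
          finally show ?thesis .
        qed
        show ?case
        proof (intro allI impI)
          fix j assume j: "j < k \<sigma> N"
          then have x: "norm (X \<sigma> N j \<eta>) \<le> A \<eta> * r N" using elim by auto
          let ?z = "fst (X \<sigma> N j \<eta>)" and ?y = "fst (X \<sigma> N j 0)" and ?w = "snd (X \<sigma> N j \<eta>)"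
          have d: "cmod (?z - ?y) \<le> exp (4 * A \<eta> * \<sigma>) * (r N * D N + 2 * C * A \<eta> ^ 3 * \<sigma> * (r N)\<^sup>2)"
          proof -
            have "cmod (?z - ?y) \<le> exp (4 * A \<eta> * \<sigma>) *
              (cmod (fst (X \<sigma> N (k \<sigma> N) \<eta>) - fst (X \<sigma> N (k \<sigma> N) 0)) + 2 * C * A \<eta> ^ 3 * \<sigma> * (r N)\<^sup>2)"
              by (rule fst_difference_backward)
                (use elim x0 j A_ge[of \<eta>] r(2)[of N] rk_le[OF \<sigma>(1), of N] in \<open>auto simp: Xstep\<close>)
            moreover have "cmod (fst (X \<sigma> N (k \<sigma> N) \<eta>) - fst (X \<sigma> N (k \<sigma> N) 0)) = r N * D N"
              using elim r(2)[of N] by (simp add: D_def norm_divide flip: diff_divide_distrib)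
            ultimately show ?thesis by simp
          qed
          have sum_le: "cmod (?z + ?y) \<le> 2 * A \<eta> * r N"
            using norm_triangle_ineq[of ?z ?y] fst_le[of "X \<sigma> N j \<eta>"] fst_le[of "X \<sigma> N j 0"] x x0[of j] j
            by auto
          have "cmod (b * (?z\<^sup>2 - ?y\<^sup>2)) = cmod b * (cmod (?z + ?y) * cmod (?z - ?y))"
            by (simp add: power2_eq_square square_diff_square_factored norm_mult)
          also have "\<dots> \<le> cmod b * ((2 * A \<eta> * r N) *
              (exp (4 * A \<eta> * \<sigma>) * (r N * D N + 2 * C * A \<eta> ^ 3 * \<sigma> * (r N)\<^sup>2)))"
            by (intro mult_left_mono mult_mono d sum_le) (use A_ge[of \<eta>] r(2)[of N] in auto)
          finally have 1: "cmod (b * (?z\<^sup>2 - ?y\<^sup>2)) \<le> cmod b * ((2 * A \<eta> * r N) *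
              (exp (4 * A \<eta> * \<sigma>) * (r N * D N + 2 * C * A \<eta> ^ 3 * \<sigma> * (r N)\<^sup>2)))" .
          have 2: "cmod (snd (P (X \<sigma> N j \<eta>)) - (?w + ?w\<^sup>2 + b * ?z\<^sup>2)) \<le> C * A \<eta> ^ 3 * r N ^ 3"
            using snd_step[of "X \<sigma> N j \<eta>"] x elim cube[OF x] by simp
          have "snd (X \<sigma> N (Suc j) \<eta>) - (?w + ?w\<^sup>2 + b * ?y\<^sup>2)
            = (snd (P (X \<sigma> N j \<eta>)) - (?w + ?w\<^sup>2 + b * ?z\<^sup>2)) + b * (?z\<^sup>2 - ?y\<^sup>2)"
            by (simp add: Xstep algebra_simps)
          then have "cmod (snd (X \<sigma> N (Suc j) \<eta>) - (?w + ?w\<^sup>2 + b * ?y\<^sup>2))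
            \<le> C * A \<eta> ^ 3 * r N ^ 3 + cmod b * ((2 * A \<eta> * r N) *
              (exp (4 * A \<eta> * \<sigma>) * (r N * D N + 2 * C * A \<eta> ^ 3 * \<sigma> * (r N)\<^sup>2)))"
            using norm_triangle_mono[OF 2 1] by (simp only:)
          also have "\<dots> = E N * (r N)\<^sup>2"
            by (simp add: E_def power2_eq_square power3_eq_cube algebra_simps)
          also have "\<dots> \<le> \<epsilon> * (r N)\<^sup>2" by (rule mult_right_mono) (use elim in auto)
          finally show "cmod (snd (X \<sigma> N (Suc j) \<eta>) - (?w + ?w\<^sup>2 + b * ?y\<^sup>2)) \<le> \<epsilon> * (r N)\<^sup>2" .
        qed
      qed
    qed simp_all
  qed
  moreover have "h1 = (\<lambda>_. - c)" using h1 by auto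
  ultimately show ?thesis by blast
qed

end

section \<open>Uniform bounds for logarithmic derivatives\<close>

lemma montel_entire:
  fixes F :: "nat \<Rightarrow> complex \<Rightarrow> complex"
  assumes "\<And>N. F N holomorphic_on UNIV"
    and "\<And>R. \<exists>B. \<forall>\<^sub>F N in sequentially. \<forall>\<eta>. cmod \<eta> \<le> R \<longrightarrow> cmod (F N \<eta>) \<le> B"
  shows "\<exists>h s. h holomorphic_on UNIV \<and> strict_mono (s :: nat \<Rightarrow> nat) \<and>
    (\<forall>K. compact K \<longrightarrow> uniform_limit K (\<lambda>N. F (s N)) h sequentially)"
proof -
  have bounded: "\<exists>B. \<forall>f\<in>range F. \<forall>z\<in>K. norm (f z) \<le> B" if K: "compact K" for K
  proof -
    obtain R where R: "\<And>z. z \<in> K \<Longrightarrow> cmod z \<le> R"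
      using compact_imp_bounded[OF K] by (auto simp: bounded_iff)
    obtain B N0 where B: "\<And>N \<eta>. N0 \<le> N \<Longrightarrow> cmod \<eta> \<le> R \<Longrightarrow> cmod (F N \<eta>) \<le> B"
      using assms(2)[of R] by (auto simp: eventually_sequentially)
    have "\<exists>B. \<forall>z\<in>K. cmod (F N z) \<le> B" for N
    proof -
      have "compact (F N ` K)"
        by (intro compact_continuous_image K holomorphic_on_imp_continuous_on
            holomorphic_on_subset[OF assms(1)]) simp
      then have "bounded (F N ` K)" by (rule compact_imp_bounded)
      then show ?thesis unfolding bounded_iff by blast
    qed
    then obtain b where b: "\<And>N z. z \<in> K \<Longrightarrow> cmod (F N z) \<le> b N" by metis
    have "cmod (F N z) \<le> max B (Max (b ` {..N0}))" if z: "z \<in> K" for N z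
    proof (cases "N0 \<le> N")
      case True
      then show ?thesis using B R z by (simp add: le_max_iff_disj)
    next
      case False
      then have "b N \<le> Max (b ` {..N0})" by (intro Max_ge) auto
      then show ?thesis using b[OF z, of N] by (simp add: le_max_iff_disj)
    qed
    then show ?thesis by (intro exI[of _ "max B (Max (b ` {..N0}))"]) auto
  qed
  obtain h s where hs: "h holomorphic_on UNIV" "strict_mono (s :: nat \<Rightarrow> nat)"
      "\<And>K. \<lbrakk>compact K; K \<subseteq> UNIV\<rbrakk> \<Longrightarrow> uniform_limit K (F \<circ> s) h sequentially"
  proof (rule Montel[of UNIV "range F" F])
    show "\<And>h. h \<in> range F \<Longrightarrow> h holomorphic_on UNIV" using assms(1) by blast
    show "\<exists>B. \<forall>f\<in>range F. \<forall>z\<in>K. norm (f z) \<le> B" if "compact K" "K \<subseteq> UNIV" for K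
      by (rule bounded[OF that(1)])
  qed auto
  show ?thesis
    using hs(1,2) hs(3)[OF _ subset_UNIV] by (intro exI[of _ h] exI[of _ s]) (simp add: o_def)
qed

lemma deriv_tendsto_0:
  fixes F :: "nat \<Rightarrow> complex \<Rightarrow> complex"
  assumes "\<And>N. F N holomorphic_on UNIV"
    and "uniform_limit (cball 0 1) F (\<lambda>_. c) sequentially"
  shows "(\<lambda>N. deriv (F N) 0) \<longlonglongrightarrow> 0"
proof (rule tendstoI)
  fix e :: real assume e: "0 < e"
  have "\<forall>\<^sub>F N in sequentially. \<forall>x\<in>cball 0 1. dist (F N x) c < e / 2"
    using assms(2) e by (intro uniform_limitD) auto
  then show "\<forall>\<^sub>F N in sequentially. dist (deriv (F N) 0) 0 < e"
  proof eventually_elim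
    case (elim N)
    have hol: "(\<lambda>x. F N x - c) holomorphic_on UNIV" by (intro holomorphic_intros assms)
    have "norm ((deriv ^^ 1) (\<lambda>x. F N x - c) 0) \<le> fact 1 * (e / 2) / 1 ^ 1"
    proof (rule Cauchy_inequality)
      show "(\<lambda>x. F N x - c) holomorphic_on ball 0 1" using hol by (rule holomorphic_on_subset) simp
      show "continuous_on (cball 0 1) (\<lambda>x. F N x - c)"
        by (rule holomorphic_on_imp_continuous_on[OF holomorphic_on_subset[OF hol]]) simp
      fix x :: complex assume "norm (0 - x) = 1"
      then have "x \<in> cball 0 1" by simp
      then have "dist (F N x) c < e / 2" using elim by blast
      then show "norm (F N x - c) \<le> e / 2" by (simp add: dist_norm)
    qed simp
    moreover have "deriv (\<lambda>x. F N x - c) 0 = deriv (F N) 0"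
    proof -
      have "F N field_differentiable at 0"
        by (rule holomorphic_on_imp_differentiable_at[OF assms(1)]) auto
      then show ?thesis by (subst deriv_diff) auto
    qed
    ultimately show ?case using e by simp
  qed
qed

context parabolic_germ
begin

text \<open>If the logarithmic derivatives were unbounded, the Brody rescaling would produce a limit curve whose
  derivative at the centre has norm 1, whereas all such limits are constant. The curves avoid
  the origin and tend to it uniformly; the first property makes the logarithmic derivative finite, the
  second one makes the scale \<open>r\<close> tend to 0.\<close>

theorem log_derivative_bound:
  fixes f :: "nat \<Rightarrow> complex \<Rightarrow> C2"
  assumes curve: "holomorphic_curve (f 0)" and step: "\<And>n \<xi>. f (Suc n) \<xi> = P (f n \<xi>)"
    and nz: "\<And>\<xi>. cmod \<xi> \<le> 1 \<Longrightarrow> f 0 \<xi> \<noteq> 0"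
    and small: "\<And>n \<xi>. cmod \<xi> \<le> 1 \<Longrightarrow> norm (f n \<xi>) \<le> \<delta>"
    and unif: "uniform_limit (cball 0 1) f (\<lambda>_. 0) sequentially"
  shows "\<exists>L. \<forall>n \<xi>. cmod \<xi> \<le> 1/2 \<longrightarrow> norm (curve_deriv (f n) \<xi>) \<le> L * norm (f n \<xi>)"
proof (rule ccontr)
  assume "\<not> ?thesis"
  then have unbounded: "\<exists>n \<xi>. cmod \<xi> \<le> 1/2 \<and> L * norm (f n \<xi>) < norm (curve_deriv (f n) \<xi>)" for L
    by (meson not_le)
  have curves: "holomorphic_curve (f n)" for n
  proof (induction n)
    case (Suc n)
    then show ?case using holomorphic_curve_compose[OF hol, of "f n"] by (simp add: step[abs_def])
  qed (rule curve)
  have inv: "f n \<xi> \<noteq> 0 \<and> 1 / norm (f n \<xi>) \<le> 1 / norm (f 0 \<xi>) + 2 * C1 * real n" if "cmod \<xi> \<le> 1" for n \<xi>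
    using inverse_norm_growth[of n "\<lambda>n. f n \<xi>"] step small[OF that] nz[OF that] by simp
  obtain A0 where A0: "\<And>\<xi>. cmod \<xi> \<le> 1 \<Longrightarrow> 1 / norm (f 0 \<xi>) \<le> A0"
  proof -
    have "continuous_on (cball 0 1) (\<lambda>\<xi>. 1 / norm (f 0 \<xi>))"
      using nz by (intro continuous_intros holomorphic_curve_continuous[OF curve]) auto
    then have "bounded ((\<lambda>\<xi>. 1 / norm (f 0 \<xi>)) ` cball 0 1)"
      by (intro compact_imp_bounded compact_continuous_image) auto
    then obtain A where "\<And>\<xi>. \<xi> \<in> cball 0 1 \<Longrightarrow> norm (1 / norm (f 0 \<xi>)) \<le> A"
      unfolding bounded_iff by blast
    then show ?thesis by (intro that[of A]) simp
  qed
  define Q where "Q N n a \<rho> \<longleftrightarrow> N \<le> n \<and> 0 < \<rho> \<and> cmod a \<le> 1 \<and>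
    \<rho> * norm (curve_deriv (f n) a) = norm (f n a) \<and>
    (\<forall>m\<le>n. \<forall>\<eta>::complex. cmod \<eta> \<le> real N \<longrightarrow> cmod (a + \<rho> * \<eta>) \<le> 1 \<and>
       \<rho> * norm (curve_deriv (f m) (a + \<rho> * \<eta>)) \<le> 2 * norm (f m (a + \<rho> * \<eta>)))"
    for N n :: nat and a :: complex and \<rho> :: real
  have "\<exists>n a \<rho>. Q N n a \<rho>" for N
    unfolding Q_def by (rule brody_rescaling[OF curves _ unbounded]) (simp add: inv)
  then obtain n a \<rho> where Q: "\<And>N. Q N (n N) (a N) (\<rho> N)" by metis
  have n: "N \<le> n N" and \<rho>: "0 < \<rho> N" and a: "cmod (a N) \<le> 1"
    and max: "\<rho> N * norm (curve_deriv (f (n N)) (a N)) = norm (f (n N) (a N))" for N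
    using Q[of N] unfolding Q_def by blast+
  have near: "cmod (a N + \<rho> N * \<eta>) \<le> 1 \<and>
       \<rho> N * norm (curve_deriv (f m) (a N + \<rho> N * \<eta>)) \<le> 2 * norm (f m (a N + \<rho> N * \<eta>))"
    if "m \<le> n N" "cmod \<eta> \<le> real N" for N m and \<eta> :: complex
    using Q[of N] that unfolding Q_def by blast
  define g where "g N m \<eta> = f m (a N + \<rho> N * \<eta>)" for N m and \<eta> :: complex
  define r where "r N = norm (f (n N) (a N))" for N
  have r_pos: "0 < r N" for N using inv[OF a] by (simp add: r_def)
  have g_curve: "holomorphic_curve (g N m)" for N m
    unfolding g_def by (rule curve_affine(1)[OF curves])
  have g_deriv: "norm (curve_deriv (g N m) \<eta>) = \<rho> N * norm (curve_deriv (f m) (a N + \<rho> N * \<eta>))" for N m and \<eta> :: complex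
    using curve_affine(2)[OF curves, of m "a N" "\<rho> N"] \<rho>[of N] by (simp add: g_def[abs_def] norm_cscale)
  have growth: "norm (g N m \<eta>) \<le> exp (2 * cmod \<eta>) * norm (g N m 0)"
    if "m \<le> n N" "cmod \<eta> \<le> real N" for N m \<eta>
  proof -
    have "norm (curve_deriv (g N m) \<zeta>) \<le> 2 * norm (g N m \<zeta>)" if "\<zeta> \<in> closed_segment 0 \<eta>" for \<zeta>
    proof -
      have "cmod \<zeta> \<le> cmod \<eta>" using segment_bound1[OF that] by simp
      then show ?thesis using near[OF \<open>m \<le> n N\<close>, of \<zeta>] \<open>cmod \<eta> \<le> real N\<close>
        unfolding g_deriv by (simp add: g_def)
    qed
    then show ?thesis using curve_norm_growth[OF g_curve, of 0 \<eta> N m 2] by simp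
  qed
  have r_lim: "r \<longlonglongrightarrow> 0"
  proof (rule tendstoI)
    fix e :: real assume "0 < e"
    then have "\<forall>\<^sub>F m in sequentially. \<forall>\<xi>\<in>cball 0 1. dist (f m \<xi>) 0 < e"
      by (rule uniform_limitD[OF unif])
    then obtain M where M: "\<forall>m\<ge>M. \<forall>\<xi>\<in>cball 0 1. dist (f m \<xi>) 0 < e"
      unfolding eventually_sequentially by blast
    show "\<forall>\<^sub>F N in sequentially. dist (r N) 0 < e"
      using eventually_ge_at_top[of M]
    proof eventually_elim
      case (elim N)
      then have "M \<le> n N" "a N \<in> cball 0 1" using n[of N] a[of N] by auto
      then have "dist (f (n N) (a N)) 0 < e" using M by blast
      then show ?case by (simp add: r_def)
    qed
  qed
  have g_end: "norm (g N (n N) \<eta>) / r N \<le> exp (2 * cmod \<eta>)" if "cmod \<eta> \<le> real N" for N \<eta>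
    using growth[OF order_refl that] r_pos[of N] by (simp add: r_def g_def field_simps)
  have hol_fst: "(\<lambda>\<eta>. fst (g N (n N) \<eta>) / r N) holomorphic_on UNIV"
    and hol_snd: "(\<lambda>\<eta>. snd (g N (n N) \<eta>) / r N) holomorphic_on UNIV" for N
    using g_curve[of N "n N"] r_pos[of N] unfolding holomorphic_curve_def
    by (auto intro!: holomorphic_intros)
  have bd: "\<forall>\<^sub>F N in sequentially. \<forall>\<eta>. cmod \<eta> \<le> R \<longrightarrow> norm (g N (n N) \<eta>) / r N \<le> exp (2 * R)" for R
    using eventually_ge_at_top[of "nat \<lceil>R\<rceil>"]
  proof eventually_elim
    case (elim N)
    show ?case
    proof (intro allI impI)
      fix \<eta> :: complex assume "cmod \<eta> \<le> R"
      then have "norm (g N (n N) \<eta>) / r N \<le> exp (2 * cmod \<eta>)" using elim by (intro g_end) linarith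
      also have "\<dots> \<le> exp (2 * R)" using \<open>cmod \<eta> \<le> R\<close> by simp
      finally show "norm (g N (n N) \<eta>) / r N \<le> exp (2 * R)" .
    qed
  qed
  have fst_le: "cmod (fst x) \<le> norm x" and snd_le: "cmod (snd x) \<le> norm x" for x :: C2
    using norm_fst_le[of "fst x" "snd x"] norm_snd_le[of "snd x" "fst x"] by simp_all
  have bd1: "\<exists>B. \<forall>\<^sub>F N in sequentially. \<forall>\<eta>. cmod \<eta> \<le> R \<longrightarrow> cmod (fst (g N (n N) \<eta>) / r N) \<le> B" for R
    using bd[of R]
  proof (intro exI[of _ "exp (2 * R)"], eventually_elim)
    case (elim N)
    then show ?case
      using r_pos[of N] by (auto simp: norm_divide intro: order_trans[OF divide_right_mono[OF fst_le]])
  qed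
  from montel_entire[OF hol_fst bd1]
  obtain h1 s1 where h1: "h1 holomorphic_on UNIV" "strict_mono (s1 :: nat \<Rightarrow> nat)"
    "\<forall>K. compact K \<longrightarrow> uniform_limit K (\<lambda>N \<eta>. fst (g (s1 N) (n (s1 N)) \<eta>) / r (s1 N)) h1 sequentially"
    by (elim exE conjE)
  have bd2: "\<exists>B. \<forall>\<^sub>F N in sequentially. \<forall>\<eta>. cmod \<eta> \<le> R \<longrightarrow>
      cmod (snd (g (s1 N) (n (s1 N)) \<eta>) / r (s1 N)) \<le> B" for R
    using eventually_subseq[OF h1(2) bd[of R]]
  proof (intro exI[of _ "exp (2 * R)"], eventually_elim)
    case (elim N)
    then show ?case
      using r_pos[of "s1 N"] by (auto simp: norm_divide intro: order_trans[OF divide_right_mono[OF snd_le]])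
  qed
  from montel_entire[OF hol_snd bd2]
  obtain h2 s2 where h2: "h2 holomorphic_on UNIV" "strict_mono (s2 :: nat \<Rightarrow> nat)"
    "\<forall>K. compact K \<longrightarrow> uniform_limit K
      (\<lambda>N \<eta>. snd (g (s1 (s2 N)) (n (s1 (s2 N))) \<eta>) / r (s1 (s2 N))) h2 sequentially"
    by (elim exE conjE)
  define s where "s i = s1 (s2 i)" for i
  have s: "strict_mono s" using h1(2) h2(2) by (simp add: s_def strict_mono_def)
  have u1: "uniform_limit K (\<lambda>i \<eta>. fst (g (s i) (n (s i)) \<eta>) / r (s i)) h1 sequentially" if "compact K" for K
  proof -
    have "filterlim s2 sequentially sequentially" by (rule filterlim_subseq[OF h2(2)])
    from filterlim_compose[OF h1(3)[rule_format, OF that] this]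
    show ?thesis by (simp add: s_def)
  qed
  have u2: "uniform_limit K (\<lambda>i \<eta>. snd (g (s i) (n (s i)) \<eta>) / r (s i)) h2 sequentially" if "compact K" for K
    using h2(3)[rule_format, OF that] by (simp add: s_def)
  have "\<exists>c1 c2. h1 = (\<lambda>_. c1) \<and> h2 = (\<lambda>_. c2)"
  proof (rule rescaled_limit_constant[where g = "\<lambda>i. g (s i)" and r = "\<lambda>i. r (s i)" and n = "\<lambda>i. n (s i)" and ?A0.0 = A0])
    show "g (s i) (Suc m) \<eta> = P (g (s i) m \<eta>)" for i m \<eta> by (simp add: g_def step)
    show "(\<lambda>i. r (s i)) \<longlonglongrightarrow> 0" using LIMSEQ_subseq_LIMSEQ[OF r_lim s] by (simp add: o_def)
    show "0 < r (s i)" for i by (rule r_pos)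
    show "r (s i) = norm (g (s i) (n (s i)) 0)" for i by (simp add: r_def g_def)
    show "1 / r (s i) \<le> A0 + 2 * C1 * real (n (s i))" for i
      using inv[OF a, of "n (s i)" "s i"] A0[OF a, of "s i"] by (simp add: r_def)
    show "norm (g (s i) m 0) \<le> \<delta> \<and> g (s i) m 0 \<noteq> 0" for i m
      using small[OF a] inv[OF a] by (simp add: g_def)
    show "\<forall>\<^sub>F i in sequentially. \<forall>m\<le>n (s i). norm (g (s i) m \<eta>) \<le> exp (2 * cmod \<eta>) * norm (g (s i) m 0)" for \<eta>
      using eventually_ge_at_top[of "nat \<lceil>cmod \<eta>\<rceil>"]
    proof eventually_elim
      case (elim i)
      then have "cmod \<eta> \<le> real (s i)" using seq_suble[OF s, of i] by linarith
      then show ?case using growth by blast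
    qed
    show "(\<lambda>i. fst (g (s i) (n (s i)) \<eta>) / r (s i)) \<longlonglongrightarrow> h1 \<eta>" for \<eta>
      using tendsto_uniform_limitI[OF u1[of "{\<eta>}"], of \<eta>] by simp
    show "(\<lambda>i. snd (g (s i) (n (s i)) \<eta>) / r (s i)) \<longlonglongrightarrow> h2 \<eta>" for \<eta>
      using tendsto_uniform_limitI[OF u2[of "{\<eta>}"], of \<eta>] by simp
  qed (fact h1(1) h2(1))+
  then obtain c1 c2 where c: "h1 = (\<lambda>_. c1)" "h2 = (\<lambda>_. c2)" by blast
  have "(\<lambda>i. deriv (\<lambda>\<eta>. fst (g (s i) (n (s i)) \<eta>) / r (s i)) 0) \<longlonglongrightarrow> 0"
    by (rule deriv_tendsto_0[OF hol_fst]) (use u1[of "cball 0 1"] c in simp)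
  then have e1: "\<forall>\<^sub>F i in sequentially. norm (deriv (\<lambda>\<eta>. fst (g (s i) (n (s i)) \<eta>) / r (s i)) 0) < 1/4"
    by (auto dest!: tendstoD[of _ _ _ "1/4"] simp: dist_norm)
  have "(\<lambda>i. deriv (\<lambda>\<eta>. snd (g (s i) (n (s i)) \<eta>) / r (s i)) 0) \<longlonglongrightarrow> 0"
    by (rule deriv_tendsto_0[OF hol_snd]) (use u2[of "cball 0 1"] c in simp)
  then have e2: "\<forall>\<^sub>F i in sequentially. norm (deriv (\<lambda>\<eta>. snd (g (s i) (n (s i)) \<eta>) / r (s i)) 0) < 1/4"
    by (auto dest!: tendstoD[of _ _ _ "1/4"] simp: dist_norm)
  have "\<forall>\<^sub>F i in sequentially. False"
    using e1 e2
  proof eventually_elim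
    case (elim i)
    define G where "G = g (s i) (n (s i))"
    define R where "R = r (s i)"
    have R: "0 < R" using r_pos by (simp add: R_def)
    have diff: "(\<lambda>\<eta>. fst (G \<eta>)) field_differentiable at 0" "(\<lambda>\<eta>. snd (G \<eta>)) field_differentiable at 0"
      using g_curve[of "s i" "n (s i)"] unfolding G_def holomorphic_curve_def
      by (auto intro: holomorphic_on_imp_differentiable_at)
    have "cmod (deriv (\<lambda>\<eta>. fst (G \<eta>)) 0 / R) < 1/4" "cmod (deriv (\<lambda>\<eta>. snd (G \<eta>)) 0 / R) < 1/4"
      using elim unfolding G_def[symmetric] R_def[symmetric]
        deriv_cdivide_right[OF diff(1)] deriv_cdivide_right[OF diff(2)] .
    then have "cmod (deriv (\<lambda>\<eta>. fst (G \<eta>)) 0) \<le> R / 4" "cmod (deriv (\<lambda>\<eta>. snd (G \<eta>)) 0) \<le> R / 4"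
      using R by (simp_all add: norm_divide field_simps)
    then have "norm (curve_deriv G 0) \<le> R / 2"
      using norm_Pair_le[of "deriv (\<lambda>\<eta>. fst (G \<eta>)) 0" "deriv (\<lambda>\<eta>. snd (G \<eta>)) 0"]
      by (simp add: curve_deriv_def)
    moreover have "norm (curve_deriv G 0) = R"
      unfolding G_def g_deriv R_def using max[of "s i"] by (simp add: r_def)
    ultimately show False using R by simp
  qed
  then show False by simp
qed

end

section \<open>Tangency propagates\<close>

text \<open>The sine of the angle to the line of \<open>(1, t)\<close>, up to a constant factor and a phase.\<close>

definition tangency_defect :: "complex \<Rightarrow> C2 \<Rightarrow> complex" where
  "tangency_defect t x = (snd x - t * fst x) / norm x"

lemma norm_linear_form: "cmod (snd x - t * fst x) \<le> (1 + cmod t) * norm (x :: C2)"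
proof -
  have "cmod (snd x - t * fst x) \<le> cmod (snd x) + cmod t * cmod (fst x)"
    using norm_triangle_ineq4[of "snd x" "t * fst x"] by (simp add: norm_mult)
  also have "\<dots> \<le> norm x + cmod t * norm x"
    using norm_fst_le[of "fst x" "snd x"] norm_snd_le[of "snd x" "fst x"]
    by (intro add_mono mult_left_mono) auto
  finally show ?thesis by (simp add: algebra_simps)
qed

lemma zero_notin_attracted_domain:
  assumes "invariant_attracted_domain P \<Omega>"
  shows "0 \<notin> \<Omega>"
  using assms unfolding invariant_attracted_domain_def frontier_def by (auto simp: interior_open)

lemma iterate_in_attracted_domain:
  assumes "invariant_attracted_domain P \<Omega>" "x \<in> \<Omega>"
  shows "(P ^^ n) x \<in> \<Omega>"
  using assms by (induction n) (auto simp: invariant_attracted_domain_def)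

lemma holomorphic_curve_iterate:
  assumes "holomorphic_C2 P" "holomorphic_curve f"
  shows "holomorphic_curve (\<lambda>\<xi>. (P ^^ n) (f \<xi>))"
proof (induction n)
  case (Suc n)
  from holomorphic_curve_compose[OF assms(1) this] show ?case by simp
qed (simp add: assms(2))

lemma subseq_of_not_tendsto_0:
  fixes X :: "nat \<Rightarrow> complex"
  assumes "\<not> X \<longlonglongrightarrow> 0"
  shows "\<exists>e>0. \<exists>s. strict_mono (s :: nat \<Rightarrow> nat) \<and> (\<forall>n. e \<le> cmod (X (s n)))"
proof -
  obtain e where e: "0 < e" "\<not> (\<forall>\<^sub>F n in sequentially. cmod (X n) < e)"
    using assms by (auto simp: tendsto_iff)
  then have "\<forall>m. \<exists>n\<ge>m. n \<in> {n. e \<le> cmod (X n)}"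
    by (auto simp: eventually_sequentially not_less)
  then have "infinite {n. e \<le> cmod (X n)}"
    unfolding infinite_nat_iff_unbounded_le by blast
  from infinite_enumerate[OF this] e(1) show ?thesis by auto
qed

context parabolic_germ
begin

text \<open>By the bound on logarithmic derivatives all values of \<open>P\<^sup>n\<close> on the half disc are comparable to the
  one at the centre. Divided by it, the linear form that vanishes on \<open>(1, t)\<close> gives a bounded sequence
  of holomorphic functions that tends to 0 near the centre, hence on the whole half disc by
  Montel's theorem and the identity theorem.\<close>

lemma tangency_along_disc:
  assumes \<Omega>: "invariant_attracted_domain P \<Omega>"
    and unif: "uniform_limit U (\<lambda>n. P ^^ n) (\<lambda>_. 0) sequentially"
    and \<phi>: "holomorphic_curve \<phi>" "\<And>\<xi>. cmod \<xi> \<le> 1 \<Longrightarrow> \<phi> \<xi> \<in> U \<inter> \<Omega>"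
    and V: "open V" "\<phi> 0 \<in> V" "\<And>y. y \<in> V \<Longrightarrow> (\<lambda>n. tangency_defect t ((P ^^ n) y)) \<longlonglongrightarrow> 0"
  shows "(\<lambda>n. tangency_defect t ((P ^^ n) (\<phi> (1/4)))) \<longlonglongrightarrow> 0"
proof -
  have "\<forall>\<^sub>F n in sequentially. \<forall>x\<in>U. dist ((P ^^ n) x) 0 < \<delta>"
    by (rule uniform_limitD[OF unif \<delta>_pos])
  then obtain n0 where n0: "\<forall>n\<ge>n0. \<forall>x\<in>U. dist ((P ^^ n) x) 0 < \<delta>"
    unfolding eventually_sequentially by blast
  define f where "f n \<xi> = (P ^^ (n + n0)) (\<phi> \<xi>)" for n \<xi>
  have f_nz: "f n \<xi> \<noteq> 0" if "cmod \<xi> \<le> 1" for n \<xi>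
    using iterate_in_attracted_domain[OF \<Omega>, of "\<phi> \<xi>" "n + n0"] \<phi>(2)[OF that]
      zero_notin_attracted_domain[OF \<Omega>] by (auto simp: f_def)
  have f_curve: "holomorphic_curve (f n)" for n
    unfolding f_def by (rule holomorphic_curve_iterate[OF hol \<phi>(1)])
  have "\<exists>L. \<forall>n \<xi>. cmod \<xi> \<le> 1/2 \<longrightarrow> norm (curve_deriv (f n) \<xi>) \<le> L * norm (f n \<xi>)"
  proof (rule log_derivative_bound)
    show "norm (f n \<xi>) \<le> \<delta>" if "cmod \<xi> \<le> 1" for n \<xi>
    proof -
      have "dist ((P ^^ (n + n0)) (\<phi> \<xi>)) 0 < \<delta>" using n0 \<phi>(2)[OF that] by auto
      then show ?thesis by (simp add: f_def)
    qed
    show "uniform_limit (cball 0 1) f (\<lambda>_. 0) sequentially"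
    proof (rule uniform_limitI)
      fix e :: real assume "0 < e"
      then have "\<forall>\<^sub>F n in sequentially. \<forall>x\<in>U. dist ((P ^^ n) x) 0 < e"
        by (rule uniform_limitD[OF unif])
      then have "\<forall>\<^sub>F n in sequentially. \<forall>x\<in>U. dist ((P ^^ (n + n0)) x) 0 < e"
        by (rule sequentially_offset)
      then show "\<forall>\<^sub>F n in sequentially. \<forall>\<xi>\<in>cball 0 1. dist (f n \<xi>) 0 < e"
      proof eventually_elim
        case (elim n)
        show ?case
        proof
          fix \<xi> :: complex assume "\<xi> \<in> cball 0 1"
          then have "\<phi> \<xi> \<in> U" using \<phi>(2)[of \<xi>] by simp
          then show "dist (f n \<xi>) 0 < e" using elim unfolding f_def by blast
        qed
      qed
    qed
    show "holomorphic_curve (f 0)" by (rule f_curve)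
    show "f (Suc n) \<xi> = P (f n \<xi>)" for n \<xi> by (simp add: f_def)
    show "f 0 \<xi> \<noteq> 0" if "cmod \<xi> \<le> 1" for \<xi> by (rule f_nz[OF that])
  qed
  then obtain L where L: "\<And>n \<xi>. cmod \<xi> \<le> 1/2 \<Longrightarrow> norm (curve_deriv (f n) \<xi>) \<le> L * norm (f n \<xi>)"
    by blast
  define K where "K = exp (\<bar>L\<bar> / 2)"
  have K: "0 < K" by (simp add: K_def)
  have compare: "norm (f n x) \<le> K * norm (f n y)"
    if "x = 0 \<or> y = 0" "cmod x \<le> 1/2" "cmod y \<le> 1/2" for n x y
  proof -
    have "norm (curve_deriv (f n) \<zeta>) \<le> \<bar>L\<bar> * norm (f n \<zeta>)" if "\<zeta> \<in> closed_segment y x" for \<zeta>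
    proof -
      have "\<zeta> \<in> cball 0 (1/2)"
        using that closed_segment_subset[of y "cball 0 (1/2)" x] \<open>cmod x \<le> 1/2\<close> \<open>cmod y \<le> 1/2\<close> by auto
      then have "norm (curve_deriv (f n) \<zeta>) \<le> L * norm (f n \<zeta>)" using L by simp
      also have "\<dots> \<le> \<bar>L\<bar> * norm (f n \<zeta>)" by (intro mult_right_mono) auto
      finally show ?thesis .
    qed
    then have "norm (f n x) \<le> exp (\<bar>L\<bar> * cmod (x - y)) * norm (f n y)"
      by (rule curve_norm_growth[OF f_curve])
    also have "\<dots> \<le> K * norm (f n y)"
    proof (rule mult_right_mono)
      have "cmod (x - y) \<le> 1/2" using that by auto
      from mult_left_mono[OF this, of "\<bar>L\<bar>"]
      show "exp (\<bar>L\<bar> * cmod (x - y)) \<le> K" by (simp add: K_def)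
    qed simp
    finally show ?thesis .
  qed
  define h where "h n \<xi> = (snd (f n \<xi>) - t * fst (f n \<xi>)) / norm (f n 0)" for n \<xi>
  have h_hol: "h n holomorphic_on S" for n S
  proof -
    have "h n holomorphic_on UNIV"
      using f_curve[of n] f_nz[of 0 n] unfolding h_def holomorphic_curve_def
      by (auto intro!: holomorphic_intros)
    then show ?thesis by (rule holomorphic_on_subset) simp
  qed
  have h_bound: "cmod (h n \<xi>) \<le> (1 + cmod t) * K" if "cmod \<xi> \<le> 1/2" for n \<xi>
  proof -
    have pos: "0 < norm (f n 0)" using f_nz[of 0 n] by simp
    have "cmod (snd (f n \<xi>) - t * fst (f n \<xi>)) \<le> (1 + cmod t) * norm (f n \<xi>)"
      by (rule norm_linear_form)
    also have "\<dots> \<le> (1 + cmod t) * (K * norm (f n 0))"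
      by (intro mult_left_mono compare) (use that in auto)
    finally show ?thesis using pos by (simp add: h_def norm_divide divide_le_eq mult.assoc)
  qed
  have h_defect: "h n \<xi> = tangency_defect t (f n \<xi>) * complex_of_real (norm (f n \<xi>) / norm (f n 0))"
    if "cmod \<xi> \<le> 1" for n \<xi>
    using f_nz[OF that, of n] by (simp add: h_def tangency_defect_def)
  have ratio: "norm (f n \<xi>) / norm (f n 0) \<le> K" "norm (f n 0) / norm (f n \<xi>) \<le> K"
    if "cmod \<xi> \<le> 1/2" for n \<xi>
    using compare[of 0 \<xi> n] compare[of \<xi> 0 n] that f_nz[of 0 n] f_nz[of \<xi> n]
    by (auto simp: divide_le_eq)
  have "open (\<phi> -` V)"
    by (rule open_vimage[OF V(1) holomorphic_curve_continuous[OF \<phi>(1)]])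
  moreover have "0 \<in> \<phi> -` V" using V(2) by simp
  ultimately obtain \<eta> where \<eta>: "0 < \<eta>" "ball 0 \<eta> \<subseteq> \<phi> -` V"
    by (meson open_contains_ball_eq)
  define \<eta>' where "\<eta>' = min \<eta> (1/2)"
  have \<eta>': "0 < \<eta>'" "\<eta>' \<le> \<eta>" "\<eta>' \<le> 1/2" using \<eta>(1) by (auto simp: \<eta>'_def)
  have near: "(\<lambda>n. h n \<xi>) \<longlonglongrightarrow> 0" if \<xi>: "\<xi> \<in> ball 0 \<eta>'" for \<xi>
  proof -
    have "\<xi> \<in> ball 0 \<eta>" using \<xi> \<eta>'(2) by simp
    then have "\<phi> \<xi> \<in> V" using \<eta>(2) by blast
    from LIMSEQ_ignore_initial_segment[OF V(3)[OF this], of n0]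
    have "(\<lambda>n. tangency_defect t (f n \<xi>)) \<longlonglongrightarrow> 0" by (simp add: f_def)
    then have lim: "(\<lambda>n. cmod (tangency_defect t (f n \<xi>)) * K) \<longlonglongrightarrow> 0"
      by (intro tendsto_mult_left_zero tendsto_norm_zero)
    show ?thesis
    proof (rule Lim_null_comparison[OF _ lim])
      have "norm (h n \<xi>) \<le> cmod (tangency_defect t (f n \<xi>)) * K" for n
      proof -
        have \<xi>': "cmod \<xi> \<le> 1/2" using \<xi> \<eta>'(3) by simp
        then have "h n \<xi> = tangency_defect t (f n \<xi>) * complex_of_real (norm (f n \<xi>) / norm (f n 0))"
          by (intro h_defect) simp
        then have "norm (h n \<xi>) = cmod (tangency_defect t (f n \<xi>)) * (norm (f n \<xi>) / norm (f n 0))"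
          by (simp only: norm_mult norm_of_real abs_divide abs_norm_cancel)
        also have "\<dots> \<le> cmod (tangency_defect t (f n \<xi>)) * K"
          by (rule mult_left_mono[OF ratio(1)[OF \<xi>'] norm_ge_zero])
        finally show ?thesis .
      qed
      then show "\<forall>\<^sub>F n in sequentially. norm (h n \<xi>) \<le> cmod (tangency_defect t (f n \<xi>)) * K" by simp
    qed
  qed
  have h_lim: "(\<lambda>n. h n (1/4)) \<longlonglongrightarrow> 0"
  proof (rule ccontr)
    assume "\<not> ?thesis"
    from subseq_of_not_tendsto_0[OF this]
    obtain e s where e: "0 < e" and s: "strict_mono (s :: nat \<Rightarrow> nat)" and e_le: "\<And>n. e \<le> cmod (h (s n) (1/4))"
      by blast
    obtain g r where g: "g holomorphic_on ball 0 (1/2)" and r: "strict_mono (r :: nat \<Rightarrow> nat)"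
      and lim: "\<And>x. x \<in> ball 0 (1/2) \<Longrightarrow> (\<lambda>n. h (s (r n)) x) \<longlonglongrightarrow> g x"
    proof (rule Montel[of "ball 0 (1/2)" "range (\<lambda>n. h (s n))" "\<lambda>n. h (s n)"])
      show "\<And>h'. h' \<in> range (\<lambda>n. h (s n)) \<Longrightarrow> h' holomorphic_on ball 0 (1/2)"
        using h_hol by blast
      show "\<exists>B. \<forall>h\<in>range (\<lambda>n. h (s n)). \<forall>z\<in>K. norm (h z) \<le> B" if "K \<subseteq> ball 0 (1/2)" for K
        using h_bound that by (intro exI[of _ "(1 + cmod t) * exp (\<bar>L\<bar> / 2)"]) (auto simp: K_def)
    qed auto
    have sr: "strict_mono (\<lambda>n. s (r n))" using s r by (simp add: strict_mono_def)
    have g0: "g \<xi> = 0" if "\<xi> \<in> ball 0 \<eta>'" for \<xi>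
    proof (rule LIMSEQ_unique)
      show "(\<lambda>n. h (s (r n)) \<xi>) \<longlonglongrightarrow> g \<xi>" using that \<eta>' by (intro lim) auto
      show "(\<lambda>n. h (s (r n)) \<xi>) \<longlonglongrightarrow> 0"
        using LIMSEQ_subseq_LIMSEQ[OF near[OF that] sr] by (simp add: o_def)
    qed
    have "g (1/4) = 0"
    proof (rule analytic_continuation_open[of "ball 0 \<eta>'" "ball 0 (1/2)" g "\<lambda>_. 0"])
      show "ball (0::complex) \<eta>' \<noteq> {}" using \<eta>' by simp
      show "ball (0::complex) \<eta>' \<subseteq> ball 0 (1/2)" using \<eta>' by (intro subset_ball) simp
    qed (use g g0 in auto)
    moreover have "(\<lambda>n. h (s (r n)) (1/4)) \<longlonglongrightarrow> g (1/4)" by (rule lim) simp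
    ultimately have "(\<lambda>n. cmod (h (s (r n)) (1/4))) \<longlonglongrightarrow> 0"
      by (simp add: tendsto_norm_zero)
    then have "e \<le> 0" by (rule LIMSEQ_le_const) (use e_le in auto)
    then show False using e by simp
  qed
  have "(\<lambda>n. tangency_defect t (f n (1/4))) \<longlonglongrightarrow> 0"
  proof (rule Lim_null_comparison)
    show "(\<lambda>n. cmod (h n (1/4)) * K) \<longlonglongrightarrow> 0"
      by (intro tendsto_mult_left_zero tendsto_norm_zero h_lim)
    have "norm (tangency_defect t (f n (1/4))) \<le> cmod (h n (1/4)) * K" for n
    proof -
      have "tangency_defect t (f n (1/4)) = h n (1/4) * complex_of_real (norm (f n 0) / norm (f n (1/4)))"
        using f_nz[of "1/4" n] f_nz[of 0 n] by (simp add: h_defect)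
      then have "norm (tangency_defect t (f n (1/4))) = cmod (h n (1/4)) * (norm (f n 0) / norm (f n (1/4)))"
        by (simp only: norm_mult norm_of_real abs_divide abs_norm_cancel)
      also have "\<dots> \<le> cmod (h n (1/4)) * K"
        by (rule mult_left_mono[OF ratio(2) norm_ge_zero]) simp
      finally show ?thesis .
    qed
    then show "\<forall>\<^sub>F n in sequentially. norm (tangency_defect t (f n (1/4))) \<le> cmod (h n (1/4)) * K" by simp
  qed
  then show ?thesis unfolding f_def by (rule LIMSEQ_offset)
qed

text \<open>The interior of the set of tangent points is closed in \<open>\<Omega>\<close>: near a limit point, every point lies
  on an affine complex disc centred in this interior, on which the preceding lemma applies.\<close>

theorem tangency_propagates:
  assumes \<Omega>: "invariant_attracted_domain P \<Omega>"
    and \<Omega>0: "open \<Omega>0" "\<Omega>0 \<noteq> {}" "\<Omega>0 \<subseteq> \<Omega>"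
    and tangent: "\<And>x. x \<in> \<Omega>0 \<Longrightarrow> (\<lambda>n. tangency_defect t ((P ^^ n) x)) \<longlonglongrightarrow> 0"
    and x: "x \<in> \<Omega>"
  shows "(\<lambda>n. tangency_defect t ((P ^^ n) x)) \<longlonglongrightarrow> 0"
proof -
  define spreads where "spreads x \<longleftrightarrow> (\<lambda>n. tangency_defect t ((P ^^ n) x)) \<longlonglongrightarrow> 0" for x
  define A where "A = \<Union>{V. open V \<and> V \<subseteq> \<Omega> \<and> (\<forall>y\<in>V. spreads y)}"
  have A: "open A" "A \<subseteq> \<Omega>" "\<And>y. y \<in> A \<Longrightarrow> spreads y" by (auto simp: A_def)
  have "\<Omega>0 \<subseteq> A" using \<Omega>0 tangent by (auto simp: A_def spreads_def)
  have closed: "x \<in> A" if x: "x \<in> \<Omega>" "x \<in> closure A" for x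
  proof -
    obtain U where U: "open U" "x \<in> U" "U \<subseteq> \<Omega>" "uniform_limit U (\<lambda>n. P ^^ n) (\<lambda>_. 0) sequentially"
      using \<Omega> x(1) unfolding invariant_attracted_domain_def by blast
    obtain \<rho> where \<rho>: "0 < \<rho>" "ball x \<rho> \<subseteq> U" using U(1,2) open_contains_ball by blast
    obtain a where a: "a \<in> A" "dist a x < \<rho> / 16"
      using x(2) \<rho>(1) unfolding closure_approachable by (meson divide_pos_pos zero_less_numeral)
    have "spreads y" if y: "y \<in> ball x (\<rho> / 16)" for y
    proof -
      define \<phi> where "\<phi> \<xi> = a + cscale (4 * \<xi>) (y - a)" for \<xi>
      have "(\<lambda>n. tangency_defect t ((P ^^ n) (\<phi> (1/4)))) \<longlonglongrightarrow> 0"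
      proof (rule tangency_along_disc[OF \<Omega> U(4)])
        show "holomorphic_curve \<phi>"
          unfolding \<phi>_def holomorphic_curve_def cscale_def by (auto intro!: holomorphic_intros)
        show "\<phi> \<xi> \<in> U \<inter> \<Omega>" if "cmod \<xi> \<le> 1" for \<xi>
        proof -
          have "dist a y \<le> dist a x + dist x y" by (rule dist_triangle)
          then have ya: "norm (y - a) \<le> \<rho> / 8"
            using a(2) y by (simp add: dist_norm norm_minus_commute)
          have "norm (cscale (4 * \<xi>) (y - a)) = 4 * cmod \<xi> * norm (y - a)"
            by (simp add: norm_cscale norm_mult)
          also have "\<dots> \<le> 4 * 1 * (\<rho> / 8)" using that ya \<rho> by (intro mult_mono) auto
          finally have "dist a (\<phi> \<xi>) \<le> \<rho> / 2" by (simp add: \<phi>_def dist_norm)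
          then have "dist x (\<phi> \<xi>) < \<rho>"
            using dist_triangle[of x "\<phi> \<xi>" a] a(2) \<rho>(1) by (simp add: dist_commute)
          then have "\<phi> \<xi> \<in> U" using \<rho>(2) by auto
          then show ?thesis using U(3) by auto
        qed
        show "\<phi> 0 \<in> A" using a by (simp add: \<phi>_def cscale_def zero_prod_def[symmetric])
        show "(\<lambda>n. tangency_defect t ((P ^^ n) y)) \<longlonglongrightarrow> 0" if "y \<in> A" for y
          using A(3)[OF that] by (simp add: spreads_def)
      qed (fact A(1))
      moreover have "\<phi> (1/4) = y" by (simp add: \<phi>_def cscale_def prod_eq_iff)
      ultimately show ?thesis by (simp add: spreads_def)
    qed
    moreover have "ball x (\<rho> / 16) \<subseteq> \<Omega>"
      using \<rho> U(3) subset_ball[of "\<rho> / 16" \<rho> x] by auto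
    ultimately have "ball x (\<rho> / 16) \<subseteq> A" by (auto simp: A_def)
    then show ?thesis using \<rho>(1) by auto
  qed
  have "connected \<Omega>" using \<Omega> by (simp add: invariant_attracted_domain_def)
  then have "\<Omega> \<subseteq> A"
    using connectedD[of \<Omega> A "- closure A"] A(1,2) closed \<Omega>0(2,3) \<open>\<Omega>0 \<subseteq> A\<close> closure_subset[of A]
    by blast
  then have "spreads x" using A(3) x by blast
  then show ?thesis by (simp add: spreads_def)
qed

end

section \<open>Maximal domains and the projective line\<close>

lemma invariant_attracted_domain_nonempty:
  "invariant_attracted_domain P \<Omega> \<Longrightarrow> \<Omega> \<noteq> {}"
  by (auto simp: invariant_attracted_domain_def)

lemma invariant_attracted_domain_Union:
  assumes \<C>: "\<C> \<noteq> {}" "\<And>\<Omega>. \<Omega> \<in> \<C> \<Longrightarrow> invariant_attracted_domain P \<Omega> \<and> \<Omega>0 \<subseteq> \<Omega>" and \<Omega>0: "\<Omega>0 \<noteq> {}"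
  shows "invariant_attracted_domain P (\<Union>\<C>)"
proof -
  have dom: "open \<Omega>" "connected \<Omega>" "P ` \<Omega> \<subseteq> \<Omega>" "0 \<in> closure \<Omega>" "0 \<notin> \<Omega>"
    "\<forall>x\<in>\<Omega>. \<exists>U. open U \<and> x \<in> U \<and> U \<subseteq> \<Omega> \<and> uniform_limit U (\<lambda>n. P ^^ n) (\<lambda>_. 0) sequentially"
    if "\<Omega> \<in> \<C>" for \<Omega>
    using \<C>(2)[OF that] zero_notin_attracted_domain[of P \<Omega>]
    unfolding invariant_attracted_domain_def frontier_def by blast+
  show ?thesis
    unfolding invariant_attracted_domain_def
  proof (intro conjI ballI)
    show op: "open (\<Union>\<C>)" using dom(1) by blast
    show "connected (\<Union>\<C>)"
    proof (rule connected_Union)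
      show "\<Inter>\<C> \<noteq> {}" using \<C>(2) \<Omega>0 by blast
    qed (rule dom(2))
    show "P ` \<Union>\<C> \<subseteq> \<Union>\<C>" using dom(3) by blast
    obtain \<Omega> where "\<Omega> \<in> \<C>" using \<C>(1) by blast
    then have "0 \<in> closure (\<Union>\<C>)" using dom(4)[of \<Omega>] closure_mono[of \<Omega> "\<Union>\<C>"] by blast
    moreover have "0 \<notin> \<Union>\<C>" using dom(5) by blast
    ultimately show "0 \<in> frontier (\<Union>\<C>)" by (simp add: frontier_def interior_open[OF op])
    fix x assume "x \<in> \<Union>\<C>"
    then obtain \<Omega> where \<Omega>: "\<Omega> \<in> \<C>" "x \<in> \<Omega>" by blast
    then obtain U where "open U \<and> x \<in> U \<and> U \<subseteq> \<Omega> \<and> uniform_limit U (\<lambda>n. P ^^ n) (\<lambda>_. 0) sequentially"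
      using dom(6) by blast
    then show "\<exists>U. open U \<and> x \<in> U \<and> U \<subseteq> \<Union>\<C> \<and> uniform_limit U (\<lambda>n. P ^^ n) (\<lambda>_. 0) sequentially"
      using \<Omega>(1) by blast
  qed
qed

text \<open>Zorn's lemma; the union of a chain omits the origin because each member does.\<close>

lemma exists_parabolic_domain_above:
  assumes \<Omega>0: "invariant_attracted_domain P \<Omega>0"
  shows "\<exists>\<Omega>. parabolic_domain P \<Omega> \<and> \<Omega>0 \<subseteq> \<Omega>"
proof -
  define \<A> where "\<A> = {\<Omega>. invariant_attracted_domain P \<Omega> \<and> \<Omega>0 \<subseteq> \<Omega>}"
  have "\<exists>M\<in>\<A>. \<forall>X\<in>\<A>. M \<subseteq> X \<longrightarrow> X = M"
  proof (rule subset_Zorn_nonempty)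
    show "\<A> \<noteq> {}" using \<Omega>0 by (auto simp: \<A>_def)
    fix \<C> assume \<C>: "\<C> \<noteq> {}" "subset.chain \<A> \<C>"
    then have sub: "\<C> \<subseteq> \<A>" by (simp add: subset.chain_def)
    have "invariant_attracted_domain P (\<Union>\<C>)"
      by (rule invariant_attracted_domain_Union[OF \<C>(1) _ invariant_attracted_domain_nonempty[OF \<Omega>0]])
        (use sub in \<open>auto simp: \<A>_def\<close>)
    moreover have "\<Omega>0 \<subseteq> \<Union>\<C>" using \<C>(1) sub by (auto simp: \<A>_def)
    ultimately show "\<Union>\<C> \<in> \<A>" by (simp add: \<A>_def)
  qed
  then obtain M where M: "M \<in> \<A>" "\<And>X. X \<in> \<A> \<Longrightarrow> M \<subseteq> X \<Longrightarrow> X = M" by blast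
  have "\<Omega>' = M" if "invariant_attracted_domain P \<Omega>'" "M \<subseteq> \<Omega>'" for \<Omega>'
  proof (rule M(2))
    show "\<Omega>' \<in> \<A>" using that M(1) by (auto simp: \<A>_def)
  qed (rule that(2))
  then have "parabolic_domain P M" using M(1) by (auto simp: parabolic_domain_def \<A>_def)
  then show ?thesis using M(1) by (auto simp: \<A>_def)
qed

lemma complex_line_cscale:
  assumes "c \<noteq> 0"
  shows "complex_line (cscale c v) = complex_line v"
proof -
  have 1: "cscale d (cscale c v) = cscale (d * c) v" for d by (simp add: cscale_def)
  have 2: "cscale d v = cscale (d / c) (cscale c v)" for d using assms by (simp add: cscale_def)
  show ?thesis unfolding complex_line_def
  proof (intro equalityI subsetI)
    fix x assume "x \<in> range (\<lambda>d. cscale d (cscale c v))"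
    then obtain d where "x = cscale d (cscale c v)" by (rule rangeE)
    then have "x = cscale (d * c) v" by (simp only: 1)
    then show "x \<in> range (\<lambda>d. cscale d v)" by (rule range_eqI)
  next
    fix x assume "x \<in> range (\<lambda>d. cscale d v)"
    then obtain d where "x = cscale d v" by (rule rangeE)
    then have "x = cscale (d / c) (cscale c v)" using 2[of d] by (rule trans)
    then show "x \<in> range (\<lambda>d. cscale d (cscale c v))" by (rule range_eqI)
  qed
qed

lemma limitin_of_tangency_defect:
  assumes nz: "\<And>n. x n \<noteq> 0" and lim: "(\<lambda>n. tangency_defect t (x n)) \<longlonglongrightarrow> 0"
  shows "limitin P1_topology (\<lambda>n. complex_line (x n)) (complex_line (1, t)) sequentially"
  unfolding limitin_def
proof (intro conjI allI impI)
  show "complex_line (1, t) \<in> topspace P1_topology"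
    by (auto simp: topspace_P1_topology zero_prod_def)
  fix U assume U: "openin P1_topology U \<and> complex_line (1, t) \<in> U"
  define V where "V = {v \<in> - {0}. complex_line v \<in> U}"
  have "openin (top_of_set (- {0})) V" using U by (simp add: openin_P1_topology V_def)
  then have V: "open V" by (rule openin_open_trans) (simp add: open_Compl)
  have tV: "(1, t) \<in> V" using U by (simp add: V_def zero_prod_def)
  define u where "u n = snd (x n) / fst (x n)" for n
  have ev: "\<forall>\<^sub>F n in sequentially. fst (x n) \<noteq> 0 \<and>
      cmod (u n - t) \<le> cmod (tangency_defect t (x n)) * (2 * (1 + cmod t))"
    using tendstoD[OF lim, of "1/2", simplified]
  proof eventually_elim
    case (elim n)
    define d z w where "d = cmod (tangency_defect t (x n))" "z = fst (x n)" "w = snd (x n)"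
    have xzw: "x n = (z, w)" by (simp add: d_z_w_def)
    have d: "0 \<le> d" "d \<le> 1/2" using elim by (simp_all add: d_z_w_def)
    have "cmod (w - t * z) = d * norm (x n)"
      using nz[of n] by (simp add: d_z_w_def tangency_defect_def norm_divide)
    also have "\<dots> \<le> d * ((1 + cmod t) * cmod z + cmod (w - t * z))"
    proof (rule mult_left_mono[OF _ d(1)])
      have "cmod w \<le> cmod (t * z) + cmod (w - t * z)" using norm_triangle_ineq[of "t * z" "w - t * z"] by simp
      then show "norm (x n) \<le> (1 + cmod t) * cmod z + cmod (w - t * z)"
        using norm_Pair_le[of z w] by (simp add: xzw norm_mult algebra_simps)
    qed
    also have "\<dots> \<le> d * ((1 + cmod t) * cmod z) + 1/2 * cmod (w - t * z)"
      using mult_right_mono[OF d(2), of "cmod (w - t * z)"] by (simp add: algebra_simps)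
    finally have le: "cmod (w - t * z) \<le> d * (2 * (1 + cmod t)) * cmod z" by (simp add: algebra_simps)
    have z: "z \<noteq> 0"
    proof
      assume "z = 0"
      then have "x n = 0" using le by (simp add: xzw zero_prod_def)
      then show False using nz by simp
    qed
    have "cmod (u n - t) = cmod (w - t * z) / cmod z"
    proof -
      have "u n - t = (w - t * z) / z" using z by (simp add: u_def d_z_w_def(2,3)[symmetric] field_simps)
      then show ?thesis by (simp add: norm_divide)
    qed
    also have "\<dots> \<le> d * (2 * (1 + cmod t))" using le z by (simp add: divide_le_eq)
    finally show ?case using z by (simp add: d_z_w_def)
  qed
  have "(\<lambda>n. u n - t) \<longlonglongrightarrow> 0"
  proof (rule Lim_null_comparison)
    show "\<forall>\<^sub>F n in sequentially. norm (u n - t) \<le> cmod (tangency_defect t (x n)) * (2 * (1 + cmod t))"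
      using ev by eventually_elim simp
    show "(\<lambda>n. cmod (tangency_defect t (x n)) * (2 * (1 + cmod t))) \<longlonglongrightarrow> 0"
      by (intro tendsto_mult_left_zero tendsto_norm_zero lim)
  qed
  then have "u \<longlonglongrightarrow> t" by (simp add: LIM_zero_iff)
  then have "(\<lambda>n. (1, u n)) \<longlonglongrightarrow> (1, t)" by (intro tendsto_intros)
  then have "\<forall>\<^sub>F n in sequentially. (1, u n) \<in> V" using V tV by (rule topological_tendstoD)
  then show "\<forall>\<^sub>F n in sequentially. complex_line (x n) \<in> U"
    using ev
  proof eventually_elim
    case (elim n)
    then have "x n = cscale (fst (x n)) (1, u n)" by (simp add: cscale_def u_def prod_eq_iff)
    then have "complex_line (x n) = complex_line (1, u n)"
      using complex_line_cscale[of "fst (x n)" "(1, u n)"] elim by simp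
    then show ?case using elim by (simp add: V_def)
  qed
qed

text \<open>The lines at a small angle to \<open>v\<close> form an open set of the projective line. Bounded slopes keep \<open>v\<close>
  from being the vertical direction.\<close>

lemma slope_converges_of_limitin:
  assumes x: "\<And>n. fst (x n) \<noteq> 0" "\<And>n. cmod (snd (x n) / fst (x n)) \<le> B"
    and v: "v \<noteq> 0"
    and lim: "limitin P1_topology (\<lambda>n. complex_line (x n)) (complex_line v) sequentially"
  shows "convergent (\<lambda>n. snd (x n) / fst (x n))"
proof -
  define cross where "cross y = fst y * snd v - snd y * fst v" for y :: C2
  have cross_cscale: "cross (cscale c y) = c * cross y" for c y
    by (simp add: cross_def cscale_def algebra_simps)
  define u where "u n = snd (x n) / fst (x n)" for n
  have "B \<ge> 0" using x(2)[of 0] norm_ge_zero order_trans by blast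
  have "(\<lambda>n. snd v - u n * fst v) \<longlonglongrightarrow> 0"
  proof (rule tendstoI)
    fix e :: real assume e: "0 < e"
    define \<epsilon> where "\<epsilon> = e / (1 + B)"
    have \<epsilon>: "0 < \<epsilon>" using e \<open>B \<ge> 0\<close> by (simp add: \<epsilon>_def)
    define W where "W = {y \<in> - {0}. cmod (cross y) < \<epsilon> * norm y}"
    have in_W: "y \<in> W" if y: "y \<in> - {0}" "complex_line y \<in> complex_line ` W" for y
    proof -
      obtain y' where y': "y' \<in> W" "complex_line y = complex_line y'" using y(2) by blast
      have "y' = cscale 1 y'" by (simp add: cscale_def)
      then have "y' \<in> complex_line y'" unfolding complex_line_def by (rule range_eqI)
      then have "y' \<in> complex_line y" unfolding y'(2) .
      then have "y' \<in> range (\<lambda>c. cscale c y)" unfolding complex_line_def .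
      then obtain c where c: "y' = cscale c y" by (rule rangeE)
      have "c \<noteq> 0" using y'(1) c by (auto simp: W_def cscale_def zero_prod_def)
      moreover have "cmod c * cmod (cross y) < cmod c * (\<epsilon> * norm y)"
        using y'(1) unfolding W_def c by (simp add: cross_cscale norm_cscale norm_mult mult_ac)
      ultimately have "cmod (cross y) < \<epsilon> * norm y" by simp
      then show ?thesis using y(1) by (simp add: W_def)
    qed
    have "openin P1_topology (complex_line ` W)"
      unfolding openin_P1_topology
    proof
      show "complex_line ` W \<subseteq> complex_line ` (- {0})" by (auto simp: W_def)
      have "{v \<in> - {0}. complex_line v \<in> complex_line ` W} = W"
        using in_W by (auto simp: W_def)
      moreover have "open W"
      proof -
        have "W = {y. cmod (cross y) < \<epsilon> * norm y}" by (auto simp: W_def)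
        also have "open \<dots>" unfolding cross_def by (intro open_Collect_less continuous_intros)
        finally show ?thesis .
      qed
      ultimately show "openin (top_of_set (- {0})) {v \<in> - {0}. complex_line v \<in> complex_line ` W}"
        by (auto intro!: open_subset simp: W_def)
    qed
    moreover have "v \<in> W" using v \<epsilon> by (simp add: W_def cross_def)
    ultimately have "\<forall>\<^sub>F n in sequentially. complex_line (x n) \<in> complex_line ` W"
      using lim unfolding limitin_def by blast
    then show "\<forall>\<^sub>F n in sequentially. dist (snd v - u n * fst v) 0 < e"
    proof eventually_elim
      case (elim n)
      define z where "z = fst (x n)"
      have z: "z \<noteq> 0" using x(1) by (simp add: z_def)
      have xn: "x n = cscale z (1, u n)" using z by (simp add: cscale_def u_def z_def prod_eq_iff)
      have "x n \<noteq> 0" using z by (auto simp: z_def zero_prod_def)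
      then have "x n \<in> W" using in_W elim by simp
      have "cmod z * cmod (snd v - u n * fst v) < cmod z * (\<epsilon> * norm (1 :: complex, u n))"
      proof -
        have "cross (x n) = z * (snd v - u n * fst v)"
          unfolding xn cross_cscale by (simp add: cross_def)
        moreover have "norm (x n) = cmod z * norm (1 :: complex, u n)" unfolding xn norm_cscale ..
        ultimately show ?thesis using \<open>x n \<in> W\<close> by (simp add: W_def norm_mult mult_ac)
      qed
      then have "cmod (snd v - u n * fst v) < \<epsilon> * norm (1 :: complex, u n)" using z by simp
      also have "\<dots> \<le> \<epsilon> * (1 + B)"
        using norm_Pair_le[of "1 :: complex" "u n"] x(2)[of n] \<epsilon> by (intro mult_left_mono) (auto simp: u_def)
      also have "\<dots> = e" using \<open>B \<ge> 0\<close> by (simp add: \<epsilon>_def)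
      finally show ?case by simp
    qed
  qed
  note lim0 = this
  have v1: "fst v \<noteq> 0"
  proof
    assume "fst v = 0"
    then have "snd v = 0" using lim0 LIMSEQ_unique[OF tendsto_const, of "snd v" 0] by simp
    then show False using v \<open>fst v = 0\<close> by (simp add: prod_eq_iff)
  qed
  have "(\<lambda>n. (snd v - (snd v - u n * fst v)) / fst v) \<longlonglongrightarrow> (snd v - 0) / fst v"
    by (intro tendsto_intros lim0 v1)
  then show ?thesis using v1 by (auto simp: u_def convergent_def)
qed

section \<open>Coordinates near a non-degenerate characteristic direction\<close>

text \<open>Along orbits \<open>a \<mapsto> a + 1 + O(1/a)\<close> the imaginary part grows only logarithmically. The parabola
  leaves room for that and makes \<open>Im (1 / a)\<close> at most of order \<open>\<bar>a\<bar> powr (-3/2)\<close>, which is summable.\<close>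

definition sector :: "real \<Rightarrow> complex set" where
  "sector R = {a. R < Re a \<and> (Im a)\<^sup>2 < Re a}"

lemma open_sector: "open (sector R)"
  unfolding sector_def by (intro open_Collect_conj open_Collect_less continuous_intros)

lemma convex_combination_square_less:
  fixes x y s t :: real
  assumes "x\<^sup>2 < s" "y\<^sup>2 < t" "0 \<le> u" "0 \<le> v" "u + v = 1"
  shows "(u * x + v * y)\<^sup>2 < u * s + v * t"
proof -
  have "(u * x + v * y)\<^sup>2 = u * x\<^sup>2 + v * y\<^sup>2 - u * v * (x - y)\<^sup>2"
  proof -
    have v: "v = 1 - u" using assms by simp
    show ?thesis unfolding v by (simp add: power2_eq_square algebra_simps)
  qed
  also have "\<dots> \<le> u * x\<^sup>2 + v * y\<^sup>2" using assms by simp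
  also have "\<dots> < u * s + v * t"
  proof (cases "u = 0")
    case False
    then have "u * x\<^sup>2 < u * s" "v * y\<^sup>2 \<le> v * t" using assms by (auto intro: mult_left_mono)
    then show ?thesis by simp
  qed (use assms in auto)
  finally show ?thesis .
qed

lemma convex_sector: "convex (sector R)"
  unfolding convex_def
proof (intro ballI allI impI)
  fix x y :: complex and u v :: real
  assume h: "x \<in> sector R" "y \<in> sector R" "0 \<le> u" "0 \<le> v" "u + v = 1"
  have "u * R + v * R < u * Re x + v * Re y"
  proof (cases "u = 0")
    case False
    then have "u * R < u * Re x" "v * R \<le> v * Re y" using h
      by (auto simp: sector_def intro: mult_left_mono)
    then show ?thesis by simp
  qed (use h in \<open>auto simp: sector_def\<close>)
  moreover have "u * R + v * R = R" using h by (simp flip: distrib_right)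
  moreover have "(u * Im x + v * Im y)\<^sup>2 < u * Re x + v * Re y"
    by (rule convex_combination_square_less) (use h in \<open>auto simp: sector_def\<close>)
  ultimately show "u *\<^sub>R x + v *\<^sub>R y \<in> sector R" by (simp add: sector_def)
qed

lemma sector_bounds:
  assumes "a \<in> sector R" "0 \<le> R"
  shows "R < Re a" "(Im a)\<^sup>2 < Re a" "Re a \<le> cmod a" "0 < cmod a" "R < cmod a" "a \<noteq> 0" "0 < Re a"
  using assms complex_Re_le_cmod[of a] by (auto simp: sector_def)

lemma sector_step:
  assumes a: "a \<in> sector R" and K: "1 \<le> K" "64 * K\<^sup>2 \<le> R" and a1: "cmod (a1 - a - 1) \<le> K / cmod a"
  shows "a1 \<in> sector R" "Re a + 1/2 \<le> Re a1" "cmod a1 \<le> cmod a + 2"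
proof -
  have "64 \<le> 64 * K\<^sup>2" using K(1) by simp
  then have R: "0 \<le> R" "64 \<le> R" using K(2) by auto
  have KR: "64 * K \<le> R"
  proof -
    have "K \<le> K\<^sup>2" using K(1) by (simp add: power2_eq_square)
    then show ?thesis using K(2) by simp
  qed
  note s = sector_bounds[OF a R(1)]
  define \<kappa> where "\<kappa> = K / cmod a"
  have \<kappa>: "0 \<le> \<kappa>" "\<kappa> \<le> 1/64"
  proof -
    show "0 \<le> \<kappa>" using K s by (simp add: \<kappa>_def)
    have "64 * K \<le> cmod a" using KR s by simp
    then show "\<kappa> \<le> 1/64" using s by (simp add: \<kappa>_def divide_le_eq)
  qed
  have re: "\<bar>Re a1 - Re a - 1\<bar> \<le> \<kappa>" and im: "\<bar>Im a1 - Im a\<bar> \<le> \<kappa>"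
    using a1 abs_Re_le_cmod[of "a1 - a - 1"] abs_Im_le_cmod[of "a1 - a - 1"] by (auto simp: \<kappa>_def)
  show step: "Re a + 1/2 \<le> Re a1" using re \<kappa> by linarith
  have "cmod a1 \<le> cmod a + (1 + cmod (a1 - a - 1))"
    using norm_triangle_ineq[of a "1 + (a1 - a - 1)"] norm_triangle_ineq[of 1 "a1 - a - 1"] by simp
  then show "cmod a1 \<le> cmod a + 2" using a1[folded \<kappa>_def] \<kappa>(2) by linarith
  have "\<bar>Im a\<bar> * \<kappa> \<le> 1/8"
  proof (rule power2_le_imp_le)
    have "(\<bar>Im a\<bar> * \<kappa>)\<^sup>2 = (Im a)\<^sup>2 * K\<^sup>2 / (cmod a)\<^sup>2"
      by (simp add: \<kappa>_def power_mult_distrib power_divide)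
    also have "\<dots> \<le> cmod a * K\<^sup>2 / (cmod a)\<^sup>2"
      using s by (intro divide_right_mono mult_right_mono) auto
    also have "\<dots> = K\<^sup>2 / cmod a" using s by (simp add: power2_eq_square)
    also have "\<dots> \<le> K\<^sup>2 / (64 * K\<^sup>2)" using s K by (intro divide_left_mono) auto
    also have "\<dots> = (1/8)\<^sup>2" using K by (simp add: power2_eq_square)
    finally show "(\<bar>Im a\<bar> * \<kappa>)\<^sup>2 \<le> (1/8)\<^sup>2" .
  qed simp
  moreover have "\<bar>Im a1\<bar> \<le> \<bar>Im a\<bar> + \<kappa>" using im by linarith
  then have "(\<bar>Im a1\<bar>)\<^sup>2 \<le> (\<bar>Im a\<bar> + \<kappa>)\<^sup>2" by (rule power_mono) simp
  then have "(Im a1)\<^sup>2 \<le> (Im a)\<^sup>2 + 2 * (\<bar>Im a\<bar> * \<kappa>) + \<kappa>\<^sup>2" by (simp add: power2_sum)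
  moreover have "\<kappa>\<^sup>2 \<le> (1/64)\<^sup>2" by (rule power_mono[OF \<kappa>(2,1)])
  then have "\<kappa>\<^sup>2 \<le> 1/64" by (simp add: power2_eq_square)
  ultimately have "(Im a1)\<^sup>2 < Re a + 1/2" using s(2) by linarith
  then show "a1 \<in> sector R" using step s(1) by (auto simp: sector_def)
qed

context parabolic_germ
begin

text \<open>The map \<open>P\<close> in the coordinates \<open>a = 1 / z\<close>, \<open>u = w / z\<close>.\<close>

definition chart_next :: "complex \<times> complex \<Rightarrow> complex \<times> complex" where
  "chart_next = (\<lambda>(a, u). (1 / fst (P (1 / a, u / a)), snd (P (1 / a, u / a)) / fst (P (1 / a, u / a))))"

text \<open>In these coordinates \<open>u\<close> moves by \<open>1 / a\<close> times the vector field \<open>u\<^sup>2 + u + b\<close>, with summable error; its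
  zeros are the slopes of the characteristic directions. The factor \<open>1 - h\<close> in the proof is \<open>z\<^sub>1 / z\<close>.\<close>

lemma chart_step:
  assumes U: "0 \<le> U"
  shows "\<exists>K\<ge>1. \<forall>a u. K \<le> cmod a \<longrightarrow> cmod u \<le> U \<longrightarrow> fst (P (1 / a, u / a)) \<noteq> 0 \<and>
    cmod (fst (chart_next (a, u)) - a - 1) \<le> K / cmod a \<and>
    cmod (snd (chart_next (a, u)) - u - (u\<^sup>2 + u + b) / a) \<le> K / (cmod a)\<^sup>2"
proof -
  define M where "M = 1 + U"
  define E where "E = C * M ^ 3"
  define G where "G = U\<^sup>2 + U + cmod b"
  have pos: "1 \<le> M" "0 \<le> E" "0 \<le> G" using U C_nonneg by (auto simp: M_def E_def G_def)
  define K where "K = 1 + M / \<delta> + 2 * (1 + 2 * E) + 2 * (E + U * E + (1 + E) * G)"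
  have nn: "0 \<le> M / \<delta>" "0 \<le> U * E" "0 \<le> (1 + E) * G" using pos U \<delta>_pos by auto
  have K: "1 \<le> K" "M / \<delta> \<le> K" "2 * (1 + E) \<le> K" "2 * (1 + 2 * E) \<le> K" "2 * (E + U * E + (1 + E) * G) \<le> K"
    unfolding K_def using nn pos by argo+
  have "fst (P (1 / a, u / a)) \<noteq> 0 \<and>
    cmod (fst (chart_next (a, u)) - a - 1) \<le> K / cmod a \<and>
    cmod (snd (chart_next (a, u)) - u - (u\<^sup>2 + u + b) / a) \<le> K / (cmod a)\<^sup>2"
    if a: "K \<le> cmod a" and u: "cmod u \<le> U" for a u
  proof -
    define z where "z = 1 / a"
    define x where "x = (z, u * z)"
    have a0: "0 < cmod a" "a \<noteq> 0" using a K(1) by auto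
    have z0: "z \<noteq> 0" "0 < cmod z" using a0 by (auto simp: z_def)
    have az: "a = 1 / z" by (simp add: z_def)
    have Mz: "c * cmod z \<le> e" if "c / e \<le> K" "0 < e" for c e
    proof -
      have "c / e \<le> cmod a" using that(1) a by simp
      then show ?thesis using that(2) a0 by (simp add: z_def norm_divide field_simps)
    qed
    have "norm x \<le> cmod z + cmod (u * z)" unfolding x_def by (rule norm_Pair_le)
    also have "\<dots> \<le> cmod z + U * cmod z" using u by (simp add: norm_mult mult_right_mono)
    finally have nx: "norm x \<le> M * cmod z" by (simp add: M_def algebra_simps)
    then have x\<delta>: "norm x \<le> \<delta>" using Mz[OF K(2) \<delta>_pos] by simp
    have z1: "cmod z \<le> 1" using Mz[of 1 1] K by simp
    have Ez: "(1 + E) * cmod z \<le> 1/2" using Mz[of "1 + E" "1/2"] K by simp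
    have cube: "C * norm x ^ 3 \<le> E * cmod z ^ 3"
    proof -
      have "norm x ^ 3 \<le> (M * cmod z) ^ 3" by (rule power_mono[OF nx]) simp
      from mult_left_mono[OF this C_nonneg] show ?thesis by (simp add: E_def power_mult_distrib)
    qed
    define y where "y = P x"
    have y: "P (1 / a, u / a) = y" by (simp add: y_def x_def z_def)
    define e1 where "e1 = fst y - (z - z\<^sup>2)"
    define e2 where "e2 = snd y - (u * z + (u * z)\<^sup>2 + b * z\<^sup>2)"
    have e1: "cmod (e1 / z) \<le> E * (cmod z)\<^sup>2" and e2: "cmod (e2 / z) \<le> E * (cmod z)\<^sup>2"
    proof -
      have "cmod e1 \<le> E * cmod z ^ 3" "cmod e2 \<le> E * cmod z ^ 3"
        using fst_step[OF x\<delta>] snd_step[OF x\<delta>] cube by (simp_all add: e1_def e2_def y_def x_def)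
      then show "cmod (e1 / z) \<le> E * (cmod z)\<^sup>2" "cmod (e2 / z) \<le> E * (cmod z)\<^sup>2"
        using z0 by (simp_all add: norm_divide divide_le_eq power3_eq_cube power2_eq_square mult_ac)
    qed
    define h where "h = z - e1 / z"
    have h: "cmod h \<le> (1 + E) * cmod z"
    proof -
      have "cmod h \<le> cmod z + E * (cmod z)\<^sup>2"
        unfolding h_def by (rule order_trans[OF norm_triangle_ineq4]) (use e1 in simp)
      also have "(cmod z)\<^sup>2 \<le> cmod z" using z1 by (simp add: power2_eq_square mult_left_le_one_le)
      then have "cmod z + E * (cmod z)\<^sup>2 \<le> cmod z + E * cmod z" using pos by (intro add_left_mono mult_left_mono)
      finally show ?thesis by (simp add: algebra_simps)
    qed
    then have h1: "1/2 \<le> cmod (1 - h)" using Ez norm_triangle_ineq2[of 1 h] by simp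
    then have h1': "1 - h \<noteq> 0" by auto
    have fy: "fst y = z * (1 - h)"
      using z0 by (simp add: h_def e1_def power2_eq_square field_simps)
    have sy: "snd y = u * z + (u * z)\<^sup>2 + b * z\<^sup>2 + e2" by (simp add: e2_def)
    have inv: "cmod (X / (1 - h)) \<le> 2 * cmod X" for X
    proof -
      have "cmod (X / (1 - h)) \<le> cmod X / (1/2)"
        unfolding norm_divide by (rule divide_left_mono[OF h1]) (use h1 in auto)
      then show ?thesis by simp
    qed
    have e1z: "e1 / z = z - h" by (simp add: h_def)
    have hz: "cmod (h * z) \<le> (1 + E) * (cmod z)\<^sup>2"
      using mult_right_mono[OF h, of "cmod z"] by (simp add: norm_mult power2_eq_square mult.assoc)
    have "1 / fst y - a - 1 = ((h * z - e1 / z) / (1 - h)) / z"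
      unfolding e1z fy az using z0 h1' by (simp add: field_simps)
    also have "cmod \<dots> \<le> 2 * cmod (h * z - e1 / z) / cmod z"
      unfolding norm_divide[of _ z] by (rule divide_right_mono[OF inv]) simp
    also have "\<dots> \<le> 2 * ((1 + 2 * E) * (cmod z)\<^sup>2) / cmod z"
    proof (intro divide_right_mono mult_left_mono)
      show "cmod (h * z - e1 / z) \<le> (1 + 2 * E) * (cmod z)\<^sup>2"
        by (rule order_trans[OF norm_triangle_ineq4]) (use hz e1 in \<open>simp add: algebra_simps\<close>)
    qed auto
    also have "\<dots> = 2 * (1 + 2 * E) * cmod z" using z0 by (simp add: power2_eq_square)
    also have "\<dots> \<le> K * cmod z" using K(4) by (rule mult_right_mono) simp
    finally have 1: "cmod (1 / fst y - a - 1) \<le> K / cmod a" by (simp add: z_def norm_divide)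
    define g where "g = u\<^sup>2 + u + b"
    have g: "cmod g \<le> G"
    proof -
      have "cmod g \<le> cmod (u\<^sup>2) + cmod u + cmod b"
        unfolding g_def by (intro order_trans[OF norm_triangle_ineq] add_mono norm_triangle_ineq) auto
      also have "cmod (u\<^sup>2) \<le> U\<^sup>2" unfolding norm_power by (rule power_mono[OF u]) simp
      finally show ?thesis using u by (simp add: G_def)
    qed
    have "snd y / fst y - u - g / a = (e2 / z - u * (e1 / z) + h * z * g) / (1 - h)"
    proof -
      have "snd y / fst y = (snd y / z) / (1 - h)" using z0 h1' by (simp add: fy)
      also have "snd y / z = u + (u\<^sup>2 + b) * z + e2 / z"
        unfolding sy using z0 by (simp add: field_simps power2_eq_square)
      finally have "snd y / fst y - u - g / a = (u + (u\<^sup>2 + b) * z + e2 / z - (u + g * z) * (1 - h)) / (1 - h)"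
        unfolding az using h1' by (simp add: field_simps)
      also have "u + (u\<^sup>2 + b) * z + e2 / z - (u + g * z) * (1 - h) = e2 / z - u * (e1 / z) + h * z * g"
        unfolding e1z g_def by (simp add: algebra_simps)
      finally show ?thesis .
    qed
    then have "cmod (snd y / fst y - u - g / a) \<le> 2 * cmod (e2 / z - u * (e1 / z) + h * z * g)"
      using inv by simp
    also have "\<dots> \<le> 2 * ((E + U * E + (1 + E) * G) * (cmod z)\<^sup>2)"
    proof (rule mult_left_mono)
      have "cmod (u * (e1 / z)) \<le> U * (E * (cmod z)\<^sup>2)"
        unfolding norm_mult by (intro mult_mono u e1) (use U in auto)
      moreover have "cmod (h * z * g) \<le> ((1 + E) * (cmod z)\<^sup>2) * G"
        unfolding norm_mult[of _ g] by (intro mult_mono hz g) (use pos in auto)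
      ultimately have "cmod (e2 / z) + cmod (u * (e1 / z)) + cmod (h * z * g)
        \<le> (E + U * E + (1 + E) * G) * (cmod z)\<^sup>2" using e2 by (simp add: algebra_simps)
      then show "cmod (e2 / z - u * (e1 / z) + h * z * g) \<le> (E + U * E + (1 + E) * G) * (cmod z)\<^sup>2"
        using norm_triangle_ineq[of "e2 / z - u * (e1 / z)" "h * z * g"] norm_triangle_ineq4[of "e2 / z" "u * (e1 / z)"]
        by linarith
    qed simp
    also have "\<dots> = 2 * (E + U * E + (1 + E) * G) * (cmod z)\<^sup>2" by simp
    also have "\<dots> \<le> K * (cmod z)\<^sup>2" using K(5) by (rule mult_right_mono) simp
    finally have 2: "cmod (snd y / fst y - u - g / a) \<le> K / (cmod a)\<^sup>2"
      by (simp add: z_def norm_divide power_divide)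
    show ?thesis using 1 2 z0 h1' by (simp add: chart_next_def y fy g_def)
  qed
  then show ?thesis using K(1) by blast
qed

end

section \<open>Invariant regions in the chart\<close>

text \<open>Comparison with the logarithm.\<close>

lemma diverges_of_harmonic_increments:
  fixes y :: "nat \<Rightarrow> real"
  assumes step: "\<And>n. y n + c / (A + 2 * real n) \<le> y (Suc n)" and pos: "0 < c" "0 < A"
  shows "filterlim y at_top sequentially"
proof -
  have "y 0 + c / 2 * (ln (A + 2 * real n) - ln A) \<le> y n" for n
  proof (induction n)
    case (Suc n)
    define s where "s = A + 2 * real n"
    have s: "0 < s" using pos by (simp add: s_def add_pos_nonneg)
    have "1 + 2 / s = (s + 2) / s" using s by (simp add: field_simps)
    then have "ln (s + 2) - ln s = ln (1 + 2 / s)" using s by (simp add: ln_div)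
    also have "\<dots> \<le> 2 / s" using s by (intro ln_add_one_self_le_self) simp
    finally have "c / 2 * (ln (s + 2) - ln s) \<le> c / 2 * (2 / s)"
      using pos by (intro mult_left_mono) auto
    then have "c / 2 * (ln (s + 2) - ln s) \<le> c / s" by simp
    moreover have "A + 2 * real (Suc n) = s + 2" by (simp add: s_def)
    moreover have "y 0 + c / 2 * (ln s - ln A) \<le> y n" "y n + c / s \<le> y (Suc n)"
      using Suc step[of n] unfolding s_def by blast+
    ultimately have "y 0 + c / 2 * (ln (s + 2) - ln A) \<le> y (Suc n)"
      by (simp add: right_diff_distrib)
    then show ?case by (simp only: \<open>A + 2 * real (Suc n) = s + 2\<close>)
  qed simp
  moreover have "filterlim (\<lambda>n. y 0 + c / 2 * (ln (A + 2 * real n) - ln A)) at_top sequentially"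
  proof -
    have lin: "filterlim (\<lambda>n. A + 2 * real n) at_top sequentially"
      by (intro filterlim_tendsto_add_at_top[OF tendsto_const]
          filterlim_tendsto_pos_mult_at_top[OF tendsto_const _ filterlim_real_sequentially]) simp
    have "filterlim (\<lambda>n. ln (A + 2 * real n)) at_top sequentially"
      by (rule filterlim_compose[OF ln_at_top lin])
    then have "filterlim (\<lambda>n. - ln A + ln (A + 2 * real n)) at_top sequentially"
      by (intro filterlim_tendsto_add_at_top[OF tendsto_const])
    then have "filterlim (\<lambda>n. c / 2 * (- ln A + ln (A + 2 * real n))) at_top sequentially"
      using pos by (intro filterlim_tendsto_pos_mult_at_top[OF tendsto_const]) auto
    then have "filterlim (\<lambda>n. y 0 + c / 2 * (- ln A + ln (A + 2 * real n))) at_top sequentially"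
      by (intro filterlim_tendsto_add_at_top[OF tendsto_const])
    then show ?thesis by (simp add: algebra_simps)
  qed
  ultimately show ?thesis by (rule filterlim_at_top_mono[rotated, OF always_eventually, rule_format])
qed

text \<open>The excess of \<open>x\<close> over a small \<open>\<epsilon>\<close> decreases by the factor \<open>1 - \<gamma> \<alpha>\<close> once \<open>K \<alpha> \<le> \<gamma> \<epsilon>\<close>; it cannot stay
  above \<open>\<epsilon>\<close> because the sum of the \<open>\<alpha> n\<close> diverges.\<close>

lemma contraction_tendsto_0:
  fixes x \<alpha> :: "nat \<Rightarrow> real"
  assumes x: "\<And>n. 0 \<le> x n" and \<gamma>: "0 < \<gamma>" and A: "0 < A"
    and step: "\<forall>\<^sub>F n in sequentially. x (Suc n) \<le> (1 - \<gamma> * \<alpha> n) * x n + K * (\<alpha> n)\<^sup>2"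
    and \<alpha>: "\<alpha> \<longlonglongrightarrow> 0" "\<And>n. 1 / (A + 2 * real n) \<le> \<alpha> n"
  shows "x \<longlonglongrightarrow> 0"
proof (rule tendstoI)
  fix e :: real assume "0 < e"
  define \<epsilon> where "\<epsilon> = e / 3"
  have \<epsilon>: "0 < \<epsilon>" using \<open>0 < e\<close> by (simp add: \<epsilon>_def)
  have \<alpha>_pos: "0 < \<alpha> n" for n
  proof -
    have "0 < 1 / (A + 2 * real n)" using A by (simp add: add_pos_nonneg)
    then show ?thesis using \<alpha>(2)[of n] by linarith
  qed
  have lim: "(\<lambda>n. K * \<alpha> n) \<longlonglongrightarrow> K * 0" "(\<lambda>n. \<gamma> * \<alpha> n) \<longlonglongrightarrow> \<gamma> * 0"
    by (intro tendsto_intros \<alpha>)+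
  have "\<forall>\<^sub>F n in sequentially. K * \<alpha> n < \<gamma> * \<epsilon>"
    by (rule order_tendstoD(2)[OF lim(1)]) (use \<gamma> \<epsilon> in simp)
  moreover have "\<forall>\<^sub>F n in sequentially. \<gamma> * \<alpha> n < 1"
    by (rule order_tendstoD(2)[OF lim(2)]) simp
  ultimately have "\<forall>\<^sub>F n in sequentially. x (Suc n) \<le> (1 - \<gamma> * \<alpha> n) * x n + K * (\<alpha> n)\<^sup>2 \<and>
      K * \<alpha> n \<le> \<gamma> * \<epsilon> \<and> \<gamma> * \<alpha> n \<le> 1"
    using step by eventually_elim simp
  then obtain N where N: "\<forall>n\<ge>N. x (Suc n) \<le> (1 - \<gamma> * \<alpha> n) * x n + K * (\<alpha> n)\<^sup>2 \<and>
      K * \<alpha> n \<le> \<gamma> * \<epsilon> \<and> \<gamma> * \<alpha> n \<le> 1"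
    unfolding eventually_sequentially by blast
  define d where "d n = max 0 (x n - \<epsilon>)" for n
  have d_step: "d (Suc n) \<le> d n - \<gamma> * \<alpha> n * d n" if "N \<le> n" for n
  proof -
    have h: "x (Suc n) \<le> (1 - \<gamma> * \<alpha> n) * x n + K * (\<alpha> n)\<^sup>2" "K * \<alpha> n \<le> \<gamma> * \<epsilon>" "\<gamma> * \<alpha> n \<le> 1"
      using N that by blast+
    have "K * (\<alpha> n)\<^sup>2 = K * \<alpha> n * \<alpha> n" by (simp add: power2_eq_square)
    also have "\<dots> \<le> \<gamma> * \<epsilon> * \<alpha> n" using h(2) \<alpha>_pos[of n] by (intro mult_right_mono) auto
    finally have "x (Suc n) - \<epsilon> \<le> (1 - \<gamma> * \<alpha> n) * (x n - \<epsilon>)" using h(1) by (simp add: algebra_simps)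
    also have "\<dots> \<le> (1 - \<gamma> * \<alpha> n) * d n" using h(3) by (intro mult_left_mono) (auto simp: d_def)
    finally have "x (Suc n) - \<epsilon> \<le> (1 - \<gamma> * \<alpha> n) * d n" .
    moreover have "0 \<le> (1 - \<gamma> * \<alpha> n) * d n" using h(3) by (simp add: d_def)
    ultimately show ?thesis by (simp add: d_def algebra_simps)
  qed
  have mono: "d (n + k) \<le> d n" if "N \<le> n" for n k
  proof (induction k)
    case (Suc k)
    have "0 \<le> \<gamma> * \<alpha> (n + k) * d (n + k)"
      using \<gamma> \<alpha>_pos[of "n + k"] by (intro mult_nonneg_nonneg) (auto simp: d_def)
    then show ?case using d_step[of "n + k"] that Suc by simp
  qed simp
  have "\<exists>n1\<ge>N. d n1 < \<epsilon>"
  proof (rule ccontr)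
    assume none: "\<not> (\<exists>n1\<ge>N. d n1 < \<epsilon>)"
    have ge: "\<epsilon> \<le> d n" if "N \<le> n" for n using none that by (meson not_le)
    have "filterlim (\<lambda>n. - d (n + N)) at_top sequentially"
    proof (rule diverges_of_harmonic_increments)
      fix n
      have "\<gamma> * \<epsilon> * (1 / ((A + 2 * real N) + 2 * real n)) \<le> \<gamma> * d (n + N) * \<alpha> (n + N)"
        using ge[of "n + N"] \<gamma> \<epsilon> \<alpha>(2)[of "n + N"] A
        by (intro mult_mono) (auto simp: algebra_simps)
      then show "- d (n + N) + \<gamma> * \<epsilon> / ((A + 2 * real N) + 2 * real n) \<le> - d (Suc n + N)"
        using d_step[of "n + N"] by (simp add: mult_ac)
    qed (use \<gamma> \<epsilon> A in auto)
    then have "\<forall>\<^sub>F n in sequentially. 1 \<le> - d (n + N)" unfolding filterlim_at_top by blast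
    then obtain n where "1 \<le> - d (n + N)" unfolding eventually_sequentially by blast
    then show False by (simp add: d_def)
  qed
  then obtain n1 where n1: "N \<le> n1" "d n1 < \<epsilon>" by blast
  have le: "x n \<le> 2 * \<epsilon>" if "n1 \<le> n" for n
  proof -
    have "d n \<le> d n1" using mono[OF n1(1), of "n - n1"] that by simp
    moreover have "x n - \<epsilon> \<le> d n" by (simp add: d_def)
    ultimately show ?thesis using n1(2) by linarith
  qed
  have "dist (x n) 0 < e" if "n1 \<le> n" for n
    using le[OF that] x[of n] \<epsilon> by (simp add: \<epsilon>_def)
  then show "\<forall>\<^sub>F n in sequentially. dist (x n) 0 < e"
    unfolding eventually_sequentially by blast
qed

context parabolic_germ
begin

definition chart_bound :: "real \<Rightarrow> real \<Rightarrow> bool" where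
  "chart_bound U K \<longleftrightarrow> 1 \<le> K \<and> (\<forall>a u. K \<le> cmod a \<longrightarrow> cmod u \<le> U \<longrightarrow> fst (P (1 / a, u / a)) \<noteq> 0 \<and>
    cmod (fst (chart_next (a, u)) - a - 1) \<le> K / cmod a \<and>
    cmod (snd (chart_next (a, u)) - u - (u\<^sup>2 + u + b) / a) \<le> K / (cmod a)\<^sup>2)"

definition chart_point :: "complex \<times> complex \<Rightarrow> C2" where
  "chart_point = (\<lambda>(a, u). (1 / a, u / a))"

end

text \<open>A region that every map satisfying the bounds of \<open>chart_step\<close> sends into itself. The conclusions of
  \<open>sector_step\<close> are available as premises of \<open>E_step\<close>.\<close>

locale chart_region = parabolic_germ +
  fixes U K R :: real and E :: "(complex \<times> complex) set"
  assumes bound: "chart_bound U K" and R: "64 * K\<^sup>2 \<le> R"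
    and E: "open E" "connected E" "E \<noteq> {}" "E \<subseteq> sector R \<times> cball 0 U"
    and E_step: "\<And>a u a1 u1. (a, u) \<in> E \<Longrightarrow> a1 \<in> sector R \<Longrightarrow> Re a + 1/2 \<le> Re a1 \<Longrightarrow>
      cmod (a1 - a - 1) \<le> K / cmod a \<Longrightarrow>
      cmod (u1 - u - (u\<^sup>2 + u + b) / a) \<le> K / (cmod a)\<^sup>2 \<Longrightarrow> (a1, u1) \<in> E"
begin

lemma K: "1 \<le> K" "64 \<le> R" "K \<le> R"
proof -
  show 1: "1 \<le> K" using bound by (simp add: chart_bound_def)
  then have "1 * 1 \<le> K * K" "1 * K \<le> K * K" by (intro mult_mono; simp)+
  then have "64 \<le> 64 * K\<^sup>2" "K \<le> K\<^sup>2" by (simp_all add: power2_eq_square)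
  then show "64 \<le> R" "K \<le> R" using R by auto
qed

lemma E_bounds:
  assumes "(a, u) \<in> E"
  shows "a \<in> sector R" "cmod u \<le> U" "R < Re a" "Re a \<le> cmod a" "a \<noteq> 0" "K \<le> cmod a"
proof -
  show a: "a \<in> sector R" and "cmod u \<le> U" using assms E(4) by auto
  show "R < Re a" "Re a \<le> cmod a" "a \<noteq> 0" using sector_bounds[OF a] K by auto
  then show "K \<le> cmod a" using K by simp
qed

lemma chart_next_E:
  assumes "(a, u) \<in> E"
  defines "a1 \<equiv> fst (chart_next (a, u))" and "u1 \<equiv> snd (chart_next (a, u))"
  shows "(a1, u1) \<in> E" "P (chart_point (a, u)) = chart_point (a1, u1)"
    "Re a + 1/2 \<le> Re a1" "cmod a1 \<le> cmod a + 2"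
    "cmod (u1 - u - (u\<^sup>2 + u + b) / a) \<le> K / (cmod a)\<^sup>2"
proof -
  note b = E_bounds[OF assms(1)]
  have c: "fst (P (1 / a, u / a)) \<noteq> 0" "cmod (a1 - a - 1) \<le> K / cmod a"
    "cmod (u1 - u - (u\<^sup>2 + u + b) / a) \<le> K / (cmod a)\<^sup>2"
    using bound b(2,6) unfolding chart_bound_def a1_def u1_def by blast+
  note s = sector_step[OF b(1) K(1) R c(2)]
  show "Re a + 1/2 \<le> Re a1" "cmod a1 \<le> cmod a + 2"
    "cmod (u1 - u - (u\<^sup>2 + u + b) / a) \<le> K / (cmod a)\<^sup>2" by (fact s c)+
  show "(a1, u1) \<in> E" by (rule E_step[OF assms(1) s(1,2) c(2,3)])
  show "P (chart_point (a, u)) = chart_point (a1, u1)"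
    using c(1) by (simp add: chart_point_def a1_def u1_def chart_next_def)
qed

definition orbit_a :: "complex \<times> complex \<Rightarrow> nat \<Rightarrow> complex" where
  "orbit_a p n = fst ((chart_next ^^ n) p)"

definition orbit_u :: "complex \<times> complex \<Rightarrow> nat \<Rightarrow> complex" where
  "orbit_u p n = snd ((chart_next ^^ n) p)"

lemma orbit_0 [simp]: "orbit_a p 0 = fst p" "orbit_u p 0 = snd p"
  by (simp_all add: orbit_a_def orbit_u_def)

lemma orbit_Suc:
  "orbit_a p (Suc n) = fst (chart_next (orbit_a p n, orbit_u p n))"
  "orbit_u p (Suc n) = snd (chart_next (orbit_a p n, orbit_u p n))"
  by (simp_all add: orbit_a_def orbit_u_def)

lemma orbit_E:
  assumes "p \<in> E"
  shows "(orbit_a p n, orbit_u p n) \<in> E"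
proof (induction n)
  case (Suc n)
  then show ?case using chart_next_E(1) by (simp add: orbit_Suc)
qed (use assms in simp)

lemma orbit_step:
  assumes "p \<in> E"
  shows "Re (orbit_a p n) + 1/2 \<le> Re (orbit_a p (Suc n))"
    "cmod (orbit_a p (Suc n)) \<le> cmod (orbit_a p n) + 2"
    "cmod (orbit_u p (Suc n) - orbit_u p n - ((orbit_u p n)\<^sup>2 + orbit_u p n + b) / orbit_a p n)
       \<le> K / (cmod (orbit_a p n))\<^sup>2"
  using chart_next_E(3-5)[OF orbit_E[OF assms, of n]] by (simp_all add: orbit_Suc)

lemma orbit_growth:
  assumes "p \<in> E"
  shows "R + real n / 2 < Re (orbit_a p n)" "cmod (orbit_a p n) \<le> cmod (fst p) + 2 * real n"
proof -
  have "fst p \<in> sector R" using E_bounds(1)[of "fst p" "snd p"] assms by simp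
  then have "R < Re (fst p)" by (simp add: sector_def)
  then show "R + real n / 2 < Re (orbit_a p n)"
  proof (induction n)
    case (Suc n)
    then show ?case using orbit_step(1)[OF assms, of n] by (simp add: field_simps)
  qed simp
  show "cmod (orbit_a p n) \<le> cmod (fst p) + 2 * real n"
  proof (induction n)
    case (Suc n)
    then show ?case using orbit_step(2)[OF assms, of n] by simp
  qed simp
qed

lemma iterate_chart_point:
  assumes "p \<in> E"
  shows "(P ^^ n) (chart_point p) = chart_point (orbit_a p n, orbit_u p n)"
proof (induction n)
  case (Suc n)
  then show ?case using chart_next_E(2)[OF orbit_E[OF assms, of n]] by (simp add: orbit_Suc)
qed simp

lemma inverse_orbit_tendsto_0:
  assumes "p \<in> E"
  shows "(\<lambda>n. 1 / cmod (orbit_a p n)) \<longlonglongrightarrow> 0"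
proof -
  have "filterlim (\<lambda>n. cmod (orbit_a p n)) at_top sequentially"
  proof (rule filterlim_at_top_mono)
    show "filterlim (\<lambda>n. real n * (1/2)) at_top sequentially"
      by (intro filterlim_at_top_mult_tendsto_pos[OF tendsto_const _ filterlim_real_sequentially]) simp
    have "real n * (1/2) \<le> cmod (orbit_a p n)" for n
      using orbit_growth(1)[OF assms, of n] complex_Re_le_cmod[of "orbit_a p n"] K by simp
    then show "\<forall>\<^sub>F n in sequentially. real n * (1/2) \<le> cmod (orbit_a p n)" by simp
  qed
  then show ?thesis by (rule tendsto_divide_0[OF tendsto_const filterlim_at_top_imp_at_infinity])
qed

text \<open>The real part of \<open>a\<close> exceeds \<open>n / 2\<close> after \<open>n\<close> steps, so the orbits tend to the origin uniformly on
  the whole region.\<close>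

theorem attracted_domain: "invariant_attracted_domain P (chart_point ` E)"
proof -
  define W where "W = chart_point ` E"
  have U0: "0 \<le> U" using E(3) E_bounds(2) norm_ge_zero order_trans by (metis ex_in_conv surj_pair)
  define c where "c n = (1 + U) / (real n / 2 + 1)" for n
  have c_bound: "norm ((P ^^ n) x) \<le> c n" if x: "x \<in> W" for n x
  proof -
    obtain p where p: "p \<in> E" "x = chart_point p" using x by (auto simp: W_def)
    define a u where "a = orbit_a p n" "u = orbit_u p n"
    have "(a, u) \<in> E" using orbit_E[OF p(1)] by (simp add: a_u_def)
    then have u: "cmod u \<le> U" by (rule E_bounds)
    have "real n / 2 + 1 \<le> Re a" using orbit_growth(1)[OF p(1), of n] K by (simp add: a_u_def)
    then have a: "real n / 2 + 1 \<le> cmod a" using complex_Re_le_cmod[of a] by simp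
    have "norm ((P ^^ n) x) = norm (1 / a, u / a)"
      unfolding p(2) iterate_chart_point[OF p(1)] by (simp add: chart_point_def a_u_def)
    also have "\<dots> \<le> cmod (1 / a) + cmod (u / a)" by (rule norm_Pair_le)
    also have "\<dots> = (1 + cmod u) / cmod a" by (simp add: norm_divide add_divide_distrib)
    also have "\<dots> \<le> c n" unfolding c_def by (rule frac_le) (use u a U0 in auto)
    finally show ?thesis .
  qed
  have "filterlim (\<lambda>n. 1 + real n * (1/2)) at_top sequentially"
    by (intro filterlim_tendsto_add_at_top[OF tendsto_const]
        filterlim_at_top_mult_tendsto_pos[OF tendsto_const _ filterlim_real_sequentially]) simp
  then have "c \<longlonglongrightarrow> 0"
    unfolding c_def by (intro tendsto_divide_0[OF tendsto_const filterlim_at_top_imp_at_infinity])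
      (simp add: add.commute)
  then have c_small: "\<forall>\<^sub>F n in sequentially. c n < e" if "0 < e" for e
    using that by (rule order_tendstoD)
  have zero: "0 \<notin> W"
    using E_bounds(5) by (auto simp: W_def chart_point_def zero_prod_def)
  have "open ({x :: C2. fst x \<noteq> 0} \<inter> (\<lambda>x. (1 / fst x, snd x / fst x)) -` E)"
  proof (rule continuous_open_preimage[OF _ _ E(1)])
    show "continuous_on {x :: C2. fst x \<noteq> 0} (\<lambda>x. (1 / fst x, snd x / fst x))"
      by (intro continuous_intros) auto
    show "open {x :: C2. fst x \<noteq> 0}"
      by (intro open_Collect_neq continuous_intros)
  qed
  also have "{x :: C2. fst x \<noteq> 0} \<inter> (\<lambda>x. (1 / fst x, snd x / fst x)) -` E = W"
  proof (intro equalityI subsetI)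
    fix x :: C2 assume x: "x \<in> {x. fst x \<noteq> 0} \<inter> (\<lambda>x. (1 / fst x, snd x / fst x)) -` E"
    then have "x = chart_point (1 / fst x, snd x / fst x)" by (simp add: chart_point_def)
    then show "x \<in> W" using x unfolding W_def by blast
  next
    fix x assume "x \<in> W"
    then obtain a u where "(a, u) \<in> E" "x = (1 / a, u / a)" by (auto simp: W_def chart_point_def)
    then show "x \<in> {x. fst x \<noteq> 0} \<inter> (\<lambda>x. (1 / fst x, snd x / fst x)) -` E"
      using E_bounds(5) by simp
  qed
  finally have "open W" .
  moreover have "connected W"
    unfolding W_def
  proof (rule connected_continuous_image[OF _ E(2)])
    show "continuous_on E chart_point"
      unfolding chart_point_def case_prod_beta
      by (intro continuous_intros) (use E_bounds(5) in auto)
  qed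
  moreover have PW: "P ` W \<subseteq> W"
  proof
    fix y assume "y \<in> P ` W"
    then obtain a u where "(a, u) \<in> E" "y = P (chart_point (a, u))" by (auto simp: W_def)
    then show "y \<in> W" using chart_next_E(1,2)[of a u] by (auto simp: W_def)
  qed
  moreover have "0 \<in> frontier W"
  proof -
    obtain p where "p \<in> E" using E(3) by blast
    then have x: "chart_point p \<in> W" by (simp add: W_def)
    define x where "x = chart_point p"
    note x = x[folded x_def]
    have "0 \<in> closure W"
      unfolding closure_approachable
    proof (intro allI impI)
      fix e :: real assume "0 < e"
      then obtain n where "c n < e" using c_small[of e] by (auto simp: eventually_sequentially)
      then have "dist ((P ^^ n) x) 0 < e" using c_bound[OF x, of n] by simp
      moreover have "(P ^^ n) x \<in> W" using x PW by (induction n) auto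
      ultimately show "\<exists>y\<in>W. dist y 0 < e" by blast
    qed
    then show ?thesis using zero \<open>open W\<close> by (simp add: frontier_def interior_open)
  qed
  moreover have "uniform_limit W (\<lambda>n. P ^^ n) (\<lambda>_. 0) sequentially"
  proof (rule uniform_limitI)
    fix e :: real assume "0 < e"
    from c_small[OF this] show "\<forall>\<^sub>F n in sequentially. \<forall>x\<in>W. dist ((P ^^ n) x) 0 < e"
    proof eventually_elim
      case (elim n)
      then show ?case using c_bound[of _ n] by (auto intro: le_less_trans)
    qed
  qed
  ultimately show ?thesis unfolding invariant_attracted_domain_def W_def[symmetric] by blast
qed

lemma defect_tendsto_0:
  assumes p: "p \<in> E" and lim: "orbit_u p \<longlonglongrightarrow> t"
  shows "(\<lambda>n. tangency_defect t ((P ^^ n) (chart_point p))) \<longlonglongrightarrow> 0"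
proof (rule Lim_null_comparison)
  show "(\<lambda>n. cmod (orbit_u p n - t)) \<longlonglongrightarrow> 0"
    using lim by (intro tendsto_norm_zero LIM_zero)
  have "norm (tangency_defect t ((P ^^ n) (chart_point p))) \<le> cmod (orbit_u p n - t)" for n
  proof -
    define a u where "a = orbit_a p n" "u = orbit_u p n"
    have "(a, u) \<in> E" using orbit_E[OF p] by (simp add: a_u_def)
    then have a: "a \<noteq> 0" by (rule E_bounds)
    have x: "(P ^^ n) (chart_point p) = (1 / a, u / a)"
      unfolding iterate_chart_point[OF p] by (simp add: chart_point_def a_u_def)
    have "cmod (1 / a) \<le> norm (1 / a, u / a)" using norm_fst_le[of "1 / a" "u / a"] by simp
    moreover have "0 < cmod (1 / a)" using a by simp
    moreover have "cmod (u / a - t * (1 / a)) = cmod (u - t) * cmod (1 / a)"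
      unfolding norm_mult[symmetric] by (simp add: diff_divide_distrib)
    ultimately have "cmod (u / a - t * (1 / a)) \<le> cmod (u - t) * norm (1 / a, u / a)"
      "0 < norm (1 / a, u / a)"
      using mult_left_mono[of "cmod (1 / a)" "norm (1 / a, u / a)" "cmod (u - t)"] by auto
    then have "norm (tangency_defect t (1 / a, u / a)) \<le> cmod (u - t)"
      by (simp only: tangency_defect_def fst_conv snd_conv norm_divide norm_of_real abs_norm_cancel
          pos_divide_le_eq)
    then show ?thesis unfolding x by (simp only: a_u_def)
  qed
  then show "\<forall>\<^sub>F n in sequentially. norm (tangency_defect t ((P ^^ n) (chart_point p)))
      \<le> cmod (orbit_u p n - t)" by simp
qed

theorem exists_tangent_parabolic_domain:
  assumes lim: "\<And>p. p \<in> E \<Longrightarrow> orbit_u p \<longlonglongrightarrow> t"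
  shows "\<exists>\<Omega>. parabolic_domain_tangent_to P \<Omega> (1, t)"
proof -
  obtain \<Omega> where \<Omega>: "parabolic_domain P \<Omega>" "chart_point ` E \<subseteq> \<Omega>"
    using exists_parabolic_domain_above[OF attracted_domain] by blast
  have dom: "invariant_attracted_domain P \<Omega>" using \<Omega>(1) by (simp add: parabolic_domain_def)
  have "limitin P1_topology (\<lambda>n. complex_line ((P ^^ n) x)) (complex_line (1, t)) sequentially"
    if x: "x \<in> \<Omega>" for x
  proof (rule limitin_of_tangency_defect)
    show "(P ^^ n) x \<noteq> 0" for n
      using iterate_in_attracted_domain[OF dom x] zero_notin_attracted_domain[OF dom] by metis
    show "(\<lambda>n. tangency_defect t ((P ^^ n) x)) \<longlonglongrightarrow> 0"
    proof (rule tangency_propagates[OF dom _ _ \<Omega>(2) _ x])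
      show "open (chart_point ` E)" using attracted_domain by (simp add: invariant_attracted_domain_def)
      show "chart_point ` E \<noteq> {}" using E(3) by simp
      show "(\<lambda>n. tangency_defect t ((P ^^ n) y)) \<longlonglongrightarrow> 0" if "y \<in> chart_point ` E" for y
        using that defect_tendsto_0 lim by blast
    qed
  qed
  then show ?thesis using \<Omega>(1) unfolding parabolic_domain_tangent_to_def by (auto simp: zero_prod_def)
qed

text \<open>A single orbit without limit direction excludes all tangent directions of the maximal domain.\<close>

theorem exists_spiral_domain:
  assumes p: "p \<in> E" and "\<not> convergent (orbit_u p)"
  shows "\<exists>\<Omega>. spiral_domain P \<Omega>"
proof -
  obtain \<Omega> where \<Omega>: "parabolic_domain P \<Omega>" "chart_point ` E \<subseteq> \<Omega>"
    using exists_parabolic_domain_above[OF attracted_domain] by blast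
  have "\<not> parabolic_domain_tangent_to P \<Omega> v" for v
  proof
    assume t: "parabolic_domain_tangent_to P \<Omega> v"
    define x where "x n = (P ^^ n) (chart_point p)" for n
    have "chart_point p \<in> \<Omega>" using p \<Omega>(2) by blast
    then have lim: "limitin P1_topology (\<lambda>n. complex_line (x n)) (complex_line v) sequentially"
      and v: "v \<noteq> 0"
      using t unfolding parabolic_domain_tangent_to_def x_def by blast+
    have a: "orbit_a p n \<noteq> 0" for n using orbit_E[OF p, of n] E_bounds(5) by blast
    have x: "x n = (1 / orbit_a p n, orbit_u p n / orbit_a p n)" for n
      unfolding x_def iterate_chart_point[OF p] by (simp add: chart_point_def)
    have slope: "snd (x n) / fst (x n) = orbit_u p n" for n using a[of n] by (simp add: x)
    have "convergent (\<lambda>n. snd (x n) / fst (x n))"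
    proof (rule slope_converges_of_limitin[OF _ _ v lim])
      show "fst (x n) \<noteq> 0" for n using a[of n] by (simp add: x)
      show "cmod (snd (x n) / fst (x n)) \<le> U" for n
        unfolding slope using orbit_E[OF p, of n] by (rule E_bounds)
    qed
    then show False using assms(2) by (simp add: slope)
  qed
  then show ?thesis using \<Omega>(1) by (auto simp: spiral_domain_def)
qed

end

section \<open>Estimates for two distinct fixed points\<close>

text \<open>The square of the right-hand side exceeds \<open>(1 - Re w)\<^sup>2\<close> by at least \<open>2 (1 - Re w) (Im w)\<^sup>2\<close>.\<close>

lemma norm_one_minus_le:
  assumes "Re w \<le> 1/2"
  shows "cmod (1 - w) \<le> 1 - Re w + (Im w)\<^sup>2"
proof (rule power2_le_imp_le)
  have "1 * (Im w)\<^sup>2 \<le> (2 * (1 - Re w)) * (Im w)\<^sup>2" by (rule mult_right_mono) (use assms in auto)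
  moreover have "0 \<le> ((Im w)\<^sup>2)\<^sup>2" by (rule zero_le_power2)
  moreover have "(cmod (1 - w))\<^sup>2 = (1 - Re w)\<^sup>2 + (Im w)\<^sup>2" by (simp add: cmod_power2)
  ultimately show "(cmod (1 - w))\<^sup>2 \<le> (1 - Re w + (Im w)\<^sup>2)\<^sup>2"
    unfolding power2_sum[of "1 - Re w" "(Im w)\<^sup>2"] by linarith
qed (use assms in \<open>simp add: add_nonneg_nonneg\<close>)

text \<open>Summing along \<open>A, A + 1/2, \<dots>\<close> shows that the terms \<open>A powr (-3/2)\<close> are absorbed by a multiple of
  \<open>1 / sqrt A\<close>; this is the margin of the invariant region below.\<close>

lemma inverse_sqrt_decrease:
  fixes A A1 :: real
  assumes "1 \<le> A" "A + 1/2 \<le> A1"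
  shows "1 / (A * sqrt A) \<le> 12 * (1 / sqrt A - 1 / sqrt A1)"
proof -
  define s t where "s = sqrt A" "t = sqrt (A + 1/2)"
  have s: "1 \<le> s" "s\<^sup>2 = A" and t: "0 < t" "t\<^sup>2 = A + 1/2" using assms by (simp_all add: s_t_def)
  have st: "s \<le> t" using assms by (simp add: s_t_def)
  have t2s: "t \<le> 2 * s" by (rule power2_le_imp_le) (use s t assms in auto)
  have "(t - s) * (t + s) = 1/2" using s t by (simp add: power2_eq_square algebra_simps)
  moreover have "(t - s) * (t + s) \<le> (t - s) * (3 * s)" by (rule mult_left_mono) (use st t2s in auto)
  moreover have "(t - s) * (3 * s) = (6 * s * (t - s)) / 2" by simp
  ultimately have 1: "1 \<le> 6 * s * (t - s)" by linarith
  have "t * 1 \<le> (2 * s) * (6 * s * (t - s))" by (rule mult_mono) (use 1 t2s t s in auto)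
  then have "1 / s ^ 3 \<le> 12 * ((t - s) / (s * t))"
    using s t by (simp add: field_simps power3_eq_cube)
  also have "(t - s) / (s * t) = 1 / s - 1 / t" using s t by (simp add: field_simps)
  also have "1 / s - 1 / t \<le> 1 / s - 1 / sqrt A1"
  proof -
    have "t \<le> sqrt A1" using assms by (simp add: s_t_def)
    then have "1 / sqrt A1 \<le> 1 / t" using t(1) assms by (intro divide_left_mono mult_pos_pos) auto
    then show ?thesis by simp
  qed
  finally have "1 / s ^ 3 \<le> 12 * (1 / s - 1 / sqrt A1)" by simp
  moreover have "s ^ 3 = A * sqrt A" using s by (simp add: s_t_def power3_eq_cube)
  ultimately show ?thesis by (simp add: s_t_def)
qed

lemma sector_inverse_bounds:
  assumes a: "a \<in> sector R" and R: "1 \<le> R"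
  shows "\<bar>Im (1 / a)\<bar> \<le> 1 / (Re a * sqrt (Re a))" "(1 / cmod a)\<^sup>2 \<le> 1 / (Re a * sqrt (Re a))"
    "1 / cmod a \<le> 1 / R" "1 / (2 * cmod a) \<le> Re (1 / a)"
    "\<bar>Im (1 / a)\<bar> \<le> 1 / cmod a * sqrt (1 / cmod a)"
proof -
  have s: "R < Re a" "(Im a)\<^sup>2 < Re a" "Re a \<le> cmod a" "0 < cmod a" "R < cmod a" "a \<noteq> 0" "0 < Re a"
    using sector_bounds[OF a] R by auto
  have im: "\<bar>Im a\<bar> \<le> sqrt (Re a)" using s(2) by (simp add: real_le_rsqrt)
  have sq: "cmod a ^ 2 = (Re a)\<^sup>2 + (Im a)\<^sup>2" by (rule cmod_power2)
  have Im_eq: "\<bar>Im (1 / a)\<bar> = \<bar>Im a\<bar> / (cmod a)\<^sup>2"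
    by (simp add: Im_divide sq)
  have Re_eq: "Re (1 / a) = Re a / (cmod a)\<^sup>2" by (simp add: Re_divide sq)
  have "\<bar>Im a\<bar> / (cmod a)\<^sup>2 \<le> sqrt (Re a) / (Re a)\<^sup>2"
    by (rule frac_le) (use im s in auto)
  also have "\<dots> = 1 / (Re a * sqrt (Re a))"
  proof -
    have "sqrt (Re a) * sqrt (Re a) = Re a" using s by simp
    then show ?thesis using s by (simp add: field_simps power2_eq_square)
  qed
  finally show "\<bar>Im (1 / a)\<bar> \<le> 1 / (Re a * sqrt (Re a))" by (simp add: Im_eq)
  have "sqrt (Re a) \<le> Re a" using s R by (intro real_le_lsqrt) (auto simp: power2_eq_square)
  then have "Re a * sqrt (Re a) \<le> Re a * Re a" using s by (intro mult_left_mono) auto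
  also have "\<dots> \<le> (cmod a)\<^sup>2" using s by (simp add: power2_eq_square mult_mono)
  finally show "(1 / cmod a)\<^sup>2 \<le> 1 / (Re a * sqrt (Re a))"
    using s by (simp add: power_divide divide_left_mono)
  show "1 / cmod a \<le> 1 / R" using s R by (intro divide_left_mono) auto
  have "(cmod a)\<^sup>2 \<le> (2 * Re a)\<^sup>2"
  proof -
    have "Re a * 1 \<le> Re a * Re a" using s R by (intro mult_left_mono) auto
    moreover have "0 \<le> Re a * Re a" by simp
    ultimately have "Re a * Re a + Im a * Im a \<le> 4 * (Re a * Re a)"
      using s(2) unfolding power2_eq_square by linarith
    then show ?thesis unfolding sq by (simp add: power2_eq_square)
  qed
  then have "cmod a \<le> 2 * Re a" by (rule power2_le_imp_le) (use s in simp)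
  then show "1 / (2 * cmod a) \<le> Re (1 / a)" using s by (simp add: Re_eq field_simps power2_eq_square)
  have "\<bar>Im a\<bar> \<le> sqrt (cmod a)" using im s(3) by (meson order_trans real_sqrt_le_mono)
  then have "\<bar>Im a\<bar> / (cmod a)\<^sup>2 \<le> sqrt (cmod a) / (cmod a)\<^sup>2" by (rule divide_right_mono) simp
  also have "\<dots> = 1 / cmod a * sqrt (1 / cmod a)"
  proof -
    have "sqrt (cmod a) * sqrt (cmod a) = cmod a" by simp
    then show ?thesis using s by (simp add: real_sqrt_divide field_simps power2_eq_square)
  qed
  finally show "\<bar>Im (1 / a)\<bar> \<le> 1 / cmod a * sqrt (1 / cmod a)" by (simp add: Im_eq)
qed

text \<open>The quotient \<open>p / q\<close> linearizes the vector field \<open>p q\<close>: one Euler step multiplies it by \<open>1 - \<kappa> z\<close>, up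
  to second order in \<open>z\<close>.\<close>

lemma mobius_step:
  fixes z e p q \<kappa> :: complex
  assumes pq: "p = q + \<kappa>" "\<kappa> \<noteq> 0" "2 * cmod p \<le> cmod q"
    and z: "cmod z * cmod \<kappa> \<le> 1/4" and e: "cmod e \<le> cmod \<kappa> / 4" "cmod e \<le> K * (cmod z)\<^sup>2"
  defines "p1 \<equiv> p * (1 + z * q) + e" and "q1 \<equiv> q * (1 + z * p) + e"
  shows "q1 \<noteq> 0" "cmod (p1 / q1 - p / q * (1 - \<kappa> * z)) \<le> (12 * (cmod \<kappa>)\<^sup>2 + 24 * K / cmod \<kappa>) * (cmod z)\<^sup>2"
proof -
  define k where "k = cmod \<kappa>"
  have k: "0 < k" using pq by (simp add: k_def)
  have "k \<le> cmod p + cmod q" using norm_triangle_ineq4[of p q] pq by (simp add: k_def)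
  moreover have "cmod q \<le> cmod p + k" using norm_triangle_ineq4[of p \<kappa>] pq by (simp add: k_def)
  ultimately have q: "2/3 * k \<le> cmod q" "cmod q \<le> 2 * k" and p: "cmod p \<le> k" using pq(3) by auto
  have q0: "q \<noteq> 0" using q k by auto
  have zp: "cmod (z * p) \<le> 1/4"
  proof -
    have "cmod z * cmod p \<le> cmod z * k" by (rule mult_left_mono[OF p]) simp
    then show ?thesis using z by (simp add: norm_mult k_def)
  qed
  have "3/4 \<le> cmod (1 + z * p)" using zp norm_diff_ineq[of 1 "z * p"] by simp
  then have "2/3 * k * (3/4) \<le> cmod (q * (1 + z * p))"
    unfolding norm_mult using q k by (intro mult_mono) auto
  then have q1: "k / 4 \<le> cmod q1"
    using norm_diff_ineq[of "q * (1 + z * p)" e] e(1) by (simp add: q1_def k_def)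
  then have "0 < cmod q1" using k by linarith
  then show q10: "q1 \<noteq> 0" by simp
  have "p1 / q1 - p / q * (1 - \<kappa> * z) = (\<kappa> * (p * p) * q * (z * z) + e * (q - p * (1 - \<kappa> * z))) / (q * q1)"
  proof -
    have "p1 * q - p * (1 - \<kappa> * z) * q1 = \<kappa> * (p * p) * q * (z * z) + e * (q - p * (1 - \<kappa> * z))"
      unfolding p1_def q1_def pq(1) by (simp add: algebra_simps)
    moreover have "p1 / q1 - p / q * (1 - \<kappa> * z) = (p1 * q - p * (1 - \<kappa> * z) * q1) / (q * q1)"
      using q0 q10 by (simp add: field_simps)
    ultimately show ?thesis by simp
  qed
  moreover have "cmod (\<kappa> * (p * p) * q * (z * z) + e * (q - p * (1 - \<kappa> * z)))
      \<le> (2 * k ^ 4 + 4 * K * k) * (cmod z)\<^sup>2"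
  proof -
    have "cmod (\<kappa> * (p * p) * q * (z * z)) \<le> k * (k * k) * (2 * k) * (cmod z * cmod z)"
      unfolding norm_mult by (intro mult_mono) (use p q k in \<open>auto simp: k_def\<close>)
    moreover have "cmod (e * (q - p * (1 - \<kappa> * z))) \<le> (K * (cmod z)\<^sup>2) * (4 * k)"
      unfolding norm_mult
    proof (rule mult_mono[OF e(2)])
      have "cmod (1 - \<kappa> * z) \<le> 2"
        using norm_triangle_ineq4[of 1 "\<kappa> * z"] z by (simp add: norm_mult mult.commute)
      then have "cmod (p * (1 - \<kappa> * z)) \<le> k * 2" unfolding norm_mult by (intro mult_mono) (use p k in auto)
      then show "cmod (q - p * (1 - \<kappa> * z)) \<le> 4 * k"
        using norm_triangle_ineq4[of q "p * (1 - \<kappa> * z)"] q by simp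
    qed (use e(2) norm_ge_zero order_trans in \<open>blast+\<close>)
    ultimately have "cmod (\<kappa> * (p * p) * q * (z * z)) + cmod (e * (q - p * (1 - \<kappa> * z)))
       \<le> (2 * k ^ 4 + 4 * K * k) * (cmod z)\<^sup>2"
      by (simp add: power2_eq_square algebra_simps eval_nat_numeral)
    then show ?thesis by (rule order_trans[OF norm_triangle_ineq])
  qed
  moreover have "k\<^sup>2 / 6 \<le> cmod (q * q1)"
  proof -
    have "(2/3 * k) * (k / 4) \<le> cmod q * cmod q1" by (intro mult_mono q q1) (use k in auto)
    then show ?thesis by (simp add: norm_mult power2_eq_square)
  qed
  ultimately have "cmod (p1 / q1 - p / q * (1 - \<kappa> * z)) \<le> (2 * k ^ 4 + 4 * K * k) * (cmod z)\<^sup>2 / (k\<^sup>2 / 6)"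
    unfolding norm_divide using k by (simp only: norm_divide) (intro frac_le; auto intro: order_trans[OF norm_ge_zero])
  also have "\<dots> = (12 * k\<^sup>2 + 24 * K / k) * (cmod z)\<^sup>2"
    using k by (simp add: field_simps power2_eq_square eval_nat_numeral)
  finally show "cmod (p1 / q1 - p / q * (1 - \<kappa> * z)) \<le> (12 * (cmod \<kappa>)\<^sup>2 + 24 * K / cmod \<kappa>) * (cmod z)\<^sup>2"
    by (simp add: k_def)
qed

section \<open>The Moebius coordinate and its invariant region\<close>

text \<open>With \<open>\<kappa>\<^sup>2 = 1 - 4 b\<close> the vector field has the zeros \<open>(- 1 \<plusminus> \<kappa>) / 2\<close>, where its derivative is \<open>\<plusminus> \<kappa>\<close>. For
  \<open>Re \<kappa> > 0\<close> the zero \<open>t_minus\<close> attracts; for \<open>Re \<kappa> = 0\<close> it is a centre. The bound on \<open>\<bar>u\<bar>\<close> in the last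
  assumption is the one that \<open>\<bar>V\<bar> \<le> 1/2\<close> implies.\<close>

locale mobius_germ = parabolic_germ +
  fixes \<kappa> :: complex and K :: real
  assumes \<kappa>: "\<kappa>\<^sup>2 = 1 - 4 * b" "\<kappa> \<noteq> 0" "0 \<le> Re \<kappa>"
    and bound: "chart_bound (cmod ((-1 - \<kappa>) / 2) + cmod \<kappa>) K"
begin

definition "t_minus = (-1 - \<kappa>) / 2"
definition "t_plus = (-1 + \<kappa>) / 2"
definition "V u = (u - t_minus) / (u - t_plus)"
definition "M1 = 12 * (cmod \<kappa>)\<^sup>2 + 24 * K / cmod \<kappa>"
definition "M2 = cmod \<kappa> + (cmod \<kappa>)\<^sup>2 + M1"
definition "L = 12 * M2"
definition "R = 64 * K\<^sup>2 + 4 * cmod \<kappa> + 4 * K / cmod \<kappa> + 4 * L\<^sup>2 + 1"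
text \<open>The region \<open>\<bar>V\<bar> < 1/2 - L / sqrt (Re a)\<close>, with denominators cleared so that both sides are
  continuous. The shrinking margin absorbs the errors of all later steps.\<close>

definition "E = {(a, u). a \<in> sector R \<and>
  cmod (u - t_minus) * sqrt (Re a) < (sqrt (Re a) / 2 - L) * cmod (u - t_plus)}"

lemma constants:
  "1 \<le> K" "0 < cmod \<kappa>" "0 \<le> M1" "0 < M2" "0 < L" "1 \<le> R" "64 * K\<^sup>2 \<le> R"
  "4 * cmod \<kappa> \<le> R" "4 * K / cmod \<kappa> \<le> R" "4 * L\<^sup>2 < R"
proof -
  show K: "1 \<le> K" using bound by (simp add: chart_bound_def)
  show k: "0 < cmod \<kappa>" using \<kappa> by simp
  show M1: "0 \<le> M1" using K by (simp add: M1_def)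
  show M2: "0 < M2" using k M1 by (simp add: M2_def add_pos_nonneg)
  show "0 < L" using M2 by (simp add: L_def)
  have nn: "0 \<le> 64 * K\<^sup>2" "0 \<le> 4 * cmod \<kappa>" "0 \<le> 4 * K / cmod \<kappa>" "0 \<le> 4 * L\<^sup>2" using K by auto
  then show "1 \<le> R" "64 * K\<^sup>2 \<le> R" "4 * cmod \<kappa> \<le> R" "4 * K / cmod \<kappa> \<le> R" "4 * L\<^sup>2 < R"
    unfolding R_def by linarith+
qed

lemma t_diff: "t_plus - t_minus = \<kappa>"
  by (simp add: t_minus_def t_plus_def field_simps)

lemma t_plus_eq: "t_plus = t_minus + \<kappa>"
  by (simp add: t_minus_def t_plus_def field_simps)

lemma quadratic_factor: "u\<^sup>2 + u + b = (u - t_minus) * (u - t_plus)"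
proof -
  have *: "2 * (u - t_minus) = 2 * u + 1 + \<kappa>" "2 * (u - t_plus) = 2 * u + 1 - \<kappa>"
    by (simp_all add: t_minus_def t_plus_def field_simps)
  have "4 * ((u - t_minus) * (u - t_plus)) = (2 * (u - t_minus)) * (2 * (u - t_plus))" by (simp add: algebra_simps)
  also have "\<dots> = (2 * u + 1)\<^sup>2 - \<kappa>\<^sup>2" unfolding * by (simp add: power2_eq_square algebra_simps)
  also have "\<dots> = 4 * (u\<^sup>2 + u + b)" unfolding \<kappa>(1) by (simp add: power2_eq_square algebra_simps)
  finally have "(4 :: complex) * ((u - t_minus) * (u - t_plus)) = 4 * (u\<^sup>2 + u + b)" .
  then have "(u - t_minus) * (u - t_plus) = u\<^sup>2 + u + b"
    by (subst (asm) mult_left_cancel) simp_all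
  then show ?thesis ..
qed

lemma V_inverse:
  assumes "u \<noteq> t_plus"
  shows "V u \<noteq> 1" "u = (t_minus - t_plus * V u) / (1 - V u)"
proof -
  have q: "u - t_plus \<noteq> 0" using assms by simp
  have "1 - V u = - \<kappa> / (u - t_plus)" using q t_diff by (simp add: V_def field_simps)
  then have ne: "1 - V u \<noteq> 0" using q \<kappa>(2) by simp
  then show "V u \<noteq> 1" by simp
  have "V u * (u - t_plus) = u - t_minus" using q by (simp add: V_def)
  then have "u * (1 - V u) = t_minus - t_plus * V u" by (simp add: algebra_simps)
  then show "u = (t_minus - t_plus * V u) / (1 - V u)" using ne by (simp add: field_simps)
qed

lemma V_of_inverse:
  assumes "v \<noteq> 1"
  shows "(t_minus - t_plus * v) / (1 - v) \<noteq> t_plus" "V ((t_minus - t_plus * v) / (1 - v)) = v"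
proof -
  have v: "1 - v \<noteq> 0" using assms by simp
  have q: "(t_minus - t_plus * v) / (1 - v) - t_plus = - \<kappa> / (1 - v)"
    using v t_diff by (simp add: field_simps)
  have p: "(t_minus - t_plus * v) / (1 - v) - t_minus = - (\<kappa> * v) / (1 - v)"
    using v by (simp add: t_plus_eq field_simps)
  show "(t_minus - t_plus * v) / (1 - v) \<noteq> t_plus" using q v \<kappa>(2) by auto
  show "V ((t_minus - t_plus * v) / (1 - v)) = v" unfolding V_def p q using v \<kappa>(2) by simp
qed

lemma sector_sqrt:
  assumes "a \<in> sector R"
  shows "2 * L < sqrt (Re a)" "0 < sqrt (Re a)"
proof -
  have "(2 * L)\<^sup>2 < Re a" using assms constants(10) by (simp add: sector_def power_mult_distrib)
  then show "2 * L < sqrt (Re a)" by (rule real_less_rsqrt)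
  then show "0 < sqrt (Re a)" using constants(5) by linarith
qed

lemma E_iff:
  "(a, u) \<in> E \<longleftrightarrow> a \<in> sector R \<and> u \<noteq> t_plus \<and> cmod (V u) < 1/2 - L / sqrt (Re a)"
proof (cases "a \<in> sector R \<and> u \<noteq> t_plus")
  case True
  then have s: "0 < sqrt (Re a)" using sector_sqrt by blast
  have q: "0 < cmod (u - t_plus)" using True by simp
  have "cmod (V u) < 1/2 - L / sqrt (Re a) \<longleftrightarrow>
      cmod (V u) * (cmod (u - t_plus) * sqrt (Re a)) < (1/2 - L / sqrt (Re a)) * (cmod (u - t_plus) * sqrt (Re a))"
    using s q by (intro mult_less_cancel_right_pos[symmetric] mult_pos_pos)
  also have "cmod (V u) * (cmod (u - t_plus) * sqrt (Re a)) = cmod (u - t_minus) * sqrt (Re a)"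
    using q by (simp add: V_def norm_divide)
  also have "(1/2 - L / sqrt (Re a)) * (cmod (u - t_plus) * sqrt (Re a)) = (sqrt (Re a) / 2 - L) * cmod (u - t_plus)"
    using s by (simp add: left_diff_distrib)
  finally show ?thesis using True by (simp add: E_def)
next
  case False
  then show ?thesis using sector_sqrt(2)[of a] by (auto simp: E_def mult_less_0_iff)
qed

lemma E_bounds':
  assumes "(a, u) \<in> E"
  shows "a \<in> sector R" "u \<noteq> t_plus" "cmod (V u) \<le> 1/2" "2 * cmod (u - t_minus) \<le> cmod (u - t_plus)"
    "cmod u \<le> cmod t_minus + cmod \<kappa>"
proof -
  have h: "a \<in> sector R" "u \<noteq> t_plus" "cmod (V u) < 1/2 - L / sqrt (Re a)"
    using assms E_iff by auto
  have "0 < L / sqrt (Re a)" using sector_sqrt[OF h(1)] constants(5) by simp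
  then show v: "cmod (V u) \<le> 1/2" using h(3) by linarith
  show "a \<in> sector R" "u \<noteq> t_plus" by fact+
  have q: "0 < cmod (u - t_plus)" using h(2) by simp
  then show 2: "2 * cmod (u - t_minus) \<le> cmod (u - t_plus)"
    using v by (simp add: V_def norm_divide field_simps)
  have "u - t_minus = (u - t_plus) + \<kappa>" by (simp add: t_plus_eq)
  then have "cmod (u - t_plus) \<le> cmod (u - t_minus) + cmod \<kappa>"
    using norm_triangle_ineq4[of "u - t_minus" \<kappa>] by (simp add: t_plus_eq algebra_simps)
  then have "cmod (u - t_minus) \<le> cmod \<kappa>" using 2 by linarith
  then show "cmod u \<le> cmod t_minus + cmod \<kappa>"
    using norm_triangle_ineq[of t_minus "u - t_minus"] by simp
qed

lemma V_step:
  assumes E: "(a, u) \<in> E" and u1: "cmod (u1 - u - (u\<^sup>2 + u + b) / a) \<le> K / (cmod a)\<^sup>2"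
  shows "u1 \<noteq> t_plus" "cmod (V u1 - V u * (1 - \<kappa> / a)) \<le> M1 * (1 / cmod a)\<^sup>2"
proof -
  note h = E_bounds'[OF E]
  define z where "z = 1 / a"
  define e where "e = u1 - u - (u\<^sup>2 + u + b) / a"
  define p where "p = u - t_minus"
  define q where "q = u - t_plus"
  have z1: "cmod z \<le> 1 / R" using sector_inverse_bounds(3)[OF h(1) constants(6)] by (simp add: z_def norm_divide)
  have R0: "0 < R" using constants(6) by simp
  have zR: "cmod z * R \<le> 1" using z1 R0 by (simp add: field_simps)
  have zc: "cmod z * c \<le> 1" if "c \<le> R" for c
    using mult_left_mono[OF that norm_ge_zero[of z]] zR by linarith
  have pq: "p = q + \<kappa>" by (simp add: p_def q_def t_plus_eq)
  have zk: "cmod z * cmod \<kappa> \<le> 1/4" using zc[OF constants(8)] by simp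
  have e2: "cmod e \<le> K * (cmod z)\<^sup>2" using u1 by (simp add: e_def z_def norm_divide power_divide)
  have e1: "cmod e \<le> cmod \<kappa> / 4"
  proof -
    have "cmod z \<le> 1" using zc[OF constants(6)] by simp
    then have "cmod z * cmod z \<le> cmod z" by (simp add: mult_left_le_one_le)
    then have "K * (cmod z)\<^sup>2 \<le> K * cmod z" using constants(1) by (simp add: power2_eq_square)
    also have "\<dots> \<le> cmod \<kappa> / 4" using zc[OF constants(9)] constants(2) by (simp add: field_simps)
    finally show ?thesis using e2 by simp
  qed
  have p1: "u1 - t_minus = p * (1 + z * q) + e" and q1: "u1 - t_plus = q * (1 + z * p) + e"
  proof -
    have "e = u1 - u - z * (p * q)" by (simp add: e_def quadratic_factor p_def q_def z_def)
    then show "u1 - t_minus = p * (1 + z * q) + e" "u1 - t_plus = q * (1 + z * p) + e"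
      by (simp_all add: p_def q_def algebra_simps)
  qed
  have 2: "2 * cmod p \<le> cmod q" using h(4) by (simp add: p_def q_def)
  note m = mobius_step[OF pq \<kappa>(2) 2 zk e1 e2]
  show "u1 \<noteq> t_plus" using m(1) unfolding q1[symmetric] by simp
  have "cmod (V u1 - V u * (1 - \<kappa> * z)) \<le> M1 * (cmod z)\<^sup>2"
    using m(2) unfolding p1[symmetric] q1[symmetric] by (simp add: V_def M1_def p_def q_def)
  then show "cmod (V u1 - V u * (1 - \<kappa> / a)) \<le> M1 * (1 / cmod a)\<^sup>2"
    by (simp add: z_def norm_divide)
qed

text \<open>The perturbation and the factor \<open>1 - \<kappa> / a\<close> increase \<open>\<bar>V\<bar>\<close> by at most a multiple of
  \<open>Re a powr (-3/2)\<close>, which is summable along orbits. For \<open>Re \<kappa> = 0\<close> the factor has modulus close to 1,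
  and the same bound holds for a decrease.\<close>

lemma norm_V_step:
  assumes E: "(a, u) \<in> E" and u1: "cmod (u1 - u - (u\<^sup>2 + u + b) / a) \<le> K / (cmod a)\<^sup>2"
    and a1: "Re a + 1/2 \<le> Re a1"
  shows "cmod (V u1) \<le> cmod (V u) + (L / sqrt (Re a) - L / sqrt (Re a1))"
    "Re \<kappa> = 0 \<Longrightarrow> cmod (V u) - (L / sqrt (Re a) - L / sqrt (Re a1)) \<le> cmod (V u1)"
proof -
  note h = E_bounds'[OF E]
  define D where "D = 1 / (Re a * sqrt (Re a))"
  note s = sector_inverse_bounds[OF h(1) constants(6), folded D_def]
  have A: "1 \<le> Re a" using h(1) constants(6) by (simp add: sector_def)
  then have D0: "0 \<le> D" by (simp add: D_def)
  have D: "M2 * D \<le> L / sqrt (Re a) - L / sqrt (Re a1)"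
  proof -
    have "M2 * D \<le> M2 * (12 * (1 / sqrt (Re a) - 1 / sqrt (Re a1)))"
      using inverse_sqrt_decrease[OF A a1] constants(4) by (intro mult_left_mono) (auto simp: D_def)
    then show ?thesis by (simp add: L_def right_diff_distrib mult_ac)
  qed
  have err: "cmod (V u1 - V u * (1 - \<kappa> / a)) \<le> M1 * D"
    using V_step(2)[OF E u1] mult_left_mono[OF s(2) constants(3)] by simp
  have "\<kappa> / a = \<kappa> * (1 / a)" by simp
  then have Re_eq: "Re (\<kappa> / a) = Re \<kappa> * Re (1 / a) - Im \<kappa> * Im (1 / a)"
    by (simp only: times_complex.sel)
  have im: "\<bar>Im \<kappa> * Im (1 / a)\<bar> \<le> cmod \<kappa> * D"
    unfolding abs_mult by (intro mult_mono abs_Im_le_cmod s) auto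
  have kz: "cmod (\<kappa> / a) \<le> 1/4"
  proof -
    have "cmod \<kappa> * (1 / cmod a) \<le> cmod \<kappa> * (1 / R)" by (intro mult_left_mono s) simp
    also have "\<dots> \<le> 1/4" using constants(6,8) by (simp add: field_simps)
    finally show ?thesis by (simp add: norm_divide)
  qed
  have "cmod (1 - \<kappa> / a) \<le> 1 + (cmod \<kappa> + (cmod \<kappa>)\<^sup>2) * D"
  proof -
    have "0 \<le> Re (1 / a)" using s(4) by (rule order_trans[rotated]) simp
    then have "0 \<le> Re \<kappa> * Re (1 / a)" using \<kappa>(3) by simp
    then have "- Re (\<kappa> / a) \<le> cmod \<kappa> * D" using im Re_eq by linarith
    moreover have "(Im (\<kappa> / a))\<^sup>2 \<le> (cmod \<kappa>)\<^sup>2 * D"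
    proof -
      have "\<bar>Im (\<kappa> / a)\<bar>\<^sup>2 \<le> (cmod (\<kappa> / a))\<^sup>2" by (intro power_mono abs_Im_le_cmod) simp
      also have "\<dots> = (cmod \<kappa>)\<^sup>2 * (1 / cmod a)\<^sup>2" by (simp add: norm_divide power_divide)
      also have "\<dots> \<le> (cmod \<kappa>)\<^sup>2 * D" by (intro mult_left_mono s) simp
      finally show ?thesis by simp
    qed
    moreover have "Re (\<kappa> / a) \<le> 1/2" using kz complex_Re_le_cmod[of "\<kappa> / a"] by linarith
    ultimately show ?thesis using norm_one_minus_le[of "\<kappa> / a"] by (simp add: algebra_simps)
  qed
  then have "cmod (V u) * cmod (1 - \<kappa> / a) \<le> cmod (V u) * (1 + (cmod \<kappa> + (cmod \<kappa>)\<^sup>2) * D)"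
    by (rule mult_left_mono) simp
  also have "\<dots> \<le> cmod (V u) + (cmod \<kappa> + (cmod \<kappa>)\<^sup>2) * D"
  proof -
    have "cmod (V u) * ((cmod \<kappa> + (cmod \<kappa>)\<^sup>2) * D) \<le> 1 * ((cmod \<kappa> + (cmod \<kappa>)\<^sup>2) * D)"
      using h(3) D0 by (intro mult_right_mono) auto
    then show ?thesis by (simp add: distrib_left)
  qed
  finally have up: "cmod (V u * (1 - \<kappa> / a)) \<le> cmod (V u) + (cmod \<kappa> + (cmod \<kappa>)\<^sup>2) * D"
    by (simp add: norm_mult)
  have "cmod (V u1) \<le> cmod (V u) + M2 * D"
    using up err norm_triangle_ineq[of "V u * (1 - \<kappa> / a)" "V u1 - V u * (1 - \<kappa> / a)"]
    by (simp add: M2_def algebra_simps)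
  then show "cmod (V u1) \<le> cmod (V u) + (L / sqrt (Re a) - L / sqrt (Re a1))" using D by linarith
  assume "Re \<kappa> = 0"
  then have "\<bar>Re (\<kappa> / a)\<bar> \<le> cmod \<kappa> * D" using im Re_eq by simp
  then have "1 - cmod \<kappa> * D \<le> cmod (1 - \<kappa> / a)"
    using complex_Re_le_cmod[of "1 - \<kappa> / a"] by simp
  then have "cmod (V u) * (1 - cmod \<kappa> * D) \<le> cmod (V u * (1 - \<kappa> / a))"
    unfolding norm_mult by (rule mult_left_mono) simp
  moreover have "cmod (V u) * (cmod \<kappa> * D) \<le> 1 * (cmod \<kappa> * D)"
    using h(3) D0 by (intro mult_right_mono) auto
  ultimately have "cmod (V u) - cmod \<kappa> * D \<le> cmod (V u * (1 - \<kappa> / a))" by (simp add: right_diff_distrib)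
  then have "cmod (V u) - cmod \<kappa> * D - M1 * D \<le> cmod (V u1)"
    using err norm_diff_ineq[of "V u * (1 - \<kappa> / a)" "V u1 - V u * (1 - \<kappa> / a)"] by simp
  moreover have "cmod \<kappa> * D + M1 * D \<le> M2 * D"
    using D0 by (simp add: M2_def distrib_right)
  ultimately show "cmod (V u) - (L / sqrt (Re a) - L / sqrt (Re a1)) \<le> cmod (V u1)" using D by linarith
qed

sublocale chart_region P b C \<delta> "cmod t_minus + cmod \<kappa>" K R E
proof unfold_locales
  show "chart_bound (cmod t_minus + cmod \<kappa>) K" using bound by (simp add: t_minus_def)
  show "64 * K\<^sup>2 \<le> R" by (rule constants)
  have "open ({x. fst x \<in> sector R} \<inter> {x. cmod (snd x - t_minus) * sqrt (Re (fst x))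
      < (sqrt (Re (fst x)) / 2 - L) * cmod (snd x - t_plus)} :: (complex \<times> complex) set)"
  proof (rule open_Int)
    show "open {x :: complex \<times> complex. fst x \<in> sector R}"
      using open_vimage_fst[OF open_sector, of R] by (simp add: vimage_def)
    show "open {x. cmod (snd x - t_minus) * sqrt (Re (fst x))
      < (sqrt (Re (fst x)) / 2 - L) * cmod (snd x - t_plus)}"
      by (intro open_Collect_less continuous_intros) auto
  qed
  also have "\<dots> = E" by (auto simp: E_def)
  finally show "open E" .
  define \<psi> where "\<psi> = (\<lambda>(a, y). (a, (t_minus - t_plus * (complex_of_real (1/2 - L / sqrt (Re a)) * y)) /
      (1 - complex_of_real (1/2 - L / sqrt (Re a)) * y)))"
  have small: "cmod (complex_of_real (1/2 - L / sqrt (Re a)) * y) < 1/2 - L / sqrt (Re a) \<and>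
      cmod (complex_of_real (1/2 - L / sqrt (Re a)) * y) < 1 \<and> complex_of_real (1/2 - L / sqrt (Re a)) * y \<noteq> 1"
    if "a \<in> sector R" "cmod y < 1" for a y :: complex
  proof -
    have r: "0 < 1/2 - L / sqrt (Re a)" "1/2 - L / sqrt (Re a) < 1"
      using sector_sqrt[OF that(1)] constants(5) by (simp_all add: field_simps add_pos_pos)
    have "cmod (complex_of_real (1/2 - L / sqrt (Re a)) * y) = (1/2 - L / sqrt (Re a)) * cmod y"
      unfolding norm_mult norm_of_real using r by simp
    also have "\<dots> < (1/2 - L / sqrt (Re a)) * 1" using that r by (intro mult_strict_left_mono) auto
    finally have 1: "cmod (complex_of_real (1/2 - L / sqrt (Re a)) * y) < 1/2 - L / sqrt (Re a)" by simp
    then have 2: "cmod (complex_of_real (1/2 - L / sqrt (Re a)) * y) < 1" using r by linarith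
    then have "complex_of_real (1/2 - L / sqrt (Re a)) * y \<noteq> 1" by (metis norm_one less_irrefl)
    with 1 2 show ?thesis by blast
  qed
  have "E = \<psi> ` (sector R \<times> ball 0 1)"
  proof (intro equalityI subsetI)
    fix x assume "x \<in> E"
    then obtain a u where x: "x = (a, u)" "(a, u) \<in> E" by (cases x) auto
    then have h: "a \<in> sector R" "u \<noteq> t_plus" "cmod (V u) < 1/2 - L / sqrt (Re a)" using E_iff by auto
    define \<theta> where "\<theta> = 1/2 - L / sqrt (Re a)"
    have \<theta>: "0 < \<theta>" using h(3) norm_ge_zero[of "V u"] unfolding \<theta>_def by linarith
    have \<theta>y: "complex_of_real \<theta> * (V u / \<theta>) = V u" using \<theta> by simp
    have "\<psi> (a, V u / \<theta>) = (a, u)"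
      unfolding \<psi>_def using V_inverse(2)[OF h(2)] by (simp only: prod.case \<theta>_def[symmetric] \<theta>y)
    moreover have "V u / \<theta> \<in> ball 0 1" using h(3) \<theta> by (simp add: \<theta>_def[symmetric] norm_divide)
    ultimately show "x \<in> \<psi> ` (sector R \<times> ball 0 1)" using h(1) x(1) by (metis imageI SigmaI)
  next
    fix x assume "x \<in> \<psi> ` (sector R \<times> ball 0 1)"
    then obtain a y where ay: "a \<in> sector R" "cmod y < 1" "x = \<psi> (a, y)" by auto
    define v where "v = complex_of_real (1/2 - L / sqrt (Re a)) * y"
    have v: "cmod v < 1/2 - L / sqrt (Re a)" "v \<noteq> 1" using small[OF ay(1,2)] by (auto simp: v_def)
    have "x = (a, (t_minus - t_plus * v) / (1 - v))" unfolding ay(3) \<psi>_def v_def by (simp only: prod.case)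
    then show "x \<in> E" using V_of_inverse[OF v(2)] v(1) ay(1) by (simp add: E_iff)
  qed
  moreover have "connected (\<psi> ` (sector R \<times> ball 0 1))"
  proof (rule connected_continuous_image)
    have "1 - complex_of_real (1/2 - L / sqrt (Re (fst x))) * snd x \<noteq> 0" "sqrt (Re (fst x)) \<noteq> 0"
      if "x \<in> sector R \<times> ball 0 1" for x
      using small[of "fst x" "snd x"] sector_sqrt[of "fst x"] that by auto
    then show "continuous_on (sector R \<times> ball 0 1) \<psi>"
      unfolding \<psi>_def case_prod_beta by (intro continuous_intros) auto
    show "connected (sector R \<times> ball (0::complex) 1)"
      by (intro connected_Times convex_connected convex_sector convex_ball)
  qed
  ultimately show "connected E" by simp
  show "E \<noteq> {}"
  proof -
    define a where "a = complex_of_real (R + 1)"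
    have a: "a \<in> sector R" using constants(6) by (simp add: a_def sector_def)
    have "t_minus \<noteq> t_plus" using t_diff \<kappa>(2) by auto
    moreover have "L / sqrt (Re a) < 1/2" using sector_sqrt[OF a] by (simp add: field_simps)
    ultimately have "(a, t_minus) \<in> E" using a by (simp add: E_iff V_def)
    then show ?thesis by blast
  qed
  show "E \<subseteq> sector R \<times> cball 0 (cmod t_minus + cmod \<kappa>)"
    using E_bounds' by auto
  fix a u a1 u1
  assume h: "(a, u) \<in> E" "a1 \<in> sector R" "Re a + 1/2 \<le> Re a1"
    and u1: "cmod (u1 - u - (u\<^sup>2 + u + b) / a) \<le> K / (cmod a)\<^sup>2"
  have "cmod (V u) < 1/2 - L / sqrt (Re a)" using h(1) E_iff by blast
  then have "cmod (V u1) < 1/2 - L / sqrt (Re a1)" using norm_V_step(1)[OF h(1) u1 h(3)] by linarith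
  then show "(a1, u1) \<in> E" using h(2) V_step(1)[OF h(1) u1] by (simp add: E_iff)
qed

lemma orbit_V_step:
  assumes "p \<in> E"
  shows "cmod (V (orbit_u p (Suc n)) - V (orbit_u p n) * (1 - \<kappa> / orbit_a p n)) \<le> M1 * (1 / cmod (orbit_a p n))\<^sup>2"
  by (rule V_step(2)[OF orbit_E[OF assms] orbit_step(3)[OF assms]])

lemma inverse_orbit_lower_bound:
  assumes "p \<in> E"
  shows "0 < cmod (fst p)" "1 / (cmod (fst p) + 2 * real n) \<le> 1 / cmod (orbit_a p n)"
proof -
  have "fst p \<noteq> 0" using E_bounds(5)[of "fst p" "snd p"] assms by simp
  then show "0 < cmod (fst p)" by simp
  have "orbit_a p n \<noteq> 0" using E_bounds(5)[OF orbit_E[OF assms]] .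
  then show "1 / (cmod (fst p) + 2 * real n) \<le> 1 / cmod (orbit_a p n)"
    using orbit_growth(2)[OF assms, of n] \<open>0 < cmod (fst p)\<close>
    by (intro divide_left_mono mult_pos_pos add_pos_nonneg) auto
qed

lemma orbit_converges:
  assumes \<kappa>_pos: "0 < Re \<kappa>" and p: "p \<in> E"
  shows "orbit_u p \<longlonglongrightarrow> t_minus"
proof -
  define a where "a n = orbit_a p n" for n
  define \<alpha> where "\<alpha> n = 1 / cmod (a n)" for n
  define v where "v n = V (orbit_u p n)" for n
  define \<gamma> where "\<gamma> = Re \<kappa> / 4"
  have sect: "a n \<in> sector R" for n using E_bounds(1)[OF orbit_E[OF p]] by (simp add: a_def)
  have \<alpha>0: "0 \<le> \<alpha> n" for n by (simp add: \<alpha>_def)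
  have \<alpha>_lim: "\<alpha> \<longlonglongrightarrow> 0" unfolding \<alpha>_def a_def by (rule inverse_orbit_tendsto_0[OF p])
  have "(\<lambda>n. cmod \<kappa> * sqrt (\<alpha> n) + (cmod \<kappa>)\<^sup>2 * \<alpha> n) \<longlonglongrightarrow> cmod \<kappa> * sqrt 0 + (cmod \<kappa>)\<^sup>2 * 0"
    by (intro tendsto_intros \<alpha>_lim)
  then have ev1: "\<forall>\<^sub>F n in sequentially. cmod \<kappa> * sqrt (\<alpha> n) + (cmod \<kappa>)\<^sup>2 * \<alpha> n < \<gamma>"
    by (rule order_tendstoD) (use \<kappa>_pos in \<open>simp add: \<gamma>_def\<close>)
  have "(\<lambda>n. cmod \<kappa> * \<alpha> n) \<longlonglongrightarrow> cmod \<kappa> * 0" by (intro tendsto_intros \<alpha>_lim)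
  then have ev2: "\<forall>\<^sub>F n in sequentially. cmod \<kappa> * \<alpha> n < 1/2" by (rule order_tendstoD) simp
  have "(\<lambda>n. cmod (v n)) \<longlonglongrightarrow> 0"
  proof (rule contraction_tendsto_0[where \<gamma> = \<gamma> and \<alpha> = \<alpha> and K = M1 and A = "cmod (fst p)"])
    show "\<forall>\<^sub>F n in sequentially. cmod (v (Suc n)) \<le> (1 - \<gamma> * \<alpha> n) * cmod (v n) + M1 * (\<alpha> n)\<^sup>2"
      using ev1 ev2
    proof eventually_elim
      case (elim n)
      note s = sector_inverse_bounds[OF sect[of n] constants(6)]
      have "\<kappa> / a n = \<kappa> * (1 / a n)" by simp
      then have Re_eq: "Re (\<kappa> / a n) = Re \<kappa> * Re (1 / a n) - Im \<kappa> * Im (1 / a n)"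
        by (simp only: times_complex.sel)
      have "\<bar>Im \<kappa> * Im (1 / a n)\<bar> \<le> cmod \<kappa> * (\<alpha> n * sqrt (\<alpha> n))"
        unfolding abs_mult \<alpha>_def by (intro mult_mono abs_Im_le_cmod s) auto
      moreover have "Re \<kappa> * (\<alpha> n / 2) \<le> Re \<kappa> * Re (1 / a n)"
        using s(4) \<kappa>_pos by (intro mult_left_mono) (auto simp: \<alpha>_def)
      ultimately have re: "2 * \<gamma> * \<alpha> n - cmod \<kappa> * sqrt (\<alpha> n) * \<alpha> n \<le> Re (\<kappa> / a n)"
        unfolding Re_eq \<gamma>_def by (simp add: mult_ac)
      have n: "cmod (\<kappa> / a n) = cmod \<kappa> * \<alpha> n" by (simp add: \<alpha>_def norm_divide)
      have "\<bar>Im (\<kappa> / a n)\<bar>\<^sup>2 \<le> (cmod (\<kappa> / a n))\<^sup>2" by (intro power_mono abs_Im_le_cmod) simp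
      then have im: "(Im (\<kappa> / a n))\<^sup>2 \<le> (cmod \<kappa>)\<^sup>2 * \<alpha> n * \<alpha> n"
        unfolding n by (simp add: power2_eq_square mult_ac)
      have "Re (\<kappa> / a n) \<le> 1/2" using elim(2) n complex_Re_le_cmod[of "\<kappa> / a n"] by linarith
      then have "cmod (1 - \<kappa> / a n) \<le> 1 - Re (\<kappa> / a n) + (Im (\<kappa> / a n))\<^sup>2" by (rule norm_one_minus_le)
      also have "\<dots> \<le> 1 - 2 * \<gamma> * \<alpha> n + (cmod \<kappa> * sqrt (\<alpha> n) + (cmod \<kappa>)\<^sup>2 * \<alpha> n) * \<alpha> n"
        using re im by (simp add: distrib_right)
      also have "\<dots> \<le> 1 - 2 * \<gamma> * \<alpha> n + \<gamma> * \<alpha> n"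
        using elim(1) \<alpha>0[of n] by (intro add_left_mono mult_right_mono) auto
      finally have "cmod (1 - \<kappa> / a n) \<le> 1 - \<gamma> * \<alpha> n" by simp
      then have "cmod (v n * (1 - \<kappa> / a n)) \<le> (1 - \<gamma> * \<alpha> n) * cmod (v n)"
        unfolding norm_mult by (subst mult.commute) (rule mult_right_mono, auto)
      moreover have "cmod (v (Suc n) - v n * (1 - \<kappa> / a n)) \<le> M1 * (\<alpha> n)\<^sup>2"
        using orbit_V_step[OF p, of n] by (simp add: v_def a_def \<alpha>_def)
      ultimately show ?case
        using norm_triangle_ineq[of "v n * (1 - \<kappa> / a n)" "v (Suc n) - v n * (1 - \<kappa> / a n)"] by simp
    qed
    show "1 / (cmod (fst p) + 2 * real n) \<le> \<alpha> n" for n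
      using inverse_orbit_lower_bound(2)[OF p] by (simp add: \<alpha>_def a_def)
    show "0 < cmod (fst p)" by (rule inverse_orbit_lower_bound(1)[OF p])
  qed (use \<kappa>_pos \<alpha>_lim in \<open>auto simp: \<gamma>_def\<close>)
  then have v0: "v \<longlonglongrightarrow> 0" by (rule tendsto_norm_zero_cancel)
  have "(\<lambda>n. (t_minus - t_plus * v n) / (1 - v n)) \<longlonglongrightarrow> (t_minus - t_plus * 0) / (1 - 0)"
    by (intro tendsto_intros v0) simp
  moreover have "(t_minus - t_plus * v n) / (1 - v n) = orbit_u p n" for n
    using V_inverse(2)[of "orbit_u p n"] E_bounds'(2)[OF orbit_E[OF p, of n]] by (simp add: v_def)
  ultimately show ?thesis by simp
qed

text \<open>For \<open>Re \<kappa> = 0\<close> the modulus of \<open>V\<close> is preserved up to summable errors, so it stays away from 0.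
  If \<open>V\<close> had a limit \<open>v'\<close>, its increments would be close to \<open>- \<kappa> v' / a\<close>; divided by \<open>- \<kappa> v'\<close> they
  eventually have real part at least \<open>1 / (4 \<bar>a\<bar>)\<close>, whose sum diverges.\<close>

lemma exists_nonconvergent_orbit:
  assumes "Re \<kappa> = 0"
  shows "\<exists>p\<in>E. \<not> convergent (orbit_u p)"
proof -
  define A where "A = R + (8 * L)\<^sup>2 + 1"
  define u0 where "u0 = (t_minus - t_plus * (1/4)) / (1 - 1/4)"
  define p where "p = (complex_of_real A, u0)"
  have u0: "u0 \<noteq> t_plus" "V u0 = 1/4" unfolding u0_def by (rule V_of_inverse; simp)+
  have A: "R < A" "0 < A" "(8 * L)\<^sup>2 < A" 
    using constants(6) zero_le_power2[of "8 * L"] unfolding A_def by linarith+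
  then have "8 * L < sqrt A" by (intro real_less_rsqrt)
  then have LA: "L / sqrt A < 1/8" using constants(5) A by (simp add: field_simps)
  have sec: "complex_of_real A \<in> sector R" using A by (simp add: sector_def)
  have "cmod (V u0) = 1/4" unfolding u0(2) by simp
  then have p: "p \<in> E" using u0(1) LA sec by (simp add: p_def E_iff)
  define a where "a n = orbit_a p n" for n
  define v where "v n = V (orbit_u p n)" for n
  have lower: "1/8 \<le> cmod (v n) - L / sqrt (Re (a n))" for n
  proof (induction n)
    case 0
    show ?case using \<open>cmod (V u0) = 1/4\<close> LA by (simp add: v_def a_def p_def)
  next
    case (Suc n)
    have "cmod (v n) - (L / sqrt (Re (a n)) - L / sqrt (Re (a (Suc n)))) \<le> cmod (v (Suc n))"
      unfolding v_def a_def
      by (rule norm_V_step(2)[OF orbit_E[OF p] orbit_step(3)[OF p] orbit_step(1)[OF p] assms])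
    then show ?case using Suc by linarith
  qed
  have "\<not> convergent (orbit_u p)"
  proof
    assume "convergent (orbit_u p)"
    then obtain l where l: "orbit_u p \<longlonglongrightarrow> l" by (auto simp: convergent_def)
    have "2/3 * cmod \<kappa> \<le> cmod (orbit_u p n - t_plus)" for n
    proof -
      have "cmod (orbit_u p n - t_minus - (orbit_u p n - t_plus)) = cmod \<kappa>" by (simp add: t_plus_eq)
      then have "cmod \<kappa> \<le> cmod (orbit_u p n - t_minus) + cmod (orbit_u p n - t_plus)"
        using norm_triangle_ineq4[of "orbit_u p n - t_minus" "orbit_u p n - t_plus"] by simp
      then show ?thesis using E_bounds'(4)[OF orbit_E[OF p, of n]] by linarith
    qed
    then have "2/3 * cmod \<kappa> \<le> cmod (l - t_plus)"
      by (intro LIMSEQ_le_const[OF tendsto_norm[OF tendsto_diff[OF l tendsto_const]]]) auto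
    then have "l - t_plus \<noteq> 0" using constants(2) by auto
    then have "(\<lambda>n. V (orbit_u p n)) \<longlonglongrightarrow> V l"
      unfolding V_def by (intro tendsto_intros l)
    then have v_lim: "v \<longlonglongrightarrow> V l" by (simp add: v_def[abs_def])
    define v' where "v' = V l"
    have "1/8 \<le> cmod v'"
      unfolding v'_def
    proof (rule LIMSEQ_le_const[OF tendsto_norm[OF v_lim]])
      have "1/8 \<le> cmod (v n)" for n
      proof -
        have "a n \<in> sector R" using E_bounds(1)[OF orbit_E[OF p]] by (simp add: a_def)
        then have "0 < L / sqrt (Re (a n))" using sector_sqrt constants(5) by simp
        then show ?thesis using lower[of n] by linarith
      qed
      then show "\<exists>N. \<forall>n\<ge>N. 1/8 \<le> cmod (v n)" by blast
    qed
    then have v'0: "v' \<noteq> 0" by auto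
    define \<alpha> where "\<alpha> n = 1 / cmod (a n)" for n
    define c where "c = M1 / (cmod \<kappa> * cmod v')"
    have \<alpha>_lim: "\<alpha> \<longlonglongrightarrow> 0" unfolding \<alpha>_def a_def by (rule inverse_orbit_tendsto_0[OF p])
    have "(\<lambda>n. cmod (v n / v' - 1) + c * \<alpha> n) \<longlonglongrightarrow> cmod (v' / v' - 1) + c * 0"
      by (intro tendsto_intros v_lim[folded v'_def] \<alpha>_lim v'0)
    then have "\<forall>\<^sub>F n in sequentially. cmod (v n / v' - 1) + c * \<alpha> n < 1/4"
      by (rule order_tendstoD) (use v'0 in simp)
    then obtain N where N: "\<forall>n\<ge>N. cmod (v n / v' - 1) + c * \<alpha> n < 1/4"
      unfolding eventually_sequentially by blast
    define y where "y n = Re (v n / (- \<kappa> * v'))" for n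
    have y_step: "y n + 1/4 * \<alpha> n \<le> y (Suc n)" if n: "N \<le> n" for n
    proof -
      define e where "e = v (Suc n) - v n * (1 - \<kappa> / a n)"
      have e: "cmod e \<le> M1 * (\<alpha> n)\<^sup>2"
        using orbit_V_step[OF p, of n] by (simp add: e_def v_def a_def \<alpha>_def)
      have a_sec: "a n \<in> sector R" using E_bounds(1)[OF orbit_E[OF p]] by (simp add: a_def)
      have \<alpha>0: "0 \<le> \<alpha> n" by (simp add: \<alpha>_def)
      have "v (Suc n) / (- \<kappa> * v') = v n / (- \<kappa> * v') + (1 / a n) * (v n / v') + e / (- \<kappa> * v')"
        using v'0 \<kappa>(2) by (simp add: e_def field_simps)
      also have "(1 / a n) * (v n / v') = 1 / a n + (1 / a n) * (v n / v' - 1)" by (simp add: right_diff_distrib)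
      finally have "y (Suc n) = y n + Re (1 / a n) + Re ((1 / a n) * (v n / v' - 1)) + Re (e / (- \<kappa> * v'))"
        unfolding y_def by (simp only: plus_complex.sel add.assoc)
      moreover have "1/2 * \<alpha> n \<le> Re (1 / a n)"
        using sector_inverse_bounds(4)[OF a_sec constants(6)] by (simp add: \<alpha>_def)
      moreover have "- (\<alpha> n * cmod (v n / v' - 1)) \<le> Re ((1 / a n) * (v n / v' - 1))"
      proof -
        have "cmod ((1 / a n) * (v n / v' - 1)) = \<alpha> n * cmod (v n / v' - 1)"
          unfolding norm_mult by (simp add: \<alpha>_def norm_divide)
        then show ?thesis using abs_Re_le_cmod[of "(1 / a n) * (v n / v' - 1)"] by linarith
      qed
      moreover have "- (\<alpha> n * (c * \<alpha> n)) \<le> Re (e / (- \<kappa> * v'))"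
      proof -
        have "cmod (e / (- \<kappa> * v')) = cmod e / (cmod \<kappa> * cmod v')" by (simp add: norm_divide norm_mult)
        also have "\<dots> \<le> M1 * (\<alpha> n)\<^sup>2 / (cmod \<kappa> * cmod v')" by (rule divide_right_mono[OF e]) simp
        also have "\<dots> = \<alpha> n * (c * \<alpha> n)" by (simp add: c_def power2_eq_square)
        finally show ?thesis using abs_Re_le_cmod[of "e / (- \<kappa> * v')"] by linarith
      qed
      moreover have "\<alpha> n * (cmod (v n / v' - 1) + c * \<alpha> n) \<le> \<alpha> n * (1/4)"
        by (rule mult_left_mono[OF _ \<alpha>0]) (use N n in auto)
      ultimately show ?thesis by (simp add: distrib_left)
    qed
    have "filterlim (\<lambda>n. y (n + N)) at_top sequentially"
    proof (rule diverges_of_harmonic_increments[where c = "1/4" and A = "cmod (fst p) + 2 * real N"])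
      fix n
      define D where "D = cmod (fst p) + 2 * real N + 2 * real n"
      have "D = cmod (fst p) + 2 * real (n + N)" by (simp add: D_def)
      then have "1 / D \<le> \<alpha> (n + N)"
        using inverse_orbit_lower_bound(2)[OF p, of "n + N"] by (simp only: \<alpha>_def a_def)
      moreover have "1/4 / D = 1/4 * (1 / D)" by simp
      ultimately have "y (n + N) + 1/4 / D \<le> y (Suc n + N)"
        using y_step[of "n + N"] by simp
      then show "y (n + N) + 1/4 / (cmod (fst p) + 2 * real N + 2 * real n) \<le> y (Suc n + N)"
        by (simp only: D_def)
    qed (use inverse_orbit_lower_bound(1)[OF p] in \<open>auto intro: add_pos_nonneg\<close>)
    then have inf: "filterlim (\<lambda>n. y (n + N)) at_infinity sequentially"
      by (rule filterlim_at_top_imp_at_infinity)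
    have "- \<kappa> * v' \<noteq> 0" using v'0 \<kappa>(2) by simp
    then have "y \<longlonglongrightarrow> Re (v' / (- \<kappa> * v'))"
      unfolding y_def by (intro tendsto_Re tendsto_divide v_lim[folded v'_def] tendsto_const)
    then have "(\<lambda>n. y (n + N)) \<longlonglongrightarrow> Re (v' / (- \<kappa> * v'))" by (rule LIMSEQ_ignore_initial_segment)
    from not_tendsto_and_filterlim_at_infinity[OF sequentially_bot this inf] show False .
  qed
  then show ?thesis using p by blast
qed

end

section \<open>The invariant region for a double fixed point\<close>

text \<open>For \<open>b = 1/4\<close> the vector field is \<open>(u + 1/2)\<^sup>2\<close>, and \<open>Q\<close> is its time coordinate: \<open>Q\<close> increases by
  \<open>1 / a\<close>, so its real part tends to infinity like a logarithm. The condition \<open>\<bar>Q\<bar>\<^sup>2 < \<epsilon> Re a\<close> keeps the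
  error term \<open>Q\<^sup>2 / a\<^sup>2\<close> small against \<open>1 / a\<close>.\<close>

locale double_root_germ = parabolic_germ +
  fixes K :: real
  assumes b: "b = 1/4" and bound: "chart_bound (3/2) K"
begin

definition "\<epsilon> = 1 / (16 * K)"
definition "R = 64 * K\<^sup>2 + 100 / \<epsilon>"
definition "Q u = - 1 / (u + 1/2)" for u :: complex
text \<open>The conditions \<open>Re Q > 1\<close> and \<open>\<bar>Q\<bar>\<^sup>2 < \<epsilon> Re a\<close> with denominators cleared. They exclude
  \<open>u = - 1/2\<close>.\<close>

definition "E = {(a, u). a \<in> sector R \<and> (cmod (u + 1/2))\<^sup>2 < - Re (u + 1/2) \<and>
  1 < \<epsilon> * Re a * (cmod (u + 1/2))\<^sup>2}"

lemma constants: "1 \<le> K" "0 < \<epsilon>" "K * \<epsilon> = 1/16" "\<epsilon> \<le> 1" "64 * K\<^sup>2 \<le> R" "100 / \<epsilon> \<le> R" "100 \<le> R"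
proof -
  show K: "1 \<le> K" using bound by (simp add: chart_bound_def)
  show \<epsilon>: "0 < \<epsilon>" "K * \<epsilon> = 1/16" "\<epsilon> \<le> 1" using K by (simp_all add: \<epsilon>_def)
  show "64 * K\<^sup>2 \<le> R" "100 / \<epsilon> \<le> R" using \<epsilon> by (simp_all add: R_def)
  moreover have "100 \<le> 100 / \<epsilon>" using \<epsilon> by (simp add: field_simps)
  ultimately show "100 \<le> R" by simp
qed

lemma Q_inverse: "u + 1/2 \<noteq> 0 \<Longrightarrow> u = - 1/2 - 1 / Q u" "q \<noteq> 0 \<Longrightarrow> Q (- 1/2 - 1 / q) = q"
  by (simp_all add: Q_def field_simps)

lemma E_iff:
  "(a, u) \<in> E \<longleftrightarrow> a \<in> sector R \<and> u + 1/2 \<noteq> 0 \<and> 1 < Re (Q u) \<and> (cmod (Q u))\<^sup>2 < \<epsilon> * Re a"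
proof (cases "u + 1/2 = 0")
  case False
  define q where "q = u + 1/2"
  have q: "0 < (cmod q)\<^sup>2" using False by (simp add: q_def)
  have ReQ: "Re (Q u) = - Re q / (cmod q)\<^sup>2"
    by (simp add: Q_def q_def[symmetric] Re_divide cmod_power2)
  have "1 < Re (Q u) \<longleftrightarrow> (cmod q)\<^sup>2 < - Re q"
    unfolding ReQ by (simp only: pos_less_divide_eq[OF q] mult_1)
  moreover have "(cmod (Q u))\<^sup>2 < \<epsilon> * Re a \<longleftrightarrow> 1 < \<epsilon> * Re a * (cmod q)\<^sup>2"
    using q by (simp add: Q_def q_def[symmetric] norm_divide power_divide divide_less_eq)
  ultimately show ?thesis using False by (simp add: E_def q_def)
qed (simp add: E_def)

lemma Q_step:
  assumes E: "(a, u) \<in> E" and u1: "cmod (u1 - u - (u\<^sup>2 + u + b) / a) \<le> K / (cmod a)\<^sup>2"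
  shows "u1 + 1/2 \<noteq> 0" "cmod (Q u1 - Q u - 1 / a) \<le> 1 / (4 * cmod a)"
  \<comment> \<open>The number \<open>1 - eta\<close> is the factor \<open>Q u / Q u1\<close>.\<close>
proof -
  have h: "a \<in> sector R" "u + 1/2 \<noteq> 0" "1 < Re (Q u)" "(cmod (Q u))\<^sup>2 < \<epsilon> * Re a"
    using E E_iff by auto
  have R0: "0 \<le> R" using constants(7) by simp
  note s = sector_bounds[OF h(1) R0]
  define z where "z = 1 / a"
  define e where "e = u1 - u - (u\<^sup>2 + u + b) / a"
  define q where "q = Q u"
  define k where "k = cmod z"
  have k: "0 < k" "k * R \<le> 1" "k \<le> 1/100"
  proof -
    show k0: "0 < k" using s by (simp add: k_def z_def)
    have "cmod z * R \<le> cmod z * cmod a" using s by (intro mult_left_mono) auto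
    then show "k * R \<le> 1" using s by (simp add: k_def z_def norm_divide)
    moreover have "k * 100 \<le> k * R" using k0 constants(7) by simp
    ultimately show "k \<le> 1/100" by simp
  qed
  have q1: "1 < cmod q" using h(3) complex_Re_le_cmod[of "Q u"] by (simp add: q_def)
  have q0: "q \<noteq> 0" using q1 by auto
  have qk: "(cmod q)\<^sup>2 * k \<le> \<epsilon>"
  proof -
    have "\<epsilon> * Re a \<le> \<epsilon> * cmod a" by (rule mult_left_mono[OF s(3)]) (use constants(2) in simp)
    then have "(cmod q)\<^sup>2 \<le> \<epsilon> * cmod a" using h(4) unfolding q_def by linarith
    then have "(cmod q)\<^sup>2 * k \<le> \<epsilon> * cmod a * k" using k by (intro mult_right_mono) auto
    then show ?thesis using s by (simp add: k_def z_def norm_divide)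
  qed
  have e: "cmod e \<le> K * k\<^sup>2" using u1 by (simp add: e_def k_def z_def norm_divide power_divide)
  define eta where "eta = z / q + e * q"
  have "u + 1/2 = - 1 / q" using h(2) by (simp add: q_def Q_def)
  moreover have "u\<^sup>2 + u + b = (u + 1/2)\<^sup>2" by (simp add: b power2_eq_square algebra_simps)
  ultimately have fac: "u1 + 1/2 = - (1 - eta) / q"
  proof -
    assume u: "u + 1/2 = - 1 / q" and sq: "u\<^sup>2 + u + b = (u + 1/2)\<^sup>2"
    have "u1 + 1/2 = (u + 1/2) + z * (u + 1/2)\<^sup>2 + e" by (simp add: e_def sq z_def)
    also have "\<dots> = - (1 - eta) / q" unfolding u using q0 by (simp add: eta_def field_simps power2_eq_square)
    finally show ?thesis .
  qed
  have eq2: "cmod (e * q\<^sup>2) \<le> k / 16"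
  proof -
    have "cmod (e * q\<^sup>2) \<le> (K * k\<^sup>2) * (cmod q)\<^sup>2"
      unfolding norm_mult norm_power by (rule mult_right_mono[OF e]) simp
    also have "\<dots> = K * k * ((cmod q)\<^sup>2 * k)" by (simp add: power2_eq_square mult_ac)
    also have "\<dots> \<le> K * k * \<epsilon>" using constants(1) k by (intro mult_left_mono qk) auto
    also have "\<dots> = k / 16" using constants(3) by (simp add: mult_ac)
    finally show ?thesis .
  qed
  have eta: "cmod eta \<le> 2 * k"
  proof -
    have "cmod (z / q) \<le> k" using q1 k by (simp add: norm_divide k_def[symmetric] divide_le_eq mult_le_cancel_left1)
    moreover have "cmod (e * q) \<le> cmod (e * q\<^sup>2)"
      using q1 by (simp add: norm_mult norm_power power2_eq_square mult_left_mono mult_le_cancel_left1)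
    ultimately show ?thesis
      unfolding eta_def using norm_triangle_ineq[of "z / q" "e * q"] eq2 k by linarith
  qed
  have one: "1/2 \<le> cmod (1 - eta)" using eta k norm_triangle_ineq2[of 1 eta] by simp
  then have ne: "1 - eta \<noteq> 0" by auto
  show "u1 + 1/2 \<noteq> 0" unfolding fac using ne q0 by simp
  have "Q u1 = q / (1 - eta)" unfolding Q_def fac using ne q0 by (simp add: field_simps)
  then have "Q u1 - Q u - 1 / a = (e * q\<^sup>2 + z * eta) / (1 - eta)"
  proof -
    assume "Q u1 = q / (1 - eta)"
    then have "Q u1 - Q u - 1 / a = (q * eta - z + z * eta) / (1 - eta)"
      using ne by (simp add: q_def[symmetric] z_def[symmetric] field_simps)
    also have "q * eta - z = e * q\<^sup>2" using q0 by (simp add: eta_def field_simps power2_eq_square)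
    finally show ?thesis .
  qed
  also have "cmod \<dots> \<le> cmod (e * q\<^sup>2 + z * eta) / (1/2)"
    unfolding norm_divide by (rule divide_left_mono[OF one]) (use one in auto)
  also have "\<dots> \<le> 1 / (4 * cmod a)"
  proof -
    have "cmod (z * eta) \<le> k * (2 * k)"
      unfolding norm_mult k_def[symmetric] using eta k by (intro mult_left_mono) auto
    also have "\<dots> \<le> k * (1/50)" using k by (intro mult_left_mono) auto
    finally have "cmod (e * q\<^sup>2 + z * eta) \<le> k / 16 + k / 50"
      using eq2 norm_triangle_ineq[of "e * q\<^sup>2" "z * eta"] by linarith
    then have "cmod (e * q\<^sup>2 + z * eta) / (1/2) \<le> k / 4" using k by simp
    then show ?thesis by (simp add: k_def z_def norm_divide)
  qed
  finally show "cmod (Q u1 - Q u - 1 / a) \<le> 1 / (4 * cmod a)" .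
qed

lemma Re_Q_step:
  assumes E: "(a, u) \<in> E" and u1: "cmod (u1 - u - (u\<^sup>2 + u + b) / a) \<le> K / (cmod a)\<^sup>2"
  shows "Re (Q u) + 1/4 * (1 / cmod a) \<le> Re (Q u1)"
proof -
  have a: "a \<in> sector R" using E E_iff by auto
  have "1 / (2 * cmod a) \<le> Re (1 / a)" by (rule sector_inverse_bounds(4)[OF a]) (use constants(7) in simp)
  moreover have "- (1 / (4 * cmod a)) \<le> Re (Q u1 - Q u - 1 / a)"
    using Q_step(2)[OF E u1] abs_Re_le_cmod[of "Q u1 - Q u - 1 / a"] by linarith
  moreover have "1 / (2 * cmod a) = 2 * (1/4 * (1 / cmod a))" "1 / (4 * cmod a) = 1/4 * (1 / cmod a)" by simp_all
  moreover have "Re (Q u1 - Q u - 1 / a) = Re (Q u1) - Re (Q u) - Re (1 / a)" by simp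
  ultimately show ?thesis by linarith
qed

lemma norm_Q_step:
  assumes E: "(a, u) \<in> E" and u1: "cmod (u1 - u - (u\<^sup>2 + u + b) / a) \<le> K / (cmod a)\<^sup>2"
    and a1: "Re a + 1/2 \<le> Re a1"
  shows "(cmod (Q u1))\<^sup>2 < \<epsilon> * Re a1"
proof -
  have h: "a \<in> sector R" "(cmod (Q u))\<^sup>2 < \<epsilon> * Re a" using E E_iff by auto
  have R0: "0 \<le> R" using constants(7) by simp
  note s = sector_bounds[OF h(1) R0]
  define k where "k = 1 / cmod a"
  define x where "x = cmod (Q u)"
  have k: "0 < k" "k * 100 \<le> \<epsilon>"
  proof -
    show "0 < k" using s by (simp add: k_def)
    have "100 / \<epsilon> \<le> cmod a" using constants(6) s by simp
    then show "k * 100 \<le> \<epsilon>" using constants(2) s by (simp add: k_def field_simps)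
  qed
  have "cmod (Q u1 - Q u) \<le> cmod (1 / a) + cmod (Q u1 - Q u - 1 / a)"
    using norm_triangle_ineq[of "1 / a" "Q u1 - Q u - 1 / a"] by simp
  also have "\<dots> \<le> 2 * k"
  proof -
    have "cmod (1 / a) = k" "1 / (4 * cmod a) = k / 4" by (simp_all add: k_def norm_divide)
    then show ?thesis using Q_step(2)[OF E u1] k(1) by linarith
  qed
  finally have "cmod (Q u1) \<le> x + 2 * k"
    using norm_triangle_ineq[of "Q u" "Q u1 - Q u"] by (simp add: x_def)
  then have "(cmod (Q u1))\<^sup>2 \<le> (x + 2 * k)\<^sup>2" by (rule power_mono) simp
  also have "\<dots> = x\<^sup>2 + 4 * (x * k) + 4 * k\<^sup>2" by (simp add: power2_eq_square algebra_simps)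
  finally have 1: "(cmod (Q u1))\<^sup>2 \<le> x\<^sup>2 + 4 * (x * k) + 4 * k\<^sup>2" .
  have xk: "x * k \<le> \<epsilon> / 10"
  proof (rule power2_le_imp_le)
    have "\<epsilon> * Re a \<le> \<epsilon> * cmod a" by (rule mult_left_mono[OF s(3)]) (use constants(2) in simp)
    then have "x\<^sup>2 \<le> \<epsilon> * cmod a" using h(2) unfolding x_def by linarith
    then have "x\<^sup>2 * k\<^sup>2 \<le> \<epsilon> * cmod a * k\<^sup>2" by (rule mult_right_mono) simp
    also have "\<dots> = \<epsilon> * k" using s by (simp add: k_def power2_eq_square)
    also have "\<dots> \<le> \<epsilon> * (\<epsilon> / 100)" using k(2) constants(2) by (intro mult_left_mono) auto
    finally show "(x * k)\<^sup>2 \<le> (\<epsilon> / 10)\<^sup>2" by (simp add: power_mult_distrib power_divide power2_eq_square mult_ac)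
  qed (use constants(2) in simp)
  have "k * k \<le> 1 * k" using k constants(4) by (intro mult_right_mono) auto
  then have kk: "k\<^sup>2 \<le> \<epsilon> / 100" using k(2) by (simp add: power2_eq_square)
  have "\<epsilon> * Re a + \<epsilon> / 2 \<le> \<epsilon> * Re a1" using mult_left_mono[OF a1, of \<epsilon>] constants(2) by (simp add: distrib_left)
  then show ?thesis using 1 xk kk h(2) constants(2) unfolding x_def by linarith
qed

sublocale chart_region P b C \<delta> "3/2" K R E
proof unfold_locales
  show "chart_bound (3/2) K" by (rule bound)
  show "64 * K\<^sup>2 \<le> R" by (rule constants)
  have "open ({x. fst x \<in> sector R} \<inter> ({x. (cmod (snd x + 1/2))\<^sup>2 < - Re (snd x + 1/2)} \<inter>
     {x. 1 < \<epsilon> * Re (fst x) * (cmod (snd x + 1/2))\<^sup>2}) :: (complex \<times> complex) set)"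
  proof (intro open_Int)
    show "open {x :: complex \<times> complex. fst x \<in> sector R}"
      using open_vimage_fst[OF open_sector, of R] by (simp add: vimage_def)
  qed (intro open_Collect_less continuous_intros; simp)+
  also have "\<dots> = E" by (auto simp: E_def)
  finally show "open E" .
  define E' where "E' = {(a, q). a \<in> sector R \<and> 1 < Re q \<and> (cmod q)\<^sup>2 < \<epsilon> * Re a}"
  define \<psi> where "\<psi> = (\<lambda>(a :: complex, q :: complex). (a, - 1/2 - 1 / q))"
  have "convex E'"
    unfolding convex_def
  proof (intro ballI allI impI)
    fix x y and s t :: real
    assume h: "x \<in> E'" "y \<in> E'" "0 \<le> s" "0 \<le> t" "s + t = 1"
    obtain a q a' q' where xy: "x = (a, q)" "y = (a', q')" by (cases x, cases y) auto
    have x: "a \<in> sector R" "1 < Re q" "(cmod q)\<^sup>2 < \<epsilon> * Re a"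
      and y: "a' \<in> sector R" "1 < Re q'" "(cmod q')\<^sup>2 < \<epsilon> * Re a'"
      using h(1,2) by (auto simp: E'_def xy)
    have "s *\<^sub>R a + t *\<^sub>R a' \<in> sector R"
      using convex_sector[of R] x(1) y(1) h(3-5) unfolding convex_def by blast
    moreover have "1 < Re (s *\<^sub>R q + t *\<^sub>R q')"
    proof -
      have "convex {q. 1 < Re q}" by (rule convex_halfspace_Re_gt)
      then have "s *\<^sub>R q + t *\<^sub>R q' \<in> {q. 1 < Re q}"
        using x(2) y(2) h(3-5) unfolding convex_def by blast
      then show ?thesis by simp
    qed
    moreover have "(cmod (s *\<^sub>R q + t *\<^sub>R q'))\<^sup>2 < \<epsilon> * Re (s *\<^sub>R a + t *\<^sub>R a')"
    proof -
      have "cmod (s *\<^sub>R q + t *\<^sub>R q') \<le> s * cmod q + t * cmod q'"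
        using norm_triangle_ineq[of "s *\<^sub>R q" "t *\<^sub>R q'"] h(3,4) by simp
      then have "(cmod (s *\<^sub>R q + t *\<^sub>R q'))\<^sup>2 \<le> (s * cmod q + t * cmod q')\<^sup>2" by (rule power_mono) simp
      also have "\<dots> < s * (\<epsilon> * Re a) + t * (\<epsilon> * Re a')"
        by (rule convex_combination_square_less[OF x(3) y(3) h(3-5)])
      finally show ?thesis by (simp add: algebra_simps)
    qed
    ultimately show "s *\<^sub>R x + t *\<^sub>R y \<in> E'" by (simp add: E'_def xy)
  qed
  moreover have "continuous_on E' \<psi>"
    unfolding \<psi>_def case_prod_beta by (intro continuous_intros) (auto simp: E'_def)
  ultimately have "connected (\<psi> ` E')"
    by (intro connected_continuous_image convex_connected)
  also have "\<psi> ` E' = E"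
  proof (intro equalityI subsetI)
    fix x assume "x \<in> \<psi> ` E'"
    then obtain a q where aq: "a \<in> sector R" "1 < Re q" "(cmod q)\<^sup>2 < \<epsilon> * Re a" "x = (a, - 1/2 - 1 / q)"
      by (auto simp: \<psi>_def E'_def)
    have "q \<noteq> 0" using aq(2) by auto
    then show "x \<in> E" using aq Q_inverse(2) by (simp add: E_iff)
  next
    fix x assume "x \<in> E"
    then obtain a u where x: "x = (a, u)" "(a, u) \<in> E" by (cases x) auto
    then have h: "a \<in> sector R" "u + 1/2 \<noteq> 0" "1 < Re (Q u)" "(cmod (Q u))\<^sup>2 < \<epsilon> * Re a"
      using E_iff by auto
    then have "(a, Q u) \<in> E'" "x = \<psi> (a, Q u)"
      using Q_inverse(1)[OF h(2)] by (simp_all add: E'_def \<psi>_def x(1))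
    then show "x \<in> \<psi> ` E'" by blast
  qed
  finally show "connected E" .
  show "E \<noteq> {}"
  proof -
    define a where "a = complex_of_real (R + 1)"
    have a: "a \<in> sector R" using constants(7) by (simp add: a_def sector_def)
    have "100 < \<epsilon> * Re a" using constants(2,6) by (simp add: a_def field_simps)
    then have "(a, - 1/2 - 1 / 2) \<in> E" using a Q_inverse(2)[of 2] by (simp add: E_iff)
    then show ?thesis by blast
  qed
  show "E \<subseteq> sector R \<times> cball 0 (3/2)"
  proof
    fix x assume "x \<in> E"
    then obtain a u where x: "x = (a, u)" "(a, u) \<in> E" by (cases x) auto
    then have h: "a \<in> sector R" "u + 1/2 \<noteq> 0" "1 < Re (Q u)" using E_iff by auto
    have "1 \<le> cmod (Q u)" using h(3) complex_Re_le_cmod[of "Q u"] by simp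
    then have "cmod (1 / Q u) \<le> 1" by (simp add: norm_divide divide_le_eq)
    moreover have "cmod u = cmod (- 1/2 - 1 / Q u)" by (rule arg_cong[OF Q_inverse(1)[OF h(2)]])
    moreover have "cmod (- 1/2 - 1 / Q u) \<le> cmod (- 1/2) + cmod (1 / Q u)" by (rule norm_triangle_ineq4)
    moreover have "cmod (- 1/2) = 1/2" by simp
    ultimately have "cmod u \<le> 3/2" by linarith
    then show "x \<in> sector R \<times> cball 0 (3/2)" using h(1) x(1) by simp
  qed
  fix a u a1 u1
  assume h: "(a, u) \<in> E" "a1 \<in> sector R" "Re a + 1/2 \<le> Re a1"
    and u1: "cmod (u1 - u - (u\<^sup>2 + u + b) / a) \<le> K / (cmod a)\<^sup>2"
  have "1 < Re (Q u)" using h(1) E_iff by blast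
  moreover have "0 \<le> 1/4 * (1 / cmod a)" by simp
  ultimately have "1 < Re (Q u1)" using Re_Q_step[OF h(1) u1] by linarith
  then show "(a1, u1) \<in> E"
    using h(2) Q_step(1)[OF h(1) u1] norm_Q_step[OF h(1) u1 h(3)] by (simp add: E_iff)
qed

lemma orbit_converges:
  assumes p: "p \<in> E"
  shows "orbit_u p \<longlonglongrightarrow> - 1/2"
proof -
  define y where "y n = Re (Q (orbit_u p n))" for n
  have fp: "0 < cmod (fst p)" using E_bounds(5)[of "fst p" "snd p"] p by simp
  have "filterlim y at_top sequentially"
  proof (rule diverges_of_harmonic_increments[OF _ _ fp])
    fix n
    define D where "D = cmod (fst p) + 2 * real n"
    have a: "0 < cmod (orbit_a p n)" using E_bounds(5)[OF orbit_E[OF p]] by simp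
    have D: "cmod (orbit_a p n) \<le> D" using orbit_growth(2)[OF p] by (simp add: D_def)
    then have "1 / D \<le> 1 / cmod (orbit_a p n)" using a less_le_trans[OF a D] by (intro divide_left_mono mult_pos_pos) auto
    moreover have "1/4 / D = 1/4 * (1 / D)" by simp
    moreover have "y n + 1/4 * (1 / cmod (orbit_a p n)) \<le> y (Suc n)"
      unfolding y_def by (rule Re_Q_step[OF orbit_E[OF p] orbit_step(3)[OF p]])
    ultimately show "y n + 1/4 / (cmod (fst p) + 2 * real n) \<le> y (Suc n)"
      unfolding D_def[symmetric] by linarith
  qed simp
  then have "filterlim (\<lambda>n. cmod (Q (orbit_u p n))) at_top sequentially"
    by (rule filterlim_at_top_mono) (auto simp: y_def complex_Re_le_cmod)
  then have "filterlim (\<lambda>n. Q (orbit_u p n)) at_infinity sequentially"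
    by (simp add: filterlim_at_infinity_conv_norm_at_top)
  then have "(\<lambda>n. 1 / Q (orbit_u p n)) \<longlonglongrightarrow> 0"
    by (intro tendsto_divide_0[OF tendsto_const])
  then have "(\<lambda>n. - 1/2 - 1 / Q (orbit_u p n)) \<longlonglongrightarrow> - 1/2 - 0" by (intro tendsto_intros)
  moreover have "- 1/2 - 1 / Q (orbit_u p n) = orbit_u p n" for n
    using Q_inverse(1)[of "orbit_u p n"] orbit_E[OF p, of n] by (simp add: E_iff)
  ultimately show ?thesis by simp
qed

end

section \<open>Spiral and tangent parabolic domains\<close>

lemma parabolic_germ_of_two_jet:
  assumes hol: "holomorphic_C2 P"
    and jet: "has_two_jet_at_0 P (\<lambda>(z, w). (z - z^2, w + w^2 + b * z^2))"
  shows "\<exists>C \<delta>. parabolic_germ P b C \<delta>"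
proof -
  obtain c where c: "0 < c" and ev: "\<forall>\<^sub>F x in nhds 0.
      norm (norm (P x - (case x of (z, w) \<Rightarrow> (z - z^2, w + w^2 + b * z^2)))) \<le> c * norm (norm x ^ 3)"
    using jet unfolding has_two_jet_at_0_def by (rule landau_o.bigE)
  then obtain d where d: "0 < d" and le: "\<And>x. dist x 0 < d \<Longrightarrow>
      norm (norm (P x - (case x of (z, w) \<Rightarrow> (z - z^2, w + w^2 + b * z^2)))) \<le> c * norm (norm x ^ 3)"
    unfolding eventually_nhds_metric by blast
  define D where "D = 2 + cmod b + c"
  have D: "0 < D" using c by (simp add: D_def add_pos_nonneg)
  define \<delta> where "\<delta> = min (d / 2) (min 1 (1 / (2 * D)))"
  have \<delta>: "0 < \<delta>" "\<delta> \<le> d / 2" "\<delta> \<le> 1" "\<delta> \<le> 1 / (2 * D)" using d D by (auto simp: \<delta>_def)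
  have "parabolic_germ P b c \<delta>"
  proof
    have "D * \<delta> \<le> 1/2" using \<delta>(4) D by (simp add: field_simps)
    then show "(2 + cmod b + c) * \<delta> \<le> 1/2" by (simp only: D_def)
    fix x :: C2 assume "norm x \<le> \<delta>"
    then have "dist x 0 < d" using \<delta>(2) d by simp
    from le[OF this]
    show "norm (P x - (fst x - (fst x)\<^sup>2, snd x + (snd x)\<^sup>2 + b * (fst x)\<^sup>2)) \<le> c * norm x ^ 3"
      by (simp add: case_prod_beta)
  qed (use hol \<delta> c in auto)
  then show ?thesis by blast
qed

context parabolic_germ
begin

lemma chart_boundE:
  assumes "0 \<le> U"
  obtains K where "chart_bound U K"
  using chart_step[OF assms] unfolding chart_bound_def by blast

lemma mobius_germI:
  assumes "\<kappa>\<^sup>2 = 1 - 4 * b" "\<kappa> \<noteq> 0" "0 \<le> Re \<kappa>"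
  shows "\<exists>K. mobius_germ P b C \<delta> \<kappa> K"
proof -
  obtain K where "chart_bound (cmod ((-1 - \<kappa>) / 2) + cmod \<kappa>) K"
    by (rule chart_boundE[of "cmod ((-1 - \<kappa>) / 2) + cmod \<kappa>"]) auto
  then have "mobius_germ P b C \<delta> \<kappa> K" using assms by unfold_locales
  then show ?thesis by blast
qed

end

lemma nondegenerate_direction:
  assumes "t\<^sup>2 + t + b = 0"
  shows "nondegenerate_characteristic_direction (P2 b) (1, t)"
proof -
  have "t\<^sup>2 + b = - t" using assms by (simp add: eq_neg_iff_add_eq_0 algebra_simps)
  then have "P2 b (1, t) = cscale (- 1) (1, t)" by (simp add: P2_def cscale_def)
  then show ?thesis
    unfolding nondegenerate_characteristic_direction_def by (auto simp: zero_prod_def intro!: exI[of _ "- 1"])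
qed

theorem theorem1p1:
  fixes b :: complex and P :: "complex \<times> complex \<Rightarrow> complex \<times> complex"
  assumes "holomorphic_C2 P"
    and "has_two_jet_at_0 P (\<lambda>(z, w). (z - z^2, w + w^2 + b * z^2))"
  shows "(b \<in> complex_of_real ` {1/4<..} \<longrightarrow> (\<exists>\<Omega>. spiral_domain P \<Omega>)) \<and>
         (b \<notin> complex_of_real ` {1/4<..} \<longrightarrow>
            (\<exists>\<Omega> v. nondegenerate_characteristic_direction (P2 b) v \<and>
                    parabolic_domain_tangent_to P \<Omega> v))"
proof (intro conjI impI)
  obtain C \<delta> where "parabolic_germ P b C \<delta>" using parabolic_germ_of_two_jet[OF assms] by blast
  then interpret parabolic_germ P b C \<delta> .
  define \<kappa> where "\<kappa> = csqrt (1 - 4 * b)"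
  have \<kappa>: "\<kappa>\<^sup>2 = 1 - 4 * b" by (simp add: \<kappa>_def)
  have Re_ge: "0 \<le> Re \<kappa>" using csqrt_principal[of "1 - 4 * b"] by (auto simp: \<kappa>_def)
  {
    assume "b \<in> complex_of_real ` {1/4<..}"
    then obtain \<beta> :: real where \<beta>: "1/4 < \<beta>" "b = complex_of_real \<beta>" by auto
    have sq: "\<kappa>\<^sup>2 = complex_of_real (1 - 4 * \<beta>)" using \<kappa> \<beta>(2) by simp
    have "Re (\<kappa>\<^sup>2) < 0" "Im (\<kappa>\<^sup>2) = 0" using \<beta>(1) unfolding sq by simp_all
    then have lt: "(Re \<kappa>)\<^sup>2 < (Im \<kappa>)\<^sup>2" and z: "Re \<kappa> * Im \<kappa> = 0"
      by (auto simp: power2_eq_square)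
    have "\<kappa> \<noteq> 0" using lt by auto
    have "Im \<kappa> \<noteq> 0" using lt zero_le_power2[of "Re \<kappa>"] by auto
    then have "Re \<kappa> = 0" using z by simp
    obtain K where "mobius_germ P b C \<delta> \<kappa> K" using mobius_germI[OF \<kappa> \<open>\<kappa> \<noteq> 0\<close> Re_ge] by blast
    then interpret mobius_germ P b C \<delta> \<kappa> K .
    show "\<exists>\<Omega>. spiral_domain P \<Omega>"
      using exists_nonconvergent_orbit[OF \<open>Re \<kappa> = 0\<close>] exists_spiral_domain by blast
  next
    assume nb: "b \<notin> complex_of_real ` {1/4<..}"
    show "\<exists>\<Omega> v. nondegenerate_characteristic_direction (P2 b) v \<and> parabolic_domain_tangent_to P \<Omega> v"
    proof (cases "\<kappa> = 0")
      case True
      have "b = (4 * b) / 4" by simp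
      also have "4 * b = 1" using \<kappa> True by simp
      finally have b: "b = 1/4" .
      obtain K where "chart_bound (3/2) K" by (rule chart_boundE[of "3/2"]) auto
      then interpret double_root_germ P b C \<delta> K using b by unfold_locales
      have "nondegenerate_characteristic_direction (P2 b) (1, - 1/2)"
        by (rule nondegenerate_direction) (simp add: b power2_eq_square)
      then show ?thesis using exists_tangent_parabolic_domain[OF orbit_converges] by blast
    next
      case False
      have "Re \<kappa> \<noteq> 0"
      proof
        assume "Re \<kappa> = 0"
        then have "Im (\<kappa>\<^sup>2) = 0" "Re (\<kappa>\<^sup>2) = - ((Im \<kappa>)\<^sup>2)" by (simp_all add: power2_eq_square)
        then have "Im b = 0" "1 - 4 * Re b = - ((Im \<kappa>)\<^sup>2)" unfolding \<kappa> by simp_all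
        moreover have "0 < (Im \<kappa>)\<^sup>2" using False \<open>Re \<kappa> = 0\<close> by (simp add: complex_eq_iff)
        ultimately have "Im b = 0" "1/4 < Re b" by linarith+
        then have "b = complex_of_real (Re b)" "Re b \<in> {1/4<..}" by (simp_all add: complex_eq_iff)
        then show False using nb by (metis imageI)
      qed
      then have pos: "0 < Re \<kappa>" using Re_ge by simp
      obtain K where "mobius_germ P b C \<delta> \<kappa> K" using mobius_germI[OF \<kappa> False Re_ge] by blast
      then interpret mobius_germ P b C \<delta> \<kappa> K .
      have "nondegenerate_characteristic_direction (P2 b) (1, t_minus)"
        by (rule nondegenerate_direction) (simp add: quadratic_factor)
      then show ?thesis using exists_tangent_parabolic_domain[OF orbit_converges[OF pos]] by blast
    qed
  }
qed

end
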